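(* Let $\psi\in P\cap B$, $1\le s<\infty$ and $\beta\in\mathbb{R}$. Then $$e^{\perp}_{2n}(L^{\psi}_{\beta,\infty})_s\asymp e^{\perp}_{2n-1}(L^{\psi}_{\beta,\infty})_s\asymp\psi(n),$$ that is, there exist positive constants $K_1,K_2$, independent of $n$, such that for all $n\in\mathbb{N}$ $$K_1\psi(n)\le e^{\perp}_{2n}(L^{\psi}_{\beta,\infty})_s\le K_2\psi(n)\quad\text{and}\quad K_1\psi(n)\le e^{\perp}_{2n-1}(L^{\psi}_{\beta,\infty})_s\le K_2\psi(n).$$
   Context: Spaces. For $1\le p<\infty$, $L_p$ is the space of $2\pi$-periodic functions $f:\mathbb{R}\to\mathbb{C}$ summable to the power $p$ on $[0,2\pi)$, with norm $\|f\|_p=\left(\int_0^{2\pi}|f(t)|^p\,dt\right)^{1/p}$; $L_\infty$ is the space of $2\pi$-periodic measurable essentially bounded functions with $\|f\|_\infty=\operatorname{ess\,sup}_t|f(t)|$. Fourier coefficients are $\hat f(k)=\frac1{2\pi}\int_{-\pi}^{\pi}f(t)e^{-ikt}\,dt$, $k\in\mathbb{Z}$. $\mathbb{N}=\{1,2,\dots\}$. $(\psi,\beta)$-derivative. Let $\psi(k)$, $k\in\mathbb{N}$, be a sequence of positive numbers, $\beta\in\mathbb{R}$, and $f\in L_1$ real-valued. If the series $$\sum_{k\in\mathbb{Z}\setminus\{0\}}\frac{\hat f(k)}{\psi(|k|)}e^{i\left(kx+\frac{\beta\pi}{2}\operatorname{sign}k\right)}$$ is the Fourier series of some function in $L_1$,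 that function is called the $(\psi,\beta)$-derivative of $f$ and is denoted $f^\psi_\beta$. Class $L^\psi_{\beta,\infty}$. It is the set of all real-valued $f\in L_1$ whose $(\psi,\beta)$-derivative exists and satisfies $\|f^\psi_\beta\|_\infty\le 1$. Best orthogonal trigonometric approximation. For $m\in\mathbb{N}$, $$e^\perp_m(f)_s=\inf_{\gamma_m}\Big\|f-\sum_{k\in\gamma_m}\hat f(k)e^{ik\cdot}\Big\|_s,\qquad e^\perp_m(L^\psi_{\beta,\infty})_s=\sup_{f\in L^\psi_{\beta,\infty}}e^\perp_m(f)_s,$$ where the infimum is over all sets $\gamma_m$ of $m$ (distinct) integers. Set $P$. $P$ is the set of positive sequences $\psi(k)$, $k\ge1$, that are almost decreasing (there is a constant $M>0$ with $\psi(k_2)\le M\psi(k_1)$ whenever $k_1\le k_2$) and for which there is a constant $K$, independent of $n$, such that for all $n\in\mathbb{N}$ $$\sup_{m\in\mathbb{N}}\sum_{k=2^m}^{2^{m+1}}|\psi_n(k+1)-\psi_n(k)|\le K\psi(n),$$ where $\psi_n(k)=0$ for $k<n$ and $\psi_n(k)=\psi(k)$ for $k\ge n$. Set $B$. $B$ is the set of positive sequences $\psi(k)$, $k\in\mathbb{N}$, for which there is a constant $K>0$ with $\psi(k)/\psi(2k)\le K$ for all $k\in\mathbb{N}$. For positive sequences, $A(n)\asymp B(n)$ means that there are positive constants $K_1,K_2$ with $K_1B(n)\le A(n)\le K_2B(n)$ for all $n\in\mathbb{N}$. *)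

theory Defs
  imports "HOL-Analysis.Analysis" "HOL-Probability.Essential_Supremum"
begin

text \<open>Complex-valued functions on the line that are Lebesgue measurable, periodic with period
  \<open>2 * pi\<close>, and summable to the power \<open>p\<close> over one period (meant for \<open>1 \<le> p < \<infinity>\<close>).\<close>

definition Lp :: "real \<Rightarrow> (real \<Rightarrow> complex) set" where
  "Lp p = {f. (\<forall>t. f (t + 2 * pi) = f t) \<and> f \<in> borel_measurable lebesgue \<and>
              set_integrable lebesgue {0..<2 * pi} (\<lambda>t. cmod (f t) powr p)}"

text \<open>The norms take the value \<open>\<infinity>\<close> where the classical norm is not finite: an element of
  \<open>Lp 1\<close> need not belong to \<open>Lp s\<close>, and the Bochner integral alone would yield \<open>0\<close> there.\<close>

definition Lp_norm :: "real \<Rightarrow> (real \<Rightarrow> complex) \<Rightarrow> ennreal" where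
  "Lp_norm p f =
     (if set_integrable lebesgue {0..<2 * pi} (\<lambda>t. cmod (f t) powr p)
      then ennreal ((LINT t:{0..<2 * pi}|lebesgue. cmod (f t) powr p) powr (1 / p))
      else \<infinity>)"

definition Linf_norm :: "(real \<Rightarrow> complex) \<Rightarrow> ennreal" where
  "Linf_norm f = esssup lebesgue (\<lambda>t. ennreal (cmod (f t)))"

definition fourier_coeff :: "(real \<Rightarrow> complex) \<Rightarrow> int \<Rightarrow> complex" where
  "fourier_coeff f k =
     1 / (2 * of_real pi) *
     (LINT t:{-pi..pi}|lebesgue. f t * exp (- \<i> * of_int k * of_real t))"

text \<open>\<open>g\<close> is a \<open>(\<psi>, \<beta>)\<close>-derivative of \<open>f\<close>. That a trigonometric series is the Fourier series
  of \<open>g\<close> means that its coefficients are the Fourier coefficients of \<open>g\<close>; the series in question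
  has no term of index \<open>0\<close>. The derivative is determined only almost everywhere, hence a relation.
  Sequences indexed by the positive integers are functions on \<^typ>\<open>nat\<close> whose value
  at \<open>0\<close> is never used.\<close>

definition is_psi_derivative ::
  "(nat \<Rightarrow> real) \<Rightarrow> real \<Rightarrow> (real \<Rightarrow> complex) \<Rightarrow> (real \<Rightarrow> complex) \<Rightarrow> bool" where
  "is_psi_derivative \<psi> \<beta> f g \<longleftrightarrow>
     g \<in> Lp 1 \<and>
     (\<forall>k. fourier_coeff g k =
        (if k = 0 then 0
         else fourier_coeff f k / of_real (\<psi> (nat \<bar>k\<bar>)) *
              exp (\<i> * of_real (\<beta> * pi / 2 * of_int (sgn k)))))"

definition class_L :: "(nat \<Rightarrow> real) \<Rightarrow> real \<Rightarrow> (real \<Rightarrow> complex) set" where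
  "class_L \<psi> \<beta> = {f \<in> Lp 1. (\<forall>t. f t \<in> \<real>) \<and>
                     (\<exists>g. is_psi_derivative \<psi> \<beta> f g \<and> Linf_norm g \<le> 1)}"

definition best_orth_approx :: "nat \<Rightarrow> (real \<Rightarrow> complex) \<Rightarrow> real \<Rightarrow> ennreal" where
  "best_orth_approx m f s =
     (INF \<gamma> \<in> {\<gamma> :: int set. finite \<gamma> \<and> card \<gamma> = m}.
        Lp_norm s (\<lambda>t. f t - (\<Sum>k\<in>\<gamma>. fourier_coeff f k * exp (\<i> * of_int k * of_real t))))"

definition best_orth_approx_class :: "nat \<Rightarrow> (real \<Rightarrow> complex) set \<Rightarrow> real \<Rightarrow> ennreal" where
  "best_orth_approx_class m F s = (SUP f \<in> F. best_orth_approx m f s)"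

definition almost_decreasing :: "(nat \<Rightarrow> real) \<Rightarrow> bool" where
  "almost_decreasing \<psi> \<longleftrightarrow>
     (\<exists>M>0. \<forall>k1 k2. 1 \<le> k1 \<and> k1 \<le> k2 \<longrightarrow> \<psi> k2 \<le> M * \<psi> k1)"

definition cut_below :: "(nat \<Rightarrow> real) \<Rightarrow> nat \<Rightarrow> nat \<Rightarrow> real" where
  "cut_below \<psi> n k = (if k < n then 0 else \<psi> k)"

definition class_P :: "(nat \<Rightarrow> real) set" where
  "class_P = {\<psi>. (\<forall>k\<ge>1. 0 < \<psi> k) \<and> almost_decreasing \<psi> \<and>
     (\<exists>K::real. \<forall>n\<ge>1.
        (SUP m \<in> {1..}. ereal (\<Sum>k = 2 ^ m..2 ^ (m + 1).
           \<bar>cut_below \<psi> n (k + 1) - cut_below \<psi> n k\<bar>)) \<le> ereal (K * \<psi> n))}"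

definition class_B :: "(nat \<Rightarrow> real) set" where
  "class_B = {\<psi>. (\<forall>k\<ge>1. 0 < \<psi> k) \<and> (\<exists>K>0. \<forall>k\<ge>1. \<psi> k / \<psi> (2 * k) \<le> K)}"

end

theory Submission
  imports Defs
begin

text \<open>Upper bound. Choosing \<open>\<gamma>\<close> as the symmetric interval of frequencies below \<open>n\<close>, the remainder is the image of
  the \<open>(\<psi>, \<beta>)\<close>-derivative \<open>g\<close>, \<open>\<bar>g\<bar> \<le> 1\<close>, under a multiplier whose variation over every dyadic block is
  \<open>O(\<psi> n)\<close>. It suffices to bound it in \<open>L\<^sub>2\<^sub>r\<close> for an integer \<open>r\<close>, and for these exponents the
  Marcinkiewicz multiplier theorem from \<open>L\<^sub>\<infinity>\<close> to \<open>L\<^sub>2\<^sub>r\<close> has an elementary proof on trigonometric polynomials: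
  M. Riesz' argument works verbatim for \<open>\<ell>\<^sub>2\<close>-valued functions, and removes the multiplier from the blocks after an
  Abel summation; the square function of \<open>g\<close> is bounded by summing the top frequency first, against a weight
  of low degree; and the sum of the blocks is bounded by the square function through orthogonality of the
  increments of \<open>r\<close>-th powers. Fejer means and Fatou's lemma pass to general \<open>g\<close>.

  Lower bound. A Rudin-Shapiro polynomial of length comparable to \<open>n\<close> is flat and has flat coefficients, so
  removing \<open>2 n\<close> of its coefficients cannot make the \<open>L\<^sub>1\<close>-norm small.\<close>


subsection \<open>Trigonometric polynomials and their mean value\<close>

text \<open>\<open>class_P\<close> controls the variation of the cut sequence on each dyadic block
  but not its total variation, which may be infinite. Sharp blocks behave badly on bounded
  functions, since their kernels are not bounded in \<open>L\<^sub>1\<close>. So the square function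
  is estimated for smooth, overlapping blocks built from Fejer means, which are averages against a
  positive kernel, and the sharp partial sums are cut out of the smooth blocks afterwards by the
  Riesz projection. With an even exponent every norm is the mean of a polynomial expression, and
  disjointness of spectra does the work of real-variable theory. The number \<open>\<beta>\<close>
  contributes only a constant of modulus one on each half-line of frequencies, which is harmless
  once the series is split into two one-sided sums. Up to the multiplier theorem all constants
  depend on the exponent alone.\<close>

abbreviation circle :: "real measure" where
  "circle \<equiv> lebesgue_on {-pi..pi}"

abbreviation fc :: "(real \<Rightarrow> complex) \<Rightarrow> int \<Rightarrow> complex" where
  "fc \<equiv> fourier_coeff"

abbreviation abs2 :: "complex \<Rightarrow> real" where
  "abs2 z \<equiv> (cmod z)\<^sup>2"

definition ex :: "int \<Rightarrow> real \<Rightarrow> complex" where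
  "ex k t = exp (\<i> * of_int k * of_real t)"

definition mean :: "(real \<Rightarrow> 'a) \<Rightarrow> 'a :: euclidean_space" where
  "mean f = (1 / (2 * pi)) *\<^sub>R integral\<^sup>L circle f"

lemma ex_0 [simp]: "ex 0 t = 1"
  by (simp add: ex_def)

lemma ex_add: "ex (j + k) t = ex j t * ex k t"
  by (simp add: ex_def exp_add [symmetric] algebra_simps)

lemma ex_minus: "ex (- k) t = cnj (ex k t)"
  by (simp add: ex_def exp_cnj)

lemma ex_diff_arg: "ex k (x - t) = ex k x * ex (- k) t"
  by (simp add: ex_def exp_add [symmetric] algebra_simps)

lemma norm_ex [simp]: "cmod (ex k t) = 1"
  by (simp add: ex_def)

lemma ex_mult_cnj [simp]: "ex k t * cnj (ex k t) = 1"
  by (metis ex_0 ex_add ex_minus add.right_inverse)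

lemma ex_periodic: "ex k (t + 2 * pi) = ex k t"
proof -
  have "ex k (2 * pi) = 1"
    using exp_integer_2pi [of "of_int k"] by (simp add: ex_def mult_ac)
  then show ?thesis unfolding ex_def of_real_add ring_distribs exp_add by simp
qed

lemma cont_ex [continuous_intros]: "continuous_on S (ex k)"
  unfolding ex_def by (intro continuous_intros)

lemma cont_integrable:
  fixes f :: "real \<Rightarrow> 'a :: euclidean_space"
  shows "continuous_on UNIV f \<Longrightarrow> integrable circle f"
  by (intro continuous_imp_integrable_real) (metis continuous_on_subset subset_UNIV)

lemma mean_add:
  fixes f g :: "real \<Rightarrow> 'a :: euclidean_space"
  assumes "continuous_on UNIV f" "continuous_on UNIV g"
  shows "mean (\<lambda>x. f x + g x) = mean f + mean g"
  using assms by (simp add: mean_def cont_integrable scaleR_right_distrib)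

lemma mean_diff:
  fixes f g :: "real \<Rightarrow> 'a :: euclidean_space"
  assumes "continuous_on UNIV f" "continuous_on UNIV g"
  shows "mean (\<lambda>x. f x - g x) = mean f - mean g"
  using assms by (simp add: mean_def cont_integrable scaleR_right_diff_distrib)

lemma mean_sum:
  fixes f :: "'i \<Rightarrow> real \<Rightarrow> 'a :: euclidean_space"
  assumes "\<And>i. i \<in> I \<Longrightarrow> continuous_on UNIV (f i)"
  shows "mean (\<lambda>x. \<Sum>i\<in>I. f i x) = (\<Sum>i\<in>I. mean (f i))"
  using assms by (simp add: mean_def cont_integrable scaleR_sum_right)

lemma mean_cmult:
  fixes f :: "real \<Rightarrow> complex"
  shows "mean (\<lambda>x. c * f x) = c * mean f"
  by (simp add: mean_def)

lemma mean_rmult: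
  fixes f :: "real \<Rightarrow> real"
  shows "mean (\<lambda>x. c * f x) = c * mean f"
  by (simp add: mean_def)

lemma mean_const [simp]: "mean (\<lambda>x. c) = (c :: 'a :: euclidean_space)"
  by (simp add: mean_def measure_restrict_space)

lemma mean_mono:
  fixes f g :: "real \<Rightarrow> real"
  assumes "continuous_on UNIV f" "continuous_on UNIV g" "\<And>x. f x \<le> g x"
  shows "mean f \<le> mean g"
  unfolding mean_def using assms
  by (auto intro!: divide_right_mono integral_mono cont_integrable)

lemma mean_nonneg:
  fixes f :: "real \<Rightarrow> real"
  assumes "\<And>x. 0 \<le> f x"
  shows "0 \<le> mean f"
  unfolding mean_def using assms by (auto intro!: mult_nonneg_nonneg integral_nonneg_AE)

lemma mean_Re:
  assumes "continuous_on UNIV f"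
  shows "mean (\<lambda>x. Re (f x)) = Re (mean f)"
  using assms by (simp add: mean_def cont_integrable)

lemma mean_of_real:
  fixes f :: "real \<Rightarrow> real"
  assumes "continuous_on UNIV f"
  shows "mean (\<lambda>x. complex_of_real (f x)) = of_real (mean f)"
  using assms by (simp add: mean_def cont_integrable scaleR_conv_of_real)

lemma mean_cnj: "mean (\<lambda>x. cnj (f x)) = cnj (mean f)"
  by (simp add: mean_def integral_cnj)

lemma norm_mean_le:
  fixes f :: "real \<Rightarrow> complex"
  shows "norm (mean f) \<le> mean (\<lambda>x. norm (f x))"
  by (simp add: mean_def divide_right_mono)

lemma has_integral_ex:
  assumes "k \<noteq> 0"
  shows "(ex k has_integral 0) {-pi..pi}"
proof -
  have "((\<lambda>t. ex k t) has_integral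
      (ex k pi / (\<i> * of_int k) - ex k (-pi) / (\<i> * of_int k))) {-pi..pi}"
    using assms unfolding ex_def
    by (intro fundamental_theorem_of_calculus
          has_vector_derivative_real_field [where f = "\<lambda>z. exp (\<i> * of_int k * z) / (\<i> * of_int k)"])
       (auto intro!: derivative_eq_intros)
  moreover have "ex k pi = ex k (-pi)"
    using ex_periodic [of k "-pi"] by simp
  ultimately show ?thesis by simp
qed

lemma mean_ex: "mean (ex k) = (if k = 0 then 1 else 0)"
proof (cases "k = 0")
  case True
  then have "ex k = (\<lambda>_. 1)" by auto
  with True show ?thesis by simp
next
  case False
  have "integral\<^sup>L circle (ex k) = integral {-pi..pi} (ex k)"
    by (intro lebesgue_integral_eq_integral cont_integrable continuous_intros) auto
  with False has_integral_ex [OF False] show ?thesis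
    by (simp add: mean_def integral_unique)
qed

text \<open>Trigonometric polynomials are encoded by an upper bound for their spectrum.
  \<open>A\<close> may be infinite, typically a half-line, so that products and orthogonality are
  settled by set arithmetic on spectra; a frequency may be added repeatedly, so no normal form is
  involved.\<close>

inductive_set tp :: "int set \<Rightarrow> (real \<Rightarrow> complex) set" for A where
  zero: "(\<lambda>x. 0) \<in> tp A"
| add: "f \<in> tp A \<Longrightarrow> k \<in> A \<Longrightarrow> (\<lambda>x. c * ex k x + f x) \<in> tp A"

lemma tp_cont: "f \<in> tp A \<Longrightarrow> continuous_on S f"
  by (induction rule: tp.induct) (auto intro!: continuous_intros)

lemma tp_mono: "f \<in> tp A \<Longrightarrow> A \<subseteq> B \<Longrightarrow> f \<in> tp B"
  by (induction rule: tp.induct) (auto intro: tp.intros)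

lemma tp_ex: "k \<in> A \<Longrightarrow> (\<lambda>x. c * ex k x) \<in> tp A"
  using tp.add [OF tp.zero, of k A c] by simp

lemma tp_const: "0 \<in> A \<Longrightarrow> (\<lambda>x. c) \<in> tp A"
  using tp_ex [of 0 A c] by simp

lemma tp_add: "f \<in> tp A \<Longrightarrow> g \<in> tp A \<Longrightarrow> (\<lambda>x. f x + g x) \<in> tp A"
  by (induction rule: tp.induct) (auto intro: tp.intros simp: add.assoc)

lemma tp_cmult: "f \<in> tp A \<Longrightarrow> (\<lambda>x. c * f x) \<in> tp A"
proof (induction rule: tp.induct)
  case (add f k d)
  then show ?case
    using tp.add [of "\<lambda>x. c * f x" A k "c * d"] by (simp add: algebra_simps)
qed (auto intro: tp.intros)

lemma tp_diff: "f \<in> tp A \<Longrightarrow> g \<in> tp A \<Longrightarrow> (\<lambda>x. f x - g x) \<in> tp A"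
  using tp_add [of f A "\<lambda>x. (-1) * g x"] tp_cmult [of g A "-1"] by simp

lemma tp_sum: "(\<And>i. i \<in> I \<Longrightarrow> f i \<in> tp A) \<Longrightarrow> (\<lambda>x. \<Sum>i\<in>I. f i x) \<in> tp A"
  by (induction I rule: infinite_finite_induct) (auto intro: tp.zero tp_add)

lemma tp_ex_mult: "f \<in> tp A \<Longrightarrow> (\<lambda>x. ex j x * f x) \<in> tp ((+) j ` A)"
proof (induction rule: tp.induct)
  case (add f k c)
  then show ?case
    using tp.add [of "\<lambda>x. ex j x * f x" "(+) j ` A" "j + k" c]
    by (simp add: algebra_simps ex_add)
qed (auto intro: tp.intros)

lemma tp_mult:
  assumes "f \<in> tp A" "g \<in> tp B" "\<And>a b. a \<in> A \<Longrightarrow> b \<in> B \<Longrightarrow> a + b \<in> C"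
  shows "(\<lambda>x. f x * g x) \<in> tp C"
  using assms(1)
proof (induction rule: tp.induct)
  case zero
  then show ?case by (auto intro: tp.zero)
next
  case (add f k c)
  have "(\<lambda>x. c * (ex k x * g x)) \<in> tp C"
    by (rule tp_cmult, rule tp_mono [OF tp_ex_mult [OF assms(2)]]) (use add assms(3) in auto)
  from tp_add [OF this add.IH] show ?case
    by (simp add: algebra_simps)
qed

lemma tp_cnj:
  assumes "f \<in> tp A" "\<And>a. a \<in> A \<Longrightarrow> - a \<in> B"
  shows "(\<lambda>x. cnj (f x)) \<in> tp B"
  using assms(1)
proof (induction rule: tp.induct)
  case (add f k c)
  then show ?case
    using tp.add [of "\<lambda>x. cnj (f x)" B "- k" "cnj c"] assms(2) by (simp add: ex_minus)
qed (auto intro: tp.intros)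

lemma tp_finite_spectrum: "f \<in> tp A \<Longrightarrow> \<exists>S. finite S \<and> S \<subseteq> A \<and> f \<in> tp S"
proof (induction rule: tp.induct)
  case (add f k c)
  then obtain S where "finite S" "S \<subseteq> A" "f \<in> tp S" by auto
  then show ?case
    using add by (intro exI [of _ "insert k S"]) (auto intro: tp.add tp_mono)
qed (auto intro: tp.zero)

lemma tp_bounded_degree:
  assumes "f \<in> tp A" shows "\<exists>n. f \<in> tp {- int n<..<int n}"
proof -
  obtain S where S: "finite S" "f \<in> tp S" using tp_finite_spectrum [OF assms] by auto
  define n where "n = nat (\<Sum>k\<in>S. \<bar>k\<bar>) + 1"
  have "\<bar>k\<bar> < int n" if "k \<in> S" for k
    using member_le_sum [of k S abs] that S by (auto simp: n_def)
  then have "S \<subseteq> {- int n<..<int n}" by (force simp: abs_less_iff)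
  with S show ?thesis by (meson tp_mono)
qed

lemma mean_tp_zero:
  assumes "f \<in> tp A" "0 \<notin> A" shows "mean f = 0"
  using assms(1)
proof (induction rule: tp.induct)
  case (add f k c)
  then show ?case
    using assms(2) mean_add [OF tp_cont [OF tp_ex [OF add(2)]] tp_cont [OF add(1)]]
    by (auto simp: mean_cmult mean_ex)
qed (auto simp: mean_def)

lemma mean_orthogonal:
  assumes "f \<in> tp A" "g \<in> tp B" "A \<inter> B = {}"
  shows "mean (\<lambda>x. f x * cnj (g x)) = 0"
proof (rule mean_tp_zero)
  show "(\<lambda>x. f x * cnj (g x)) \<in> tp {a - b |a b. a \<in> A \<and> b \<in> B}"
    by (rule tp_mult [OF assms(1) tp_cnj [OF assms(2), of "uminus ` B"]]) force+
  show "0 \<notin> {a - b |a b. a \<in> A \<and> b \<in> B}"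
    using assms(3) by auto
qed

lemma norm_add_squared: "abs2 (a + b) = abs2 a + abs2 b + 2 * Re (a * cnj b)"
  by (simp only: cmod_power2) (simp add: algebra_simps power2_eq_square)

lemma mean_pythagoras:
  assumes "f \<in> tp A" "g \<in> tp B" "A \<inter> B = {}"
  shows "mean (\<lambda>x. abs2 (f x + g x)) = mean (\<lambda>x. abs2 (f x)) + mean (\<lambda>x. abs2 (g x))"
proof -
  note c = tp_cont [OF assms(1)] tp_cont [OF assms(2)]
  have "mean (\<lambda>x. Re (f x * cnj (g x))) = 0"
    by (subst mean_Re) (auto intro!: continuous_intros c simp: mean_orthogonal [OF assms])
  then show ?thesis
    unfolding norm_add_squared
    by (simp add: mean_add mean_rmult continuous_intros c)
qed

subsection \<open>Fourier coefficients of trigonometric polynomials\<close>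

lemma fourier_coeff_eq_mean: "fc f k = mean (\<lambda>t. f t * ex (- k) t)"
  by (simp add: fourier_coeff_def mean_def set_lebesgue_integral_def integral_restrict_space
      ex_def scaleR_conv_of_real)

lemma fc_add:
  assumes "f \<in> tp A" "g \<in> tp B"
  shows "fc (\<lambda>x. f x + g x) k = fc f k + fc g k"
  unfolding fourier_coeff_eq_mean ring_distribs
  by (intro mean_add continuous_intros tp_cont [OF assms(1)] tp_cont [OF assms(2)])

lemma fc_ex: "fc (\<lambda>x. c * ex j x) k = (if j = k then c else 0)"
proof -
  have "fc (\<lambda>x. c * ex j x) k = mean (\<lambda>x. c * ex (j - k) x)"
    by (simp add: fourier_coeff_eq_mean mult.assoc flip: ex_add)
  then show ?thesis
    by (simp only: mean_cmult mean_ex) auto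
qed

lemma fc_zero [simp]: "fc (\<lambda>x. 0) k = 0"
  by (simp add: fourier_coeff_eq_mean)

lemma fc_outside:
  assumes "f \<in> tp A" "k \<notin> A" shows "fc f k = 0"
  using assms(1)
proof (induction rule: tp.induct)
  case (add f j c)
  then show ?case
    using assms(2) by (subst fc_add [OF tp_ex [of j A]]) (auto simp: fc_ex)
qed simp

lemma tp_expansion:
  assumes "f \<in> tp A" "finite A"
  shows "f x = (\<Sum>k\<in>A. fc f k * ex k x)"
  using assms(1)
proof (induction rule: tp.induct)
  case (add f j c)
  have "(\<Sum>k\<in>A. fc (\<lambda>x. c * ex j x + f x) k * ex k x)
      = (\<Sum>k\<in>A. (if j = k then c * ex k x else 0)) + f x"
    unfolding add.IH
    by (subst fc_add [OF tp_ex add.hyps(1), of j A])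
       (auto simp: add fc_ex algebra_simps sum.distrib intro!: sum.cong)
  then show ?case using add assms(2) by simp
qed simp

lemma fc_sum_ex:
  assumes "finite A"
  shows "fc (\<lambda>x. \<Sum>k\<in>A. c k * ex k x) j = (if j \<in> A then c j else 0)"
  using assms
proof (induction A rule: finite_induct)
  case (insert a A)
  have "fc (\<lambda>x. \<Sum>k\<in>insert a A. c k * ex k x) j
      = fc (\<lambda>x. c a * ex a x) j + fc (\<lambda>x. \<Sum>k\<in>A. c k * ex k x) j"
    using fc_add [of "\<lambda>x. c a * ex a x" UNIV "\<lambda>x. \<Sum>k\<in>A. c k * ex k x" UNIV j] insert
    by (simp add: tp_ex tp_sum)
  then show ?case using insert by (auto simp: fc_ex)
qed simp

lemma tp_sum_ex: "A \<subseteq> B \<Longrightarrow> (\<lambda>x. \<Sum>k\<in>A. c k * ex k x) \<in> tp B"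
  by (intro tp_sum tp_ex) auto

lemma parseval_sum:
  assumes "finite A"
  shows "mean (\<lambda>x. (\<Sum>k\<in>A. c k * ex k x) * cnj (\<Sum>k\<in>A. d k * ex k x)) = (\<Sum>k\<in>A. c k * cnj (d k))"
proof -
  have *: "c k * ex k x * cnj (\<Sum>k\<in>A. d k * ex k x) = 
     c k * cnj ((\<Sum>j\<in>A. d j * ex j x) * ex (- k) x)" for k x
    by (simp add: ex_minus)
  have "mean (\<lambda>x. (\<Sum>k\<in>A. c k * ex k x) * cnj (\<Sum>k\<in>A. d k * ex k x))
     = (\<Sum>k\<in>A. mean (\<lambda>x. c k * cnj ((\<Sum>j\<in>A. d j * ex j x) * ex (- k) x)))"
    unfolding sum_distrib_right * by (intro mean_sum continuous_intros)
  also have "\<dots> = (\<Sum>k\<in>A. c k * cnj (d k))"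
    unfolding mean_cmult mean_cnj fourier_coeff_eq_mean [symmetric]
    using assms by (intro sum.cong) (auto simp: fc_sum_ex)
  finally show ?thesis .
qed

lemma parseval_norm:
  assumes "finite A"
  shows "mean (\<lambda>x. abs2 (\<Sum>k\<in>A. c k * ex k x)) = (\<Sum>k\<in>A. abs2 (c k))"
proof -
  have "complex_of_real (mean (\<lambda>x. abs2 (\<Sum>k\<in>A. c k * ex k x)))
     = of_real (\<Sum>k\<in>A. abs2 (c k))"
    by (subst mean_of_real [symmetric])
       (auto intro!: continuous_intros simp: complex_norm_square parseval_sum [OF assms] simp del: cnj_sum of_real_power)
  then show ?thesis using of_real_eq_iff by blast
qed

lemma parseval:
  assumes "f \<in> tp A" "finite A"
  shows "mean (\<lambda>x. abs2 (f x)) = (\<Sum>k\<in>A. abs2 (fc f k))"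
proof -
  have "f = (\<lambda>x. \<Sum>k\<in>A. fc f k * ex k x)"
    using tp_expansion [OF assms] by blast
  then have "mean (\<lambda>x. abs2 (f x)) = mean (\<lambda>x. abs2 (\<Sum>k\<in>A. fc f k * ex k x))"
    by metis
  also note parseval_norm [OF assms(2)]
  finally show ?thesis .
qed


subsection \<open>Vector-valued Riesz projection\<close>

lemma norm_power_diff_le:
  fixes x y :: complex
  assumes "cmod x \<le> B" "cmod y \<le> B"
  shows "cmod (x ^ r - y ^ r) \<le> cmod (x - y) * (r * B ^ (r - 1))"
proof -
  have B: "0 \<le> B" using assms(1) norm_ge_zero order_trans by blast
  have "cmod (\<Sum>i<r. y ^ (r - Suc i) * x ^ i) \<le> (\<Sum>i<r. B ^ (r - 1))"
  proof (rule sum_norm_le)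
    fix i assume "i \<in> {..<r}"
    then have "r - 1 = (r - Suc i) + i" by auto
    then have "B ^ (r - 1) = B ^ (r - Suc i) * B ^ i" by (metis power_add)
    then show "cmod (y ^ (r - Suc i) * x ^ i) \<le> B ^ (r - 1)"
      using assms B by (auto simp: norm_mult norm_power intro!: mult_mono power_mono)
  qed
  then show ?thesis
    by (simp add: power_diff_sumr2 norm_mult mult_left_mono)
qed

text \<open>If \<open>E\<close> is small against \<open>X\<close>, the complex number is a small
  relative perturbation of \<open>X\<close>, and the real part of its power keeps half of
  \<open>X ^ r\<close>. Otherwise \<open>X ^ r\<close> and the modulus of the power are both
  \<open>O(E ^ r)\<close> and are paid for by \<open>C\<close>. This is the pointwise inequality on
  which M. Riesz' argument rests.\<close>

lemma riesz_pointwise: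
  "\<exists>C\<ge>0. \<forall>X E t :: real. 0 \<le> X \<longrightarrow> 0 \<le> E \<longrightarrow> \<bar>t\<bar> \<le> sqrt E * sqrt X \<longrightarrow>
      X ^ r / 2 - C * E ^ r \<le> Re (Complex (X - E) (2 * t) ^ r)"
proof -
  \<comment> \<open>For \<open>E \<le> \<eta>\<^sup>2 * X\<close> one gets
    \<open>cmod (z - X) \<le> 3 * \<eta> * X\<close> and \<open>cmod z \<le> 4 * X\<close>;
    \<open>\<eta>\<close> makes the resulting relative error \<open>3 * \<eta> * r * 4 ^ r\<close>
    of the power at most 1/2. The summand 1 keeps the denominator positive for
    \<open>r = 0\<close>.\<close>
  define \<eta> :: real where "\<eta> = 1 / (6 * r * 4 ^ r + 1)"
  have \<eta>: "0 < \<eta>" "\<eta> \<le> 1" by (auto simp: \<eta>_def field_simps add_pos_nonneg)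
  have \<eta>r: "3 * \<eta> * (r * 4 ^ r) \<le> 1 / 2"
    by (simp add: \<eta>_def field_simps add_pos_nonneg)
  \<comment> \<open>In the complementary case \<open>X \<le> E / \<eta>\<^sup>2\<close>, so
    \<open>cmod z \<le> 2 * (E + X) \<le> c * E\<close>.\<close>
  define c where "c = 2 * (1 + 1 / \<eta>\<^sup>2)"
  show ?thesis
  proof (intro exI [of _ "2 * c ^ r"] conjI allI impI)
    show "0 \<le> 2 * c ^ r" using \<eta> by (simp add: c_def)
    fix X E t :: real
    assume X: "0 \<le> X" and E: "0 \<le> E" and t: "\<bar>t\<bar> \<le> sqrt E * sqrt X"
    define z where "z = Complex (X - E) (2 * t)"
    have zX: "cmod (z - of_real X) \<le> E + 2 * (sqrt E * sqrt X)"
    proof -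
      have "cmod (z - of_real X) \<le> \<bar>Re (z - of_real X)\<bar> + \<bar>Im (z - of_real X)\<bar>"
        by (rule cmod_le)
      then show ?thesis using t E by (simp add: z_def)
    qed
    show "X ^ r / 2 - 2 * c ^ r * E ^ r \<le> Re (z ^ r)"
    proof (cases "E \<le> \<eta>\<^sup>2 * X")
      case True
      have "sqrt E \<le> sqrt (\<eta>\<^sup>2 * X)" using True by simp
      also have "\<dots> = \<eta> * sqrt X" using \<eta> by (simp add: real_sqrt_mult)
      finally have "sqrt E * sqrt X \<le> \<eta> * sqrt X * sqrt X"
        using X by (intro mult_right_mono) auto
      then have 1: "sqrt E * sqrt X \<le> \<eta> * X" using X by (simp add: mult.assoc)
      have "\<eta>\<^sup>2 * X \<le> \<eta> * X"
        using \<eta> X by (intro mult_right_mono) (auto simp: power2_eq_square mult_left_le)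
      with 1 True zX have w: "cmod (z - of_real X) \<le> 3 * \<eta> * X" by linarith
      have w3: "3 * \<eta> * X \<le> 3 * X" using \<eta> X by (simp add: mult_left_le_one_le)
      have "cmod z \<le> cmod (z - of_real X) + cmod (of_real X)"
        by (metis diff_add_cancel norm_triangle_ineq)
      then have z4: "cmod z \<le> 4 * X" using w w3 X by simp
      have "cmod (z ^ r - of_real X ^ r) \<le> cmod (z - of_real X) * (r * (4 * X) ^ (r - 1))"
        by (rule norm_power_diff_le) (use z4 X in auto)
      also have "\<dots> \<le> 3 * \<eta> * X * (r * (4 * X) ^ (r - 1))"
        using w X by (intro mult_right_mono) auto
      also have "\<dots> \<le> 3 * \<eta> * (r * 4 ^ r) * X ^ r"
      proof (cases r)
        case (Suc m)
        have "3 * \<eta> * X * (r * (4 * X) ^ (r - 1)) = 3 * \<eta> * (r * 4 ^ m) * X ^ r"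
          by (simp add: Suc power_mult_distrib algebra_simps)
        also have "\<dots> \<le> 3 * \<eta> * (r * 4 ^ r) * X ^ r"
          using \<eta> X by (intro mult_right_mono mult_left_mono) (auto simp: Suc)
        finally show ?thesis .
      qed auto
      also have "\<dots> \<le> 1 / 2 * X ^ r"
        using \<eta>r X by (intro mult_right_mono) auto
      finally have "cmod (z ^ r - of_real (X ^ r)) \<le> X ^ r / 2" by simp
      moreover have "\<bar>Re (z ^ r - of_real (X ^ r))\<bar> \<le> cmod (z ^ r - of_real (X ^ r))"
        by (rule abs_Re_le_cmod)
      ultimately have "Re (z ^ r) \<ge> X ^ r / 2" by (simp add: abs_le_iff)
      moreover have "0 \<le> 2 * c ^ r * E ^ r" using \<eta> E by (simp add: c_def)
      ultimately show ?thesis by linarith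
    next
      case False
      then have XE: "X \<le> E / \<eta>\<^sup>2" using \<eta> by (simp add: field_simps)
      have "cmod z \<le> cmod (z - of_real X) + cmod (of_real X)"
        by (metis diff_add_cancel norm_triangle_ineq)
      moreover have "2 * (sqrt E * sqrt X) \<le> E + X"
        using sum_squares_ge_zero [of "sqrt E - sqrt X" 0] X E
        by (simp add: power2_eq_square algebra_simps)
      ultimately have "cmod z \<le> 2 * (E + X)" using zX X by simp
      also have "\<dots> \<le> c * E" using mult_right_mono [OF XE, of 2] by (simp add: c_def algebra_simps)
      finally have "cmod z ^ r \<le> (c * E) ^ r" by (intro power_mono) auto
      then have "- Re (z ^ r) \<le> (c * E) ^ r"
        using abs_Re_le_cmod [of "z ^ r"] by (simp add: norm_power)
      moreover have "X ^ r \<le> (c * E) ^ r"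
      proof (intro power_mono X)
        have "d \<le> 2 * (E + d)" if "0 \<le> d" for d using E that by simp
        from this [of "E / \<eta>\<^sup>2"] E have "E / \<eta>\<^sup>2 \<le> 2 * (E + E / \<eta>\<^sup>2)"
          by (metis divide_nonneg_nonneg zero_le_power2)
        then have "E / \<eta>\<^sup>2 \<le> c * E" by (simp add: c_def algebra_simps)
        with XE show "X \<le> c * E" by (rule order_trans)
      qed
      moreover have "0 \<le> X ^ r" using X by simp
      ultimately show ?thesis by (simp add: power_mult_distrib)
    qed
  qed
qed

lemma tp_power_pos: "f \<in> tp {1..} \<Longrightarrow> (\<lambda>x. f x ^ Suc r) \<in> tp {1..}"
proof (induction r)
  case (Suc r)
  have "(\<lambda>x. f x * f x ^ Suc r) \<in> tp {1..}"
    by (rule tp_mult [OF Suc(2) Suc(1)]) (use Suc in auto)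
  then show ?case by simp
qed simp

text \<open>With \<open>q = \<Sum> A\<^sub>i \<cdot> cnj N\<^sub>i\<close>, all powers of \<open>q\<close> have mean zero, and \<open>-2 q = X - E - 2 \<i> Im q\<close>, where
  \<open>X = \<Sum> \<bar>A\<^sub>i\<bar>\<^sup>2 + \<bar>N\<^sub>i\<bar>\<^sup>2\<close>, \<open>E = \<Sum> \<bar>A\<^sub>i + N\<^sub>i\<bar>\<^sup>2\<close> and \<open>\<bar>Im q\<bar> \<le> sqrt (E X)\<close>.\<close>

lemma vector_riesz:
  "\<exists>C\<ge>0. \<forall>(I :: 'i set) a A N. finite I \<longrightarrow>
      (\<forall>i\<in>I. A i \<in> tp {a i..} \<and> N i \<in> tp {..<a i}) \<longrightarrow>
      mean (\<lambda>x. (\<Sum>i\<in>I. abs2 (A i x) + abs2 (N i x)) ^ Suc r)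
      \<le> C * mean (\<lambda>x. (\<Sum>i\<in>I. abs2 (A i x + N i x)) ^ Suc r)"
proof -
  obtain C where C0: "C \<ge> 0" and C: "\<And>X E t :: real. 0 \<le> X \<Longrightarrow> 0 \<le> E \<Longrightarrow> \<bar>t\<bar> \<le> sqrt E * sqrt X \<Longrightarrow>
      X ^ Suc r / 2 - C * E ^ Suc r \<le> Re (Complex (X - E) (2 * t) ^ Suc r)"
    using riesz_pointwise [of "Suc r"] by blast
  show ?thesis
  proof (intro exI [of _ "2 * C"] conjI allI impI)
    show "0 \<le> 2 * C" using C0 by simp
    fix I :: "'i set" and a and A N :: "'i \<Rightarrow> real \<Rightarrow> complex"
    assume I: "finite I" and AN: "\<forall>i\<in>I. A i \<in> tp {a i..} \<and> N i \<in> tp {..<a i}"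
    define X where "X x = (\<Sum>i\<in>I. abs2 (A i x) + abs2 (N i x))" for x
    define E where "E x = (\<Sum>i\<in>I. abs2 (A i x + N i x))" for x
    define q where "q x = (\<Sum>i\<in>I. A i x * cnj (N i x))" for x
    have contAN: "continuous_on UNIV (A i)" "continuous_on UNIV (N i)" if "i \<in> I" for i
      using AN that tp_cont by blast+
    have contX: "continuous_on UNIV X" and contE: "continuous_on UNIV E"
      unfolding X_def E_def by (intro continuous_intros contAN; assumption)+
    have nonneg: "0 \<le> X x" "0 \<le> E x" for x by (auto simp: X_def E_def intro!: sum_nonneg)
    have EX: "E x = X x + 2 * Re (q x)" for x
      by (simp add: E_def X_def q_def norm_add_squared sum.distrib sum_distrib_left Re_sum)
    have Im: "\<bar>Im (q x)\<bar> \<le> sqrt (E x) * sqrt (X x)" for x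
    proof -
      have "Im (q x) = Im (\<Sum>i\<in>I. (A i x + N i x) * cnj (N i x))"
        by (simp add: q_def Im_sum ring_distribs flip: sum.distrib)
      then have "\<bar>Im (q x)\<bar> \<le> cmod (\<Sum>i\<in>I. (A i x + N i x) * cnj (N i x))"
        by (metis abs_Im_le_cmod)
      also have "\<dots> \<le> (\<Sum>i\<in>I. \<bar>cmod (A i x + N i x)\<bar> * \<bar>cmod (N i x)\<bar>)"
        by (rule sum_norm_le) (simp add: norm_mult)
      also have "\<dots> \<le> L2_set (\<lambda>i. cmod (A i x + N i x)) I * L2_set (\<lambda>i. cmod (N i x)) I"
        by (rule L2_set_mult_ineq)
      also have "\<dots> \<le> sqrt (E x) * sqrt (X x)"
        unfolding L2_set_def E_def X_def
        by (intro mult_left_mono real_sqrt_le_mono sum_mono) (auto intro: sum_nonneg)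
      finally show ?thesis .
    qed
    \<comment> \<open>Only differences of frequencies with the same index \<open>i\<close> occur in
      \<open>q\<close>, so every component may have its own threshold \<open>a i\<close>. This
      freedom is what makes partial sums of different lengths accessible at once.\<close>
    have "(\<lambda>x. - 2 * q x) \<in> tp {1..}"
      unfolding q_def
    proof (intro tp_cmult tp_sum)
      fix i assume i: "i \<in> I"
      have "(\<lambda>x. cnj (N i x)) \<in> tp {1 - a i..}"
        by (rule tp_cnj [of _ "{..<a i}"]) (use i AN in auto)
      then show "(\<lambda>x. A i x * cnj (N i x)) \<in> tp {1..}"
        by (rule tp_mult [of _ "{a i..}", rotated]) (use i AN in auto)
    qed
    from tp_power_pos [OF this, of r] have q': "(\<lambda>x. (- 2 * q x) ^ Suc r) \<in> tp {1..}" .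
    have "mean (\<lambda>x. X x ^ Suc r / 2 - C * E x ^ Suc r) \<le> mean (\<lambda>x. Re ((- 2 * q x) ^ Suc r))"
    proof (rule mean_mono)
      show "continuous_on UNIV (\<lambda>x. X x ^ Suc r / 2 - C * E x ^ Suc r)"
        by (intro continuous_intros contX contE) auto
      show "continuous_on UNIV (\<lambda>x. Re ((- 2 * q x) ^ Suc r))"
        by (intro continuous_intros tp_cont [OF q'])
      show "X x ^ Suc r / 2 - C * E x ^ Suc r \<le> Re ((- 2 * q x) ^ Suc r)" for x
      proof -
        have "- 2 * q x = Complex (X x - E x) (2 * (- Im (q x)))"
          by (simp add: complex_eq_iff EX)
        then show ?thesis
          using C [of "X x" "E x" "- Im (q x)"] nonneg [of x] Im [of x] by simp
      qed
    qed
    also have "\<dots> = 0"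
      using mean_Re [OF tp_cont [OF q']] mean_tp_zero [OF q'] by simp
    finally have "mean (\<lambda>x. 1 / 2 * X x ^ Suc r - C * E x ^ Suc r) \<le> 0" by simp
    then have "1 / 2 * mean (\<lambda>x. X x ^ Suc r) - C * mean (\<lambda>x. E x ^ Suc r) \<le> 0"
      by (subst (asm) mean_diff) (auto simp only: mean_rmult intro!: continuous_intros contX contE)
    then show "mean (\<lambda>x. (\<Sum>i\<in>I. abs2 (A i x) + abs2 (N i x)) ^ Suc r)
      \<le> 2 * C * mean (\<lambda>x. (\<Sum>i\<in>I. abs2 (A i x + N i x)) ^ Suc r)"
      by (simp add: X_def E_def)
  qed
qed

text \<open>Two half-line cuts: the one at \<open>b i\<close> discards \<open>U i\<close>, the one
  at \<open>a i\<close> discards \<open>D i\<close>. The intervals may differ from component to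
  component, as those of the partial sums of a block do.\<close>

lemma vector_riesz_interval:
  "\<exists>C\<ge>0. \<forall>(I :: 'i set) a b D T U. finite I \<longrightarrow>
      (\<forall>i\<in>I. a i \<le> b i \<and> D i \<in> tp {..<a i} \<and> T i \<in> tp {a i..<b i} \<and> U i \<in> tp {b i..}) \<longrightarrow>
      mean (\<lambda>x. (\<Sum>i\<in>I. abs2 (T i x)) ^ Suc r)
      \<le> C * mean (\<lambda>x. (\<Sum>i\<in>I. abs2 (D i x + T i x + U i x)) ^ Suc r)"
proof -
  obtain C where C0: "C \<ge> 0" and C: "\<And>(I :: 'i set) a A N. finite I \<Longrightarrow>
      (\<forall>i\<in>I. A i \<in> tp {a i..} \<and> N i \<in> tp {..<a i}) \<Longrightarrow>
      mean (\<lambda>x. (\<Sum>i\<in>I. abs2 (A i x) + abs2 (N i x)) ^ Suc r)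
      \<le> C * mean (\<lambda>x. (\<Sum>i\<in>I. abs2 (A i x + N i x)) ^ Suc r)"
    using vector_riesz [where 'i = 'i, of r] by blast
  show ?thesis
  proof (intro exI [of _ "C * C"] conjI allI impI)
    show "0 \<le> C * C" by simp
    fix I :: "'i set" and a b and D T U :: "'i \<Rightarrow> real \<Rightarrow> complex"
    assume I: "finite I" and "\<forall>i\<in>I. a i \<le> b i \<and> D i \<in> tp {..<a i} \<and> T i \<in> tp {a i..<b i} \<and> U i \<in> tp {b i..}"
    then have ab: "a i \<le> b i" and D: "D i \<in> tp {..<a i}" and T: "T i \<in> tp {a i..<b i}"
      and U: "U i \<in> tp {b i..}" if "i \<in> I" for i using that by auto
    note [continuous_intros] = tp_cont [OF D] tp_cont [OF T] tp_cont [OF U]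
    have "mean (\<lambda>x. (\<Sum>i\<in>I. abs2 (T i x)) ^ Suc r)
      \<le> mean (\<lambda>x. (\<Sum>i\<in>I. abs2 (U i x) + abs2 (T i x)) ^ Suc r)"
      by (intro mean_mono continuous_intros power_mono sum_mono sum_nonneg) auto
    also have "\<dots> \<le> C * mean (\<lambda>x. (\<Sum>i\<in>I. abs2 (U i x + T i x)) ^ Suc r)"
      using U by (intro C [OF I, of _ b]) (auto intro!: tp_mono [OF T])
    also have "mean (\<lambda>x. (\<Sum>i\<in>I. abs2 (U i x + T i x)) ^ Suc r)
      \<le> mean (\<lambda>x. (\<Sum>i\<in>I. abs2 (U i x + T i x) + abs2 (D i x)) ^ Suc r)"
      by (intro mean_mono continuous_intros power_mono sum_mono sum_nonneg) auto
    also have "\<dots> \<le> C * mean (\<lambda>x. (\<Sum>i\<in>I. abs2 (U i x + T i x + D i x)) ^ Suc r)"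
    proof (rule C [OF I, of _ a], intro ballI conjI D tp_add)
      fix i assume i: "i \<in> I"
      show "U i \<in> tp {a i..}" "T i \<in> tp {a i..}"
        using ab [OF i] by (auto intro!: tp_mono [OF U [OF i]] tp_mono [OF T [OF i]])
    qed
    finally show "mean (\<lambda>x. (\<Sum>i\<in>I. abs2 (T i x)) ^ Suc r)
      \<le> C * C * mean (\<lambda>x. (\<Sum>i\<in>I. abs2 (D i x + T i x + U i x)) ^ Suc r)"
      using C0 by (simp add: mult_left_mono mult.assoc add_ac)
  qed
qed


subsection \<open>Lacunary blocks\<close>

lemma tp_power_nonneg: "f \<in> tp {0..} \<Longrightarrow> (\<lambda>x. f x ^ m) \<in> tp {0..}"
proof (induction m)
  case (Suc m)
  show ?case
    unfolding power_Suc by (rule tp_mult [OF Suc(2) Suc(1) [OF Suc(2)]]) auto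
qed (auto intro: tp_const)

lemma tp_power_degree:
  fixes R B :: int
  assumes "f \<in> tp {k. 0 \<le> k \<and> R * k \<le> B}"
  shows "(\<lambda>x. f x ^ m) \<in> tp {k. 0 \<le> k \<and> R * k \<le> int m * B}"
proof (induction m)
  case (Suc m)
  show ?case
    unfolding power_Suc
  proof (rule tp_mult [OF assms Suc])
    fix a b assume "a \<in> {k. 0 \<le> k \<and> R * k \<le> B}" "b \<in> {k. 0 \<le> k \<and> R * k \<le> int m * B}"
    then show "a + b \<in> {k. 0 \<le> k \<and> R * k \<le> int (Suc m) * B}"
      by (simp add: distrib_left distrib_right add_mono)
  qed
qed (auto intro: tp_const)

lemma sum_power_Suc_le:
  fixes a :: "'i \<Rightarrow> real"
  assumes "finite I" "\<And>i. i \<in> I \<Longrightarrow> 0 \<le> a i"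
  shows "(\<Sum>i\<in>I. a i ^ Suc r) \<le> (\<Sum>i\<in>I. a i) ^ Suc r"
proof -
  have "(\<Sum>i\<in>I. a i * a i ^ r) \<le> (\<Sum>i\<in>I. a i * (\<Sum>i\<in>I. a i) ^ r)"
    using assms by (intro sum_mono mult_left_mono power_mono member_le_sum) auto
  then show ?thesis by (simp add: sum_distrib_right)
qed

text \<open>Young's inequality with integer exponents, by comparing \<open>y\<close> with
  \<open>2 * K * S\<close>. The coefficient 1/2 is there so that the power of \<open>y\<close> can
  later be absorbed into a left-hand side.\<close>

lemma young_power:
  fixes K S y :: real
  assumes "0 \<le> K" "0 \<le> S" "0 \<le> y"
  shows "K * (S * y ^ r) \<le> y ^ Suc r / 2 + K * (2 * K) ^ r * S ^ Suc r"
proof (cases "2 * K * S \<le> y")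
  case True
  then have "2 * K * S * y ^ r \<le> y * y ^ r" using assms by (intro mult_right_mono) auto
  moreover have "0 \<le> K * (2 * K) ^ r * S ^ Suc r" using assms by simp
  ultimately show ?thesis by simp
next
  case False
  then have "K * S * y ^ r \<le> K * S * (2 * K * S) ^ r"
    using assms by (intro mult_left_mono power_mono) auto
  also have "\<dots> = K * (2 * K) ^ r * S ^ Suc r"
    by (simp add: power_mult_distrib)
  finally show ?thesis using assms by (simp add: mult.assoc add_increasing)
qed

lemma power_add_le:
  fixes a b :: real
  assumes "0 \<le> a" "0 \<le> b"
  shows "(a + b) ^ m \<le> 2 ^ m * (a ^ m + b ^ m)"
proof -
  have "(a + b) ^ m \<le> (2 * max a b) ^ m" using assms by (intro power_mono) auto
  also have "max a b ^ m \<le> a ^ m + b ^ m" using assms by (simp add: max_def)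
  then have "(2 * max a b) ^ m \<le> 2 ^ m * (a ^ m + b ^ m)"
    by (simp add: power_mult_distrib)
  finally show ?thesis .
qed

text \<open>The bound is expanded around \<open>x\<close>, which will be the later of two
  consecutive partial sums: it is the product of \<open>v\<close> with a power of that one which is
  a spectral projection of the product with the full sum.\<close>

lemma power_difference_bound:
  fixes x v :: complex
  shows "abs2 (x ^ Suc r - (x - v) ^ Suc r)
    \<le> 2 * (Suc r)\<^sup>2 * 4 ^ r * (abs2 (v * x ^ r) + (abs2 v) ^ Suc r)"
proof -
  let ?a = "cmod x" and ?b = "cmod v"
  have "cmod (x ^ Suc r - (x - v) ^ Suc r) \<le> cmod (x - (x - v)) * (Suc r * (?a + ?b) ^ (Suc r - 1))"
    by (rule norm_power_diff_le) (use norm_triangle_ineq4 [of x v] in auto)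
  also have "\<dots> = Suc r * (?b * (?a + ?b) ^ r)" by simp
  also have "(?a + ?b) ^ r \<le> 2 ^ r * (?a ^ r + ?b ^ r)"
    by (rule power_add_le) auto
  finally have "cmod (x ^ Suc r - (x - v) ^ Suc r) \<le> Suc r * (?b * (2 ^ r * (?a ^ r + ?b ^ r)))"
    by (simp add: mult_left_mono)
  then have "abs2 (x ^ Suc r - (x - v) ^ Suc r) \<le> (Suc r * (?b * (2 ^ r * (?a ^ r + ?b ^ r))))\<^sup>2"
    by (intro power_mono) auto
  also have "\<dots> = (Suc r)\<^sup>2 * 4 ^ r * (?b\<^sup>2 * (?a ^ r + ?b ^ r)\<^sup>2)"
  proof -
    have "((2::real) ^ r)\<^sup>2 = 4 ^ r" by (simp add: power2_eq_square flip: power_mult_distrib)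
    then show ?thesis by (simp only: power_mult_distrib) (simp add: mult_ac)
  qed
  also have "\<dots> \<le> (Suc r)\<^sup>2 * 4 ^ r * (?b\<^sup>2 * (2 * ((?a ^ r)\<^sup>2 + (?b ^ r)\<^sup>2)))"
    using sum_squares_bound [of "?a ^ r" "?b ^ r"]
    by (intro mult_left_mono) (auto simp: power2_sum)
  also have "\<dots> = 2 * (Suc r)\<^sup>2 * 4 ^ r * (abs2 (v * x ^ r) + (?b\<^sup>2) ^ Suc r)"
    by (simp add: norm_mult norm_power power_mult_distrib algebra_simps flip: power_mult)
  finally show ?thesis .
qed

text \<open>With \<open>P t\<close> the partial sums, the increments of \<open>P t ^ Suc r\<close> have disjoint spectra. Moreover
  \<open>v t * P (Suc t) ^ r\<close> is the part of \<open>v t * P n ^ r\<close> with frequencies below \<open>b (Suc t)\<close>, so no maximal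
  function is needed to replace \<open>P (Suc t)\<close> by the full sum.\<close>

lemma lacunary_square_function:
  "\<exists>C\<ge>0. \<forall>n b v. mono b \<and> (1::int) \<le> b 0 \<and>
      (\<forall>t<n. v t \<in> tp {k. b t \<le> k \<and> int (Suc r) * k < b (Suc t)}) \<longrightarrow>
      mean (\<lambda>x. abs2 (\<Sum>t<n. v t x) ^ Suc r)
      \<le> C * mean (\<lambda>x. (\<Sum>t<n. abs2 (v t x)) ^ Suc r)"
proof -
  define K :: real where "K = 2 * (Suc r)\<^sup>2 * 4 ^ r"
  have K: "0 \<le> K" by (simp add: K_def)
  show ?thesis
  proof (intro exI [of _ "2 * (K * (2 * K) ^ r + K)"] conjI allI impI)
    show "0 \<le> 2 * (K * (2 * K) ^ r + K)" using K by simp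
    fix n and b :: "nat \<Rightarrow> int" and v :: "nat \<Rightarrow> real \<Rightarrow> complex"
    let ?R = "int (Suc r)"
    assume asm: "mono b \<and> 1 \<le> b 0 \<and> (\<forall>t<n. v t \<in> tp {k. b t \<le> k \<and> ?R * k < b (Suc t)})"
    then have v: "v t \<in> tp {k. b t \<le> k \<and> ?R * k < b (Suc t)}" if "t < n" for t
      using that by blast
    have b: "b s \<le> b t" if "s \<le> t" for s t using asm that by (simp add: monoD)
    have b1: "1 \<le> b t" for t using asm b [of 0 t] by simp
    define P where "P t x = (\<Sum>i<t. v i x)" for t x
    have P_Suc: "P (Suc t) x = P t x + v t x" for t x by (simp add: P_def)
    have v0: "v t \<in> tp {b t..}" if "t < n" for t
      using v [OF that] by (rule tp_mono) auto
    \<comment> \<open>Degrees are recorded multiplied by \<open>?R\<close>. A product of at most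
      \<open>Suc r\<close> factors then has frequencies at most \<open>b t - 1\<close>, without any
      division or rounding.\<close>
    have P: "P t \<in> tp {k. 0 \<le> k \<and> ?R * k \<le> b t - 1}" if "t \<le> n" for t
      using that
    proof (induction t)
      case 0
      then show ?case by (auto simp: P_def intro: tp.zero)
    next
      case (Suc t)
      have "P t \<in> tp {k. 0 \<le> k \<and> ?R * k \<le> b (Suc t) - 1}"
        by (rule tp_mono [OF Suc.IH]) (use Suc.prems b [of t "Suc t"] in auto)
      moreover have "v t \<in> tp {k. 0 \<le> k \<and> ?R * k \<le> b (Suc t) - 1}"
        by (rule tp_mono [OF v]) (use Suc.prems b1 [of t] in auto)
      ultimately show ?case
        unfolding P_Suc [abs_def] by (rule tp_add)
    qed
    have P0: "P t \<in> tp {0..}" if "t \<le> n" for t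
      using P [OF that] by (rule tp_mono) auto
    note [continuous_intros] = tp_cont [OF P0] tp_cont [OF v0]
    define D where "D t x = P (Suc t) x ^ Suc r - P t x ^ Suc r" for t x
    have Dtp: "D t \<in> tp {b t..}" if "t < n" for t
    proof -
      have eq: "D t x = v t x * (\<Sum>i<Suc r. P t x ^ (Suc r - Suc i) * P (Suc t) x ^ i)" for x
        unfolding D_def by (subst power_diff_sumr2) (simp add: P_Suc)
      have "(\<lambda>x. v t x * (\<Sum>i<Suc r. P t x ^ (Suc r - Suc i) * P (Suc t) x ^ i)) \<in> tp {b t..}"
      proof (rule tp_mult [OF v0 [OF that] tp_sum])
        show "(\<lambda>x. P t x ^ (Suc r - Suc i) * P (Suc t) x ^ i) \<in> tp {0..}" for i
          by (rule tp_mult [OF tp_power_nonneg tp_power_nonneg]) (use P0 that in auto)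
      qed auto
      then show ?thesis by (simp only: eq [abs_def])
    qed
    have Ppow: "(\<lambda>x. P t x ^ Suc r) \<in> tp {..<b t}" if "t \<le> n" for t
    proof (rule tp_mono [OF tp_power_degree [OF P [OF that]]], safe)
      fix k assume "?R * k \<le> ?R * (b t - 1)"
      then show "k < b t" by (simp add: mult_le_cancel_left)
    qed
    have Psum: "mean (\<lambda>x. abs2 (P m x) ^ Suc r) = (\<Sum>t<m. mean (\<lambda>x. abs2 (D t x)))"
      if "m \<le> n" for m
      using that
    proof (induction m)
      case 0
      then show ?case by (simp add: P_def)
    next
      case (Suc m)
      have "mean (\<lambda>x. abs2 (P (Suc m) x) ^ Suc r) = mean (\<lambda>x. abs2 (P m x ^ Suc r + D m x))"
        by (simp only: D_def norm_power flip: power_mult) (simp add: norm_power mult.commute flip: power_mult power_Suc)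
      also have "\<dots> = mean (\<lambda>x. abs2 (P m x ^ Suc r)) + mean (\<lambda>x. abs2 (D m x))"
        by (rule mean_pythagoras [OF Ppow Dtp]) (use Suc.prems in auto)
      also have "mean (\<lambda>x. abs2 (P m x ^ Suc r)) = mean (\<lambda>x. abs2 (P m x) ^ Suc r)"
        by (simp only: norm_power mult.commute flip: power_mult)
      finally show ?case using Suc by simp
    qed
    have proj: "mean (\<lambda>x. abs2 (v t x * P (Suc t) x ^ r)) \<le> mean (\<lambda>x. abs2 (v t x * P n x ^ r))"
      if t: "t < n" for t
    proof -
      have 1: "(\<lambda>x. v t x * P (Suc t) x ^ r) \<in> tp {..<b (Suc t)}"
      proof (rule tp_mult [OF v [OF t] tp_power_degree [OF P]])
        show "Suc t \<le> n" using t by simp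
        fix i j assume "i \<in> {k. b t \<le> k \<and> ?R * k < b (Suc t)}"
          "j \<in> {k. 0 \<le> k \<and> ?R * k \<le> int r * (b (Suc t) - 1)}"
        then have "?R * i \<le> b (Suc t) - 1" "?R * j \<le> int r * (b (Suc t) - 1)" by auto
        then have "?R * (i + j) \<le> ?R * (b (Suc t) - 1)"
          by (simp add: distrib_left distrib_right)
        then show "i + j \<in> {..<b (Suc t)}" by (simp add: mult_le_cancel_left)
      qed
      have Pn: "P n x - P (Suc t) x = (\<Sum>i\<in>{Suc t..<n}. v i x)" for x
        unfolding P_def using t
        by (metis Suc_leI atLeast0LessThan le0 sum_diff_nat_ivl)
      have "P n x ^ r - P (Suc t) x ^ r =
          (\<Sum>i\<in>{Suc t..<n}. v i x) * (\<Sum>i<r. P (Suc t) x ^ (r - Suc i) * P n x ^ i)" for x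
        by (subst power_diff_sumr2) (simp add: Pn)
      moreover have "(\<lambda>x. (\<Sum>i\<in>{Suc t..<n}. v i x) * (\<Sum>i<r. P (Suc t) x ^ (r - Suc i) * P n x ^ i))
           \<in> tp {b (Suc t)..}"
      proof (rule tp_mult [OF tp_sum tp_sum])
        show "v i \<in> tp {b (Suc t)..}" if "i \<in> {Suc t..<n}" for i
          by (rule tp_mono [OF v0]) (use that b [of "Suc t" i] in auto)
        show "(\<lambda>x. P (Suc t) x ^ (r - Suc i) * P n x ^ i) \<in> tp {0..}" for i
          by (rule tp_mult [OF tp_power_nonneg tp_power_nonneg]) (use P0 t in auto)
      qed auto
      ultimately have 2: "(\<lambda>x. P n x ^ r - P (Suc t) x ^ r) \<in> tp {b (Suc t)..}" by simp
      have 3: "(\<lambda>x. v t x * (P n x ^ r - P (Suc t) x ^ r)) \<in> tp {b (Suc t)..}"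
        by (rule tp_mult [OF v0 [OF t] 2]) (use b1 [of t] in auto)
      have "mean (\<lambda>x. abs2 (v t x * P (Suc t) x ^ r + v t x * (P n x ^ r - P (Suc t) x ^ r)))
        = mean (\<lambda>x. abs2 (v t x * P (Suc t) x ^ r))
          + mean (\<lambda>x. abs2 (v t x * (P n x ^ r - P (Suc t) x ^ r)))"
        by (rule mean_pythagoras [OF 1 3]) auto
      moreover have "v t x * P (Suc t) x ^ r + v t x * (P n x ^ r - P (Suc t) x ^ r) = v t x * P n x ^ r" for x
        by (simp add: algebra_simps)
      moreover have "0 \<le> mean (\<lambda>x. abs2 (v t x * (P n x ^ r - P (Suc t) x ^ r)))"
        by (rule mean_nonneg) auto
      ultimately show ?thesis by simp
    qed
    define S where "S x = (\<Sum>t<n. abs2 (v t x))" for x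
    \<comment> \<open>All means involved are finite real numbers, so half of the left-hand side can
      be subtracted; this doubles the remaining constant.\<close>
    have absorb: "A \<le> 2 * c * M" if "A \<le> 1 / 2 * A + c * M" for A c M :: real using that by simp
    have contS: "continuous_on UNIV S" unfolding S_def by (intro continuous_intros) auto
    have S0: "0 \<le> S x" for x by (auto simp: S_def intro: sum_nonneg)
    have contP: "continuous_on UNIV (P n)" by (intro continuous_intros) auto
    have "mean (\<lambda>x. abs2 (P n x) ^ Suc r) = (\<Sum>t<n. mean (\<lambda>x. abs2 (D t x)))"
      by (rule Psum) simp
    also have "\<dots> \<le> (\<Sum>t<n. K * (mean (\<lambda>x. abs2 (v t x * P n x ^ r)) + mean (\<lambda>x. abs2 (v t x) ^ Suc r)))"
    proof (rule sum_mono)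
      fix t assume "t \<in> {..<n}"
      then have t: "t < n" by simp
      have "mean (\<lambda>x. abs2 (D t x))
          \<le> mean (\<lambda>x. K * (abs2 (v t x * P (Suc t) x ^ r) + abs2 (v t x) ^ Suc r))"
      proof (rule mean_mono)
        show "abs2 (D t x) \<le> K * (abs2 (v t x * P (Suc t) x ^ r) + abs2 (v t x) ^ Suc r)" for x
          using power_difference_bound [of "P (Suc t) x" r "v t x"] by (simp add: D_def P_Suc K_def)
      qed (use t in \<open>auto intro!: continuous_intros tp_cont [OF Dtp]\<close>)
      also have "\<dots> = K * (mean (\<lambda>x. abs2 (v t x * P (Suc t) x ^ r)) + mean (\<lambda>x. abs2 (v t x) ^ Suc r))"
        by (subst mean_rmult, subst mean_add) (use t in \<open>auto intro!: continuous_intros\<close>)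
      also have "\<dots> \<le> K * (mean (\<lambda>x. abs2 (v t x * P n x ^ r)) + mean (\<lambda>x. abs2 (v t x) ^ Suc r))"
        using proj [OF t] K by (intro mult_left_mono) auto
      finally show "mean (\<lambda>x. abs2 (D t x))
        \<le> K * (mean (\<lambda>x. abs2 (v t x * P n x ^ r)) + mean (\<lambda>x. abs2 (v t x) ^ Suc r))" .
    qed
    also have "\<dots> = mean (\<lambda>x. \<Sum>t<n. K * (abs2 (v t x * P n x ^ r) + abs2 (v t x) ^ Suc r))"
    proof (subst mean_sum)
      show "(\<Sum>t<n. K * (mean (\<lambda>x. abs2 (v t x * P n x ^ r)) + mean (\<lambda>x. abs2 (v t x) ^ Suc r)))
        = (\<Sum>t<n. mean (\<lambda>x. K * (abs2 (v t x * P n x ^ r) + abs2 (v t x) ^ Suc r)))"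
        unfolding mean_rmult
        by (intro sum.cong refl arg_cong2 [where f = "(*)"] mean_add [symmetric])
           (auto intro!: continuous_intros)
    qed (auto intro!: continuous_intros)
    also have "\<dots> \<le> mean (\<lambda>x. 1 / 2 * abs2 (P n x) ^ Suc r + (K * (2 * K) ^ r + K) * S x ^ Suc r)"
    proof (rule mean_mono)
      fix x
      have "(\<Sum>t<n. K * (abs2 (v t x * P n x ^ r) + abs2 (v t x) ^ Suc r))
          = K * (S x * abs2 (P n x) ^ r) + K * (\<Sum>t<n. abs2 (v t x) ^ Suc r)"
        by (simp add: S_def sum.distrib distrib_left sum_distrib_left sum_distrib_right norm_mult
            norm_power power_mult_distrib mult.commute flip: power_mult)
      also have "\<dots> \<le> K * (S x * abs2 (P n x) ^ r) + K * S x ^ Suc r"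
        unfolding S_def using K
        by (intro add_left_mono mult_left_mono sum_power_Suc_le) auto
      also have "\<dots> \<le> (abs2 (P n x) ^ Suc r / 2 + K * (2 * K) ^ r * S x ^ Suc r) + K * S x ^ Suc r"
        using young_power [OF K S0, of "abs2 (P n x)" x r] by (intro add_right_mono) auto
      also have "\<dots> = 1 / 2 * abs2 (P n x) ^ Suc r + (K * (2 * K) ^ r + K) * S x ^ Suc r"
        by (simp add: algebra_simps)
      finally show "(\<Sum>t<n. K * (abs2 (v t x * P n x ^ r) + abs2 (v t x) ^ Suc r)) \<le> \<dots>" .
    qed (auto intro!: continuous_intros contS)
    also have "\<dots> = 1 / 2 * mean (\<lambda>x. abs2 (P n x) ^ Suc r) + (K * (2 * K) ^ r + K) * mean (\<lambda>x. S x ^ Suc r)"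
      by (subst mean_add) (auto simp only: mean_rmult intro!: continuous_intros contS contP)
    finally have "mean (\<lambda>x. abs2 (P n x) ^ Suc r) \<le> 2 * (K * (2 * K) ^ r + K) * mean (\<lambda>x. S x ^ Suc r)"
      using absorb by blast
    then show "mean (\<lambda>x. abs2 (\<Sum>t<n. v t x) ^ Suc r)
      \<le> 2 * (K * (2 * K) ^ r + K) * mean (\<lambda>x. (\<Sum>t<n. abs2 (v t x)) ^ Suc r)"
      by (simp add: P_def S_def)
  qed
qed


subsection \<open>Fejer means\<close>

definition fej :: "nat \<Rightarrow> int \<Rightarrow> real" where
  "fej N k = (if \<bar>k\<bar> < int N then 1 - \<bar>of_int k\<bar> / N else 0)"

definition sigma :: "nat \<Rightarrow> (real \<Rightarrow> complex) \<Rightarrow> real \<Rightarrow> complex" where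
  "sigma N f x = (\<Sum>k\<in>{- int N<..<int N}. of_real (fej N k) * fc f k * ex k x)"

text \<open>Written as a square so that positivity is immediate; that its coefficients are the
  triangular weights \<open>fej\<close> is then a matter of counting.\<close>

definition fejer_kernel :: "nat \<Rightarrow> real \<Rightarrow> real" where
  "fejer_kernel N y = abs2 (\<Sum>a<N. ex (int a) y) / N"

lemma fej_le_1: "fej N k \<le> 1"
  by (auto simp: fej_def field_simps)

lemma fej_defect: "N \<ge> 1 \<Longrightarrow> 1 - fej N k \<le> \<bar>of_int k\<bar> / N"
  by (auto simp: fej_def field_simps)

text \<open>A difference \<open>k\<close> is attained by exactly
  \<open>N - nat \<bar>k\<bar>\<close> pairs of indices below \<open>N\<close>. This count is the
  source of the triangular Fejer weights.\<close>

lemma sum_diff_square: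
  fixes g :: "int \<Rightarrow> complex"
  shows "(\<Sum>a<N. \<Sum>b<N. g (int a - int b)) = (\<Sum>k\<in>{- int N<..<int N}. of_nat (N - nat \<bar>k\<bar>) * g k)"
proof -
  let ?S = "{..<N} \<times> {..<N}"
  let ?d = "\<lambda>p. int (fst p) - int (snd p)"
  have card: "card {p \<in> ?S. ?d p = k} = N - nat \<bar>k\<bar>" for k
  proof (cases "k \<ge> 0")
    case True
    then have "{p \<in> ?S. ?d p = k} = (\<lambda>b. (b + nat k, b)) ` {..<N - nat k}"
      by (force simp: image_iff)
    then show ?thesis using True by (simp add: card_image inj_on_def)
  next
    case False
    then have "{p \<in> ?S. ?d p = k} = (\<lambda>a. (a, a + nat (- k))) ` {..<N - nat (- k)}"
      by (force simp: image_iff)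
    then show ?thesis using False by (simp add: card_image inj_on_def)
  qed
  have "(\<Sum>a<N. \<Sum>b<N. g (int a - int b)) = (\<Sum>p\<in>?S. g (?d p))"
    by (simp add: sum.cartesian_product case_prod_beta)
  also have "\<dots> = (\<Sum>k\<in>{- int N<..<int N}. \<Sum>p\<in>{p \<in> ?S. ?d p = k}. g (?d p))"
    by (rule sum.group [symmetric]) auto
  also have "\<dots> = (\<Sum>k\<in>{- int N<..<int N}. \<Sum>p\<in>{p \<in> ?S. ?d p = k}. g k)"
    by (intro sum.cong) auto
  also have "\<dots> = (\<Sum>k\<in>{- int N<..<int N}. of_nat (N - nat \<bar>k\<bar>) * g k)"
    by (simp only: sum_constant card)
  finally show ?thesis .
qed

lemma fejer_kernel_expansion:
  assumes "N \<ge> 1"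
  shows "complex_of_real (fejer_kernel N y) = (\<Sum>k\<in>{- int N<..<int N}. of_real (fej N k) * ex k y)"
proof -
  have "complex_of_real (abs2 (\<Sum>a<N. ex (int a) y)) = (\<Sum>a<N. \<Sum>b<N. ex (int a) y * ex (- int b) y)"
    by (simp only: complex_norm_square cnj_sum sum_product ex_minus)
  also have "\<dots> = (\<Sum>a<N. \<Sum>b<N. ex (int a - int b) y)"
    by (simp flip: ex_add)
  also have "\<dots> = (\<Sum>k\<in>{- int N<..<int N}. of_nat (N - nat \<bar>k\<bar>) * ex k y)"
    by (rule sum_diff_square)
  finally have *: "complex_of_real (abs2 (\<Sum>a<N. ex (int a) y))
    = (\<Sum>k\<in>{- int N<..<int N}. of_nat (N - nat \<bar>k\<bar>) * ex k y)" .
  have "complex_of_real (fejer_kernel N y)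
      = (\<Sum>k\<in>{- int N<..<int N}. of_nat (N - nat \<bar>k\<bar>) * ex k y) / of_nat N"
    unfolding fejer_kernel_def of_real_divide * by simp
  also have "\<dots> = (\<Sum>k\<in>{- int N<..<int N}. of_real (fej N k) * ex k y)"
    unfolding sum_divide_distrib
  proof (rule sum.cong)
    fix k assume "k \<in> {- int N<..<int N}"
    then have "\<bar>k\<bar> < int N" by auto
    then have "real (N - nat \<bar>k\<bar>) = real N - \<bar>of_int k\<bar>"
      by (simp add: of_nat_diff)
    then have "fej N k = real (N - nat \<bar>k\<bar>) / N"
      using \<open>\<bar>k\<bar> < int N\<close> assms by (simp add: fej_def field_simps)
    then show "of_nat (N - nat \<bar>k\<bar>) * ex k y / of_nat N = of_real (fej N k) * ex k y" by simp
  qed simp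
  finally show ?thesis .
qed

lemma fejer_kernel_nonneg: "0 \<le> fejer_kernel N y"
  by (simp add: fejer_kernel_def)

lemma cont_fejer_kernel:
  assumes "continuous_on UNIV h" shows "continuous_on UNIV (\<lambda>t. fejer_kernel N (h t))"
  unfolding fejer_kernel_def divide_inverse
  by (intro continuous_intros continuous_on_compose2 [OF cont_ex [of UNIV] assms]) auto

lemma integrable_ex_mult:
  assumes "integrable circle f"
  shows "integrable circle (\<lambda>t. f t * ex k t)"
proof (rule Bochner_Integration.integrable_bound [OF assms])
  have "(ex k) \<in> borel_measurable circle"
    by (rule borel_measurable_integrable [OF cont_integrable [OF cont_ex]])
  then show "(\<lambda>t. f t * ex k t) \<in> borel_measurable circle"
    using assms by measurable
qed (simp add: norm_mult)

lemma mean_lincomb: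
  assumes "\<And>k. k \<in> A \<Longrightarrow> integrable circle (u k)"
  shows "mean (\<lambda>t. \<Sum>k\<in>A. c k * u k t) = (\<Sum>k\<in>A. c k * mean (u k) :: complex)"
  using assms by (simp add: mean_def scaleR_sum_right)

lemma sigma_kernel:
  assumes "integrable circle f" "N \<ge> 1"
  shows "sigma N f x = mean (\<lambda>t. f t * of_real (fejer_kernel N (x - t)))"
proof -
  have *: "f t * of_real (fejer_kernel N (x - t))
     = (\<Sum>k\<in>{- int N<..<int N}. of_real (fej N k) * ex k x * (f t * ex (- k) t))" for t
    unfolding fejer_kernel_expansion [OF assms(2)] sum_distrib_left ex_diff_arg
    by (simp add: mult_ac)
  show ?thesis
    unfolding * sigma_def fourier_coeff_eq_mean
    by (subst mean_lincomb) (auto simp: mult_ac intro!: integrable_ex_mult [OF assms(1)])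
qed

lemma sigma_tp: "sigma N f \<in> tp {- int N<..<int N}"
  unfolding sigma_def [abs_def] by (intro tp_sum_ex) auto

lemma fc_sigma: "fc (sigma N f) k = fej N k * fc f k"
  unfolding sigma_def [abs_def] by (subst fc_sum_ex) (auto simp: fej_def)

lemma mean_fejer_kernel:
  assumes "N \<ge> 1" shows "mean (\<lambda>t. fejer_kernel N (x - t)) = 1"
proof -
  have "complex_of_real (mean (\<lambda>t. fejer_kernel N (x - t))) = sigma N (\<lambda>_. 1) x"
    using sigma_kernel [OF cont_integrable [OF continuous_on_const] assms, of 1 x]
    by (simp add: mean_of_real cont_fejer_kernel continuous_intros)
  also have "\<dots> = (\<Sum>k\<in>{- int N<..<int N}. if k = 0 then 1 else 0)"
    unfolding sigma_def
    by (intro sum.cong refl) (use fc_ex [of 1 0] assms in \<open>auto simp: fej_def\<close>)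
  also have "\<dots> = 1" using assms by simp
  finally show ?thesis using of_real_eq_1_iff by blast
qed

text \<open>\<open>sigma N\<close> averages against a probability density, so the commutator at \<open>x\<close> is an average of
  \<open>g t * (Q x - Q t)\<close>.\<close>

lemma fejer_commutator_pointwise:
  assumes g: "continuous_on UNIV g" "\<And>t. cmod (g t) \<le> 1" and Q: "continuous_on UNIV Q" and N: "N \<ge> 1"
  shows "abs2 (sigma N g x * Q x - sigma N (\<lambda>t. g t * Q t) x)
    \<le> abs2 (Q x) - 2 * Re (Q x * cnj (sigma N Q x)) + Re (sigma N (\<lambda>t. Q t * cnj (Q t)) x)"
proof -
  define F where "F t = fejer_kernel N (x - t)" for t
  have F0: "0 \<le> F t" for t by (simp add: F_def fejer_kernel_nonneg)
  have contF: "continuous_on UNIV F"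
    unfolding F_def by (intro cont_fejer_kernel continuous_intros)
  note [continuous_intros] = g(1) Q contF
  define h where "h t = cmod (Q x - Q t)" for t
  have conth [continuous_intros]: "continuous_on UNIV h" unfolding h_def by (intro continuous_intros)
  define m where "m = mean (\<lambda>t. h t * F t)"
  have "sigma N g x * Q x - sigma N (\<lambda>t. g t * Q t) x = mean (\<lambda>t. g t * (Q x - Q t) * of_real (F t))"
  proof -
    have "mean (\<lambda>t. g t * (Q x - Q t) * of_real (F t))
      = mean (\<lambda>t. Q x * (g t * of_real (F t)) - g t * Q t * of_real (F t))"
      by (simp add: algebra_simps)
    also have "\<dots> = Q x * mean (\<lambda>t. g t * of_real (F t)) - mean (\<lambda>t. g t * Q t * of_real (F t))"
      by (subst mean_diff) (auto simp: mean_cmult intro!: continuous_intros)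
    finally show ?thesis
      by (simp only: sigma_kernel [OF cont_integrable [OF g(1)] N] F_def
          sigma_kernel [OF cont_integrable [OF continuous_on_mult [OF g(1) Q]] N]
          mult.commute [of "mean (\<lambda>t. g t * of_real (fejer_kernel N (x - t)))" "Q x"])
  qed
  then have "cmod (sigma N g x * Q x - sigma N (\<lambda>t. g t * Q t) x)
      \<le> mean (\<lambda>t. cmod (g t * (Q x - Q t) * of_real (F t)))"
    by (metis norm_mean_le)
  also have "\<dots> \<le> m"
    unfolding m_def
  proof (rule mean_mono)
    show "cmod (g t * (Q x - Q t) * of_real (F t)) \<le> h t * F t" for t
      using g(2) [of t] F0 by (simp add: norm_mult h_def mult_left_le_one_le mult_right_mono)
  qed (intro continuous_intros)+
  finally have "abs2 (sigma N g x * Q x - sigma N (\<lambda>t. g t * Q t) x) \<le> m\<^sup>2"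
    by (intro power_mono) auto
  \<comment> \<open>Jensen's inequality for the density \<open>F\<close>, in the form that the
    variance of \<open>h\<close> is nonnegative.\<close>
  also have "m\<^sup>2 \<le> mean (\<lambda>t. (h t)\<^sup>2 * F t)"
  proof -
    have mF: "mean F = 1" unfolding F_def by (rule mean_fejer_kernel [OF N])
    have "0 \<le> mean (\<lambda>t. (h t - m)\<^sup>2 * F t)" using F0 by (intro mean_nonneg) auto
    also have "\<dots> = mean (\<lambda>t. (h t)\<^sup>2 * F t + ((- 2 * m) * (h t * F t) + m\<^sup>2 * F t))"
      by (simp add: power2_diff algebra_simps)
    also have "\<dots> = mean (\<lambda>t. (h t)\<^sup>2 * F t) + ((- 2 * m) * m + m\<^sup>2 * 1)"
      by (subst mean_add, (intro continuous_intros)+, subst mean_add, (intro continuous_intros)+)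
         (simp only: mean_rmult mF flip: m_def)
    finally show ?thesis by (simp add: power2_eq_square)
  qed
  also have "mean (\<lambda>t. (h t)\<^sup>2 * F t) = 
    mean (\<lambda>t. abs2 (Q x) * F t + (Re (- 2 * Q x * cnj (Q t * of_real (F t))) + Re (Q t * cnj (Q t) * of_real (F t))))"
  proof (rule arg_cong [where f = mean], rule ext)
    fix t
    have "(h t)\<^sup>2 = abs2 (Q x) + (abs2 (Q t) - 2 * Re (Q x * cnj (Q t)))"
      using norm_add_squared [of "Q x" "- Q t"] by (simp add: h_def)
    moreover have "abs2 (Q t) = Re (Q t * cnj (Q t))"
      by (simp only: cmod_power2) (simp add: power2_eq_square)
    ultimately have "(h t)\<^sup>2 * F t = (abs2 (Q x) + (Re (Q t * cnj (Q t)) - 2 * Re (Q x * cnj (Q t)))) * F t"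
      by simp
    then show "(h t)\<^sup>2 * F t = abs2 (Q x) * F t + (Re (- 2 * Q x * cnj (Q t * of_real (F t))) + Re (Q t * cnj (Q t) * of_real (F t)))"
      by (simp add: algebra_simps)
  qed
  also have "\<dots> = abs2 (Q x) * 1 + (Re (- 2 * Q x * cnj (sigma N Q x)) + Re (sigma N (\<lambda>t. Q t * cnj (Q t)) x))"
  proof -
    have mF: "mean F = 1" unfolding F_def by (rule mean_fejer_kernel [OF N])
    have 1: "mean (\<lambda>t. Re (- 2 * Q x * cnj (Q t * of_real (F t)))) = Re (- 2 * Q x * cnj (sigma N Q x))"
      by (subst mean_Re, (intro continuous_intros)+)
         (simp only: mean_cmult mean_cnj sigma_kernel [OF cont_integrable [OF Q] N] F_def)
    have 2: "mean (\<lambda>t. Re (Q t * cnj (Q t) * of_real (F t))) = Re (sigma N (\<lambda>t. Q t * cnj (Q t)) x)"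
      by (subst mean_Re, (intro continuous_intros)+)
         (subst sigma_kernel [OF cont_integrable N], (intro continuous_intros)+, simp only: F_def)
    show ?thesis
      by (subst mean_add, (intro continuous_intros)+, subst mean_add, (intro continuous_intros)+)
         (simp only: mean_rmult mF 1 2)
  qed
  finally show ?thesis by simp
qed

text \<open>After integration Parseval's identity turns the pointwise bound into the sum of
  \<open>2 * (1 - fej N k) * abs2 (q k)\<close>, and the defect \<open>1 - fej N k\<close> is at
  most \<open>M / N\<close> on the spectrum of \<open>Q\<close>. The bound involves \<open>g\<close>
  only through its supremum, not through its degree.\<close>

lemma fejer_commutator:
  assumes g: "g \<in> tp UNIV" "\<And>t. cmod (g t) \<le> 1" and Q: "Q \<in> tp {- int M..int M}" and N: "N \<ge> 1"
  shows "mean (\<lambda>x. abs2 (sigma N g x * Q x - sigma N (\<lambda>t. g t * Q t) x))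
    \<le> 2 * real M / N * mean (\<lambda>x. abs2 (Q x))"
proof -
  let ?A = "{- int M..int M}"
  define q where "q = fc Q"
  have Qx: "Q = (\<lambda>x. \<Sum>k\<in>?A. q k * ex k x)"
    using tp_expansion [OF Q] by (auto simp: q_def)
  have sQ: "sigma N Q \<in> tp UNIV" by (rule tp_mono [OF sigma_tp]) simp
  note [continuous_intros] = tp_cont [OF g(1)] tp_cont [OF Q] tp_cont [OF sigma_tp]
  have pQ: "mean (\<lambda>x. abs2 (Q x)) = (\<Sum>k\<in>?A. abs2 (q k))"
    unfolding q_def by (rule parseval [OF Q]) simp
  have 1: "mean (\<lambda>x. Q x * cnj (sigma N Q x)) = (\<Sum>k\<in>?A. of_real (fej N k * abs2 (q k)))"
  proof -
    have s: "sigma N Q = (\<lambda>x. \<Sum>k\<in>?A. (of_real (fej N k) * q k) * ex k x)"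
    proof
      fix x
      have "sigma N Q \<in> tp ({- int N<..<int N} \<union> ?A)" by (rule tp_mono [OF sigma_tp]) auto
      from tp_expansion [OF this] have "sigma N Q x
        = (\<Sum>k\<in>{- int N<..<int N} \<union> ?A. of_real (fej N k) * q k * ex k x)"
        by (simp add: fc_sigma q_def)
      also have "\<dots> = (\<Sum>k\<in>?A. of_real (fej N k) * q k * ex k x)"
        by (rule sum.mono_neutral_right) (auto simp: q_def fc_outside [OF Q])
      finally show "sigma N Q x = \<dots>" .
    qed
    have "mean (\<lambda>x. Q x * cnj (sigma N Q x)) = (\<Sum>k\<in>?A. q k * cnj (of_real (fej N k) * q k))"
      unfolding s by (subst Qx, subst parseval_sum) auto
    then show ?thesis
      by (simp add: complex_norm_square mult_ac del: of_real_power)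
  qed
  have 2: "mean (sigma N (\<lambda>t. Q t * cnj (Q t))) = of_real (mean (\<lambda>x. abs2 (Q x)))"
  proof -
    have "mean (sigma N (\<lambda>t. Q t * cnj (Q t))) = fc (sigma N (\<lambda>t. Q t * cnj (Q t))) 0"
      by (simp add: fourier_coeff_eq_mean)
    also have "\<dots> = mean (\<lambda>t. Q t * cnj (Q t))"
      unfolding fc_sigma using N by (simp add: fej_def fourier_coeff_eq_mean)
    finally show ?thesis
      by (subst mean_of_real [symmetric]) (auto intro!: continuous_intros simp: complex_norm_square simp del: of_real_power)
  qed
  have "mean (\<lambda>x. abs2 (sigma N g x * Q x - sigma N (\<lambda>t. g t * Q t) x))
     \<le> mean (\<lambda>x. abs2 (Q x) + ((- 2) * Re (Q x * cnj (sigma N Q x)) + Re (sigma N (\<lambda>t. Q t * cnj (Q t)) x)))"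
  proof (rule mean_mono)
    show "abs2 (sigma N g x * Q x - sigma N (\<lambda>t. g t * Q t) x)
      \<le> abs2 (Q x) + ((- 2) * Re (Q x * cnj (sigma N Q x)) + Re (sigma N (\<lambda>t. Q t * cnj (Q t)) x))" for x
      using fejer_commutator_pointwise [OF tp_cont [OF g(1)] g(2) tp_cont [OF Q] N, of x] by simp
  qed (intro continuous_intros)+
  also have "\<dots> = mean (\<lambda>x. abs2 (Q x))
      + ((- 2) * Re (mean (\<lambda>x. Q x * cnj (sigma N Q x))) + Re (mean (sigma N (\<lambda>t. Q t * cnj (Q t)))))"
    by (subst mean_add, (intro continuous_intros)+, subst mean_add, (intro continuous_intros)+)
       (simp only: mean_rmult, subst mean_Re, (intro continuous_intros)+, subst mean_Re, (intro continuous_intros)+, rule refl)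
  also have "\<dots> = (\<Sum>k\<in>?A. 2 * (1 - fej N k) * abs2 (q k))"
    unfolding 1 2 by (simp add: pQ Re_sum sum_distrib_left algebra_simps sum_subtractf sum_negf sum.distrib)
  also have "\<dots> \<le> (\<Sum>k\<in>?A. 2 * real M / N * abs2 (q k))"
  proof (intro sum_mono mult_right_mono)
    fix k assume "k \<in> ?A"
    then have "\<bar>real_of_int k\<bar> \<le> M" by (auto simp: abs_le_iff)
    then have "\<bar>real_of_int k\<bar> / N \<le> M / N" by (rule divide_right_mono) simp
    with fej_defect [OF N, of k] have "1 - fej N k \<le> M / N" by linarith
    then show "2 * (1 - fej N k) \<le> 2 * real M / N" by simp
  qed simp
  also have "\<dots> = 2 * real M / N * mean (\<lambda>x. abs2 (Q x))"
    by (simp add: pQ sum_distrib_left)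
  finally show ?thesis .
qed

subsection \<open>The smooth dyadic square function of a bounded function\<close>

text \<open>\<open>vp (Suc j)\<close> is the de la Vallee Poussin mean that leaves frequencies up to \<open>2 ^ j\<close> unchanged;
  the convention \<open>vp 0 = 0\<close> makes \<open>dyad j\<close> leave \<open>[2 ^ j, 2 ^ (j + 1)]\<close> unchanged also for \<open>j = 0\<close>.\<close>

primrec vp :: "nat \<Rightarrow> (real \<Rightarrow> complex) \<Rightarrow> real \<Rightarrow> complex" where
  "vp 0 f x = 0"
| "vp (Suc j) f x = 2 * sigma (2 * 2 ^ j) f x - sigma (2 ^ j) f x"

primrec vpm :: "nat \<Rightarrow> int \<Rightarrow> real" where
  "vpm 0 k = 0"
| "vpm (Suc j) k = 2 * fej (2 * 2 ^ j) k - fej (2 ^ j) k"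

text \<open>The indices differ by two: \<open>vp (Suc (Suc j))\<close> is the identity up to
  \<open>2 ^ Suc j\<close> and \<open>vp j\<close> vanishes from \<open>2 ^ j\<close> on, whereas
  consecutive means would leave no plateau of dyadic length.\<close>

definition dyad :: "nat \<Rightarrow> (real \<Rightarrow> complex) \<Rightarrow> real \<Rightarrow> complex" where
  "dyad j f x = vp (Suc (Suc j)) f x - vp j f x"

text \<open>Twice the wide triangle minus the narrow one is a trapezoid with plateau up to
  \<open>2 ^ j\<close> and support up to \<open>2 * 2 ^ j\<close>. Bounds, monotonicity in
  \<open>j\<close> and the plateau are read off from this form.\<close>

lemma vpm_Suc: "vpm (Suc j) k = max 0 (min 1 (2 - \<bar>of_int k\<bar> / 2 ^ j))"
proof -
  define a where "a = \<bar>real_of_int k\<bar> / 2 ^ j"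
  have "(\<bar>k\<bar> < 2 ^ j) = (a < 1)" "(\<bar>k\<bar> < 2 * 2 ^ j) = (a < 2)"
    using of_int_less_iff [of "\<bar>k\<bar>" "2 ^ j", where ?'a = real]
      of_int_less_iff [of "\<bar>k\<bar>" "2 * 2 ^ j", where ?'a = real] by (simp_all add: a_def divide_less_eq)
  moreover have "\<bar>real_of_int k\<bar> / (2 * 2 ^ j) = a / 2" by (simp add: a_def)
  ultimately show ?thesis by (auto simp: fej_def simp flip: a_def)
qed

lemma vpm_bounds: "0 \<le> vpm j k" "vpm j k \<le> 1"
  by (cases j; simp only: vpm_Suc vpm.simps; simp)+

lemma vpm_mono: "vpm j k \<le> vpm (Suc j) k"
proof (cases j)
  case (Suc i)
  have "\<bar>real_of_int k\<bar> / 2 ^ Suc i \<le> \<bar>real_of_int k\<bar> / 2 ^ i"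
    by (intro divide_left_mono) auto
  then show ?thesis unfolding Suc vpm_Suc by linarith
qed (use vpm_bounds(1) [of "Suc 0" k] in simp)

lemma vpm_eq_1: "\<bar>k\<bar> \<le> 2 ^ j \<Longrightarrow> vpm (Suc j) k = 1"
  using of_int_le_iff [of "\<bar>k\<bar>" "2 ^ j", where ?'a = real]
  unfolding vpm_Suc by (simp add: field_simps)

lemma vpm_eq_0: "2 ^ j \<le> \<bar>k\<bar> \<Longrightarrow> vpm j k = 0"
proof (cases j)
  case (Suc i)
  assume "2 ^ j \<le> \<bar>k\<bar>"
  then have "2 * 2 ^ i \<le> \<bar>real_of_int k\<bar>"
    using of_int_le_iff [of "2 ^ j" "\<bar>k\<bar>", where ?'a = real] Suc by simp
  then show ?thesis unfolding Suc vpm_Suc by (simp add: field_simps)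
qed simp

lemma vp_tp: "vp j f \<in> tp {- (2 ^ j)..2 ^ j}"
proof (cases j)
  case 0
  have "vp 0 f = (\<lambda>x. 0)" by auto
  then show ?thesis using 0 by (simp only: tp.zero)
next
  case (Suc i)
  have "vp (Suc i) f = (\<lambda>x. 2 * sigma (2 * 2 ^ i) f x - sigma (2 ^ i) f x)" by auto
  moreover have "(\<lambda>x. 2 * sigma (2 * 2 ^ i) f x - sigma (2 ^ i) f x) \<in> tp {- (2 ^ j)..2 ^ j}"
    unfolding Suc by (intro tp_diff tp_cmult tp_mono [OF sigma_tp]) (auto simp: less_imp_le intro: order_trans)
  ultimately show ?thesis using Suc by simp
qed

lemma fc_diff:
  assumes "f \<in> tp A" "g \<in> tp B"
  shows "fc (\<lambda>x. f x - g x) k = fc f k - fc g k"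
  unfolding fourier_coeff_eq_mean left_diff_distrib
  by (intro mean_diff continuous_intros tp_cont [OF assms(1)] tp_cont [OF assms(2)])

lemma fc_cmult: "fc (\<lambda>x. c * f x) k = c * fc f k"
  by (simp add: fourier_coeff_eq_mean mult.assoc mean_cmult)

lemma fc_vp: "fc (vp j f) k = vpm j k * fc f k"
proof (cases j)
  case 0
  have "vp 0 f = (\<lambda>x. 0)" by auto
  with 0 show ?thesis by simp
next
  case (Suc i)
  have "vp (Suc i) f = (\<lambda>x. 2 * sigma (2 * 2 ^ i) f x - sigma (2 ^ i) f x)" by auto
  then show ?thesis
    using Suc fc_diff [OF tp_cmult [OF sigma_tp] sigma_tp, of 2 "2 * 2 ^ i" f "2 ^ i" f k]
    by (simp add: fc_cmult fc_sigma algebra_simps)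
qed

lemma dyad_tp: "dyad j f \<in> tp {- (4 * 2 ^ j)..4 * 2 ^ j}"
  unfolding dyad_def [abs_def]
  by (intro tp_diff tp_mono [OF vp_tp]) (auto simp: order_trans)

lemma fc_dyad: "fc (dyad j f) k = of_real (vpm (Suc (Suc j)) k - vpm j k) * fc f k"
  unfolding dyad_def [abs_def] by (subst fc_diff [OF vp_tp vp_tp]) (simp add: fc_vp algebra_simps)

lemma fc_dyad_block: "2 ^ j \<le> k \<Longrightarrow> k \<le> 2 * 2 ^ j \<Longrightarrow> fc (dyad j f) k = fc f k"
  using vpm_eq_1 [of k "Suc j"] vpm_eq_0 [of j k] by (simp add: fc_dyad del: vpm.simps)

text \<open>Each difference lies in [0, 1] and so dominates its square; with steps of two the
  differences telescope to two end terms, each at most 1. The overlap of the smooth blocks thus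
  costs a factor 2 in Bessel's inequality.\<close>

lemma sum_vpm_squares: "(\<Sum>j<n. (vpm (Suc (Suc j)) k - vpm j k)\<^sup>2) \<le> 2"
proof -
  have 1: "0 \<le> vpm (Suc (Suc j)) k - vpm j k" "vpm (Suc (Suc j)) k - vpm j k \<le> 1" for j
    using vpm_mono [of j k] vpm_mono [of "Suc j" k] vpm_bounds [of j k] vpm_bounds [of "Suc (Suc j)" k] by linarith+
  have "(\<Sum>j<n. (vpm (Suc (Suc j)) k - vpm j k)\<^sup>2) \<le> (\<Sum>j<n. vpm (Suc (Suc j)) k - vpm j k)"
    using 1 by (intro sum_mono) (simp only: power2_eq_square, metis mult_left_le)
  also have "\<dots> = vpm (Suc n) k + vpm n k - vpm 1 k - vpm 0 k"
    by (induction n) (simp_all del: vpm.simps)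
  also have "\<dots> \<le> 2"
    using vpm_bounds [of "Suc n" k] vpm_bounds [of n k] vpm_bounds [of 1 k] vpm_bounds [of 0 k] by linarith
  finally show ?thesis .
qed

lemma dyad_bessel:
  assumes "h \<in> tp UNIV"
  shows "(\<Sum>j<n. mean (\<lambda>x. abs2 (dyad j h x))) \<le> 2 * mean (\<lambda>x. abs2 (h x))"
proof -
  obtain d where d: "h \<in> tp {- int d<..<int d}" using tp_bounded_degree [OF assms] by blast
  define A where "A = {- int d<..<int d} \<union> {- (4 * 2 ^ n)..4 * 2 ^ n}"
  have A: "finite A" by (simp add: A_def)
  have h: "h \<in> tp A" by (rule tp_mono [OF d]) (auto simp: A_def)
  have G: "dyad j h \<in> tp A" if "j < n" for j
  proof (rule tp_mono [OF dyad_tp])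
    have "(2::int) ^ j \<le> 2 ^ n" using that by (intro power_increasing) auto
    then show "{- (4 * 2 ^ j)..4 * 2 ^ j} \<subseteq> A"
      unfolding A_def by (auto simp del: power_increasing_iff)
  qed
  have "(\<Sum>j<n. mean (\<lambda>x. abs2 (dyad j h x)))
      = (\<Sum>j<n. \<Sum>k\<in>A. (vpm (Suc (Suc j)) k - vpm j k)\<^sup>2 * abs2 (fc h k))"
    by (intro sum.cong refl)
       (simp add: parseval [OF G A] fc_dyad norm_mult power_mult_distrib del: vpm.simps of_real_diff)
  also have "\<dots> = (\<Sum>k\<in>A. (\<Sum>j<n. (vpm (Suc (Suc j)) k - vpm j k)\<^sup>2) * abs2 (fc h k))"
    by (subst sum.swap) (simp only: sum_distrib_right)
  also have "\<dots> \<le> (\<Sum>k\<in>A. 2 * abs2 (fc h k))"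
    by (intro sum_mono mult_right_mono sum_vpm_squares) auto
  finally show ?thesis by (simp add: parseval [OF h A] sum_distrib_left)
qed

lemma norm_diff_squared_le: "abs2 (a - b) \<le> 2 * abs2 a + 2 * abs2 b"
proof -
  have "abs2 (a - b) \<le> (cmod a + cmod b)\<^sup>2"
    by (intro power_mono norm_triangle_ineq4) auto
  also have "\<dots> \<le> 2 * abs2 a + 2 * abs2 b"
    using sum_squares_bound [of "cmod a" "cmod b"] by (simp add: power2_sum)
  finally show ?thesis .
qed

lemma mean_norm_diff_squared_le:
  assumes "continuous_on UNIV f" "continuous_on UNIV g"
  shows "mean (\<lambda>x. abs2 (f x - g x)) \<le> 2 * mean (\<lambda>x. abs2 (f x)) + 2 * mean (\<lambda>x. abs2 (g x))"
proof -
  note [continuous_intros] = assms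
  have "mean (\<lambda>x. abs2 (f x - g x)) \<le> mean (\<lambda>x. 2 * abs2 (f x) + 2 * abs2 (g x))"
    by (intro mean_mono continuous_intros norm_diff_squared_le)
  also have "\<dots> = 2 * mean (\<lambda>x. abs2 (f x)) + 2 * mean (\<lambda>x. abs2 (g x))"
    by (subst mean_add) (auto simp only: mean_rmult intro!: continuous_intros)
  finally show ?thesis .
qed

lemma vp_commutator:
  assumes g: "g \<in> tp UNIV" "\<And>t. cmod (g t) \<le> 1" and Q: "Q \<in> tp {- int M..int M}"
  shows "mean (\<lambda>x. abs2 (vp j g x * Q x - vp j (\<lambda>t. g t * Q t) x))
    \<le> 24 * real M / 2 ^ j * mean (\<lambda>x. abs2 (Q x))"
proof (cases j)
  case 0
  then show ?thesis by (simp add: mean_nonneg)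
next
  case (Suc i)
  note [continuous_intros] = tp_cont [OF sigma_tp] tp_cont [OF Q]
  let ?c = "\<lambda>N x. sigma N g x * Q x - sigma N (\<lambda>t. g t * Q t) x"
  let ?m = "mean (\<lambda>x. abs2 (Q x))"
  have "mean (\<lambda>x. abs2 (vp j g x * Q x - vp j (\<lambda>t. g t * Q t) x))
      = mean (\<lambda>x. abs2 (2 * ?c (2 * 2 ^ i) x - ?c (2 ^ i) x))"
    by (simp add: Suc algebra_simps)
  also have "\<dots> \<le> 2 * mean (\<lambda>x. abs2 (2 * ?c (2 * 2 ^ i) x)) + 2 * mean (\<lambda>x. abs2 (?c (2 ^ i) x))"
    by (intro mean_norm_diff_squared_le continuous_intros)
  also have "mean (\<lambda>x. abs2 (2 * ?c (2 * 2 ^ i) x)) = 4 * mean (\<lambda>x. abs2 (?c (2 * 2 ^ i) x))"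
    by (simp only: norm_mult power_mult_distrib mean_rmult) simp
  also have "2 * (4 * mean (\<lambda>x. abs2 (?c (2 * 2 ^ i) x))) + 2 * mean (\<lambda>x. abs2 (?c (2 ^ i) x))
     \<le> 2 * (4 * (2 * real M / real (2 * 2 ^ i) * ?m)) + 2 * (2 * real M / real (2 ^ i) * ?m)"
    by (intro add_mono mult_left_mono fejer_commutator g Q) auto
  also have "\<dots> = 24 * real M / 2 ^ j * ?m"
    by (simp add: Suc field_simps)
  finally show ?thesis .
qed

lemma dyad_commutator:
  assumes g: "g \<in> tp UNIV" "\<And>t. cmod (g t) \<le> 1" and Q: "Q \<in> tp {- int M..int M}"
  shows "mean (\<lambda>x. abs2 (dyad j g x * Q x - dyad j (\<lambda>t. g t * Q t) x))
    \<le> 60 * real M / 2 ^ j * mean (\<lambda>x. abs2 (Q x))"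
proof -
  note [continuous_intros] = tp_cont [OF vp_tp] tp_cont [OF Q]
  let ?c = "\<lambda>j x. vp j g x * Q x - vp j (\<lambda>t. g t * Q t) x"
  let ?m = "mean (\<lambda>x. abs2 (Q x))"
  have "mean (\<lambda>x. abs2 (dyad j g x * Q x - dyad j (\<lambda>t. g t * Q t) x))
      = mean (\<lambda>x. abs2 (?c (Suc (Suc j)) x - ?c j x))"
    by (simp add: dyad_def algebra_simps del: vp.simps)
  also have "\<dots> \<le> 2 * mean (\<lambda>x. abs2 (?c (Suc (Suc j)) x)) + 2 * mean (\<lambda>x. abs2 (?c j x))"
    by (intro mean_norm_diff_squared_le continuous_intros)
  also have "\<dots> \<le> 2 * (24 * real M / 2 ^ Suc (Suc j) * ?m) + 2 * (24 * real M / 2 ^ j * ?m)"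
    by (intro add_mono mult_left_mono vp_commutator g Q) auto
  also have "\<dots> = 60 * real M / 2 ^ j * ?m"
    by (simp add: field_simps)
  finally show ?thesis .
qed

lemma sum_inverse_power_2_le: "(\<Sum>j\<in>{J..<n}. 1 / 2 ^ j) \<le> (2 / 2 ^ J :: real)"
proof (cases "J \<le> n")
  case True
  then have "(\<Sum>j\<in>{J..<n}. 1 / 2 ^ j) = (2 / 2 ^ J - 2 / 2 ^ n :: real)"
  proof (induction n rule: dec_induct)
    case (step n)
    have "2 / 2 ^ Suc n = (1 / 2 ^ n :: real)" "2 / 2 ^ n = 2 * (1 / 2 ^ n :: real)" by simp_all
    then show ?case
      unfolding sum.atLeastLessThan_Suc [OF step(1)] step.IH by linarith
  qed simp
  then show ?thesis by simp
qed simp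

text \<open>Since \<open>\<bar>g\<bar> \<le> 1\<close>, the product \<open>g Q\<close> is controlled by \<open>Q\<close>, and \<open>dyad j g * Q\<close> differs from
  \<open>dyad j (g Q)\<close> by a commutator that decays geometrically once \<open>2 ^ j\<close> exceeds the degree of \<open>Q\<close>.\<close>

lemma dyad_tail_weighted:
  assumes g: "g \<in> tp UNIV" "\<And>t. cmod (g t) \<le> 1" and Q: "Q \<in> tp {- int M..int M}"
  shows "(\<Sum>j\<in>{J..<n}. mean (\<lambda>x. abs2 (dyad j g x) * abs2 (Q x)))
    \<le> (4 + 240 * real M / 2 ^ J) * mean (\<lambda>x. abs2 (Q x))"
proof -
  let ?h = "\<lambda>t. g t * Q t"
  let ?m = "mean (\<lambda>x. abs2 (Q x))"
  note [continuous_intros] = tp_cont [OF g(1)] tp_cont [OF dyad_tp] tp_cont [OF Q]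
  have h: "?h \<in> tp UNIV" by (rule tp_mult [OF g(1) Q]) auto
  have m0: "0 \<le> ?m" by (rule mean_nonneg) auto
  have "(\<Sum>j\<in>{J..<n}. mean (\<lambda>x. abs2 (dyad j g x) * abs2 (Q x)))
     \<le> (\<Sum>j\<in>{J..<n}. 2 * (60 * real M / 2 ^ j * ?m) + 2 * mean (\<lambda>x. abs2 (dyad j ?h x)))"
  proof (rule sum_mono)
    fix j
    let ?c = "\<lambda>x. dyad j g x * Q x - dyad j ?h x"
    have "mean (\<lambda>x. abs2 (dyad j g x) * abs2 (Q x)) = mean (\<lambda>x. abs2 (?c x - - dyad j ?h x))"
      by (simp add: norm_mult power_mult_distrib)
    also have "\<dots> \<le> 2 * mean (\<lambda>x. abs2 (?c x)) + 2 * mean (\<lambda>x. abs2 (- dyad j ?h x))"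
      by (intro mean_norm_diff_squared_le continuous_intros)
    also have "\<dots> \<le> 2 * (60 * real M / 2 ^ j * ?m) + 2 * mean (\<lambda>x. abs2 (dyad j ?h x))"
      using dyad_commutator [OF g Q, of j] by simp
    finally show "mean (\<lambda>x. abs2 (dyad j g x) * abs2 (Q x)) \<le> \<dots>" .
  qed
  also have "\<dots> = 120 * M * ?m * (\<Sum>j\<in>{J..<n}. 1 / 2 ^ j) + 2 * (\<Sum>j\<in>{J..<n}. mean (\<lambda>x. abs2 (dyad j ?h x)))"
    by (simp add: sum.distrib sum_distrib_left mult_ac)
  also have "\<dots> \<le> 120 * M * ?m * (2 / 2 ^ J) + 2 * (2 * ?m)"
  proof (intro add_mono mult_left_mono sum_inverse_power_2_le)
    have "(\<Sum>j\<in>{J..<n}. mean (\<lambda>x. abs2 (dyad j ?h x))) \<le> (\<Sum>j<n. mean (\<lambda>x. abs2 (dyad j ?h x)))"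
      by (intro sum_mono2) (auto intro: mean_nonneg)
    also have "\<dots> \<le> 2 * mean (\<lambda>x. abs2 (?h x))" by (rule dyad_bessel [OF h])
    also have "mean (\<lambda>x. abs2 (?h x)) \<le> ?m"
      by (intro mean_mono continuous_intros)
         (use g(2) in \<open>auto simp: norm_mult mult_left_le_one_le intro!: power_mono\<close>)
    finally show "(\<Sum>j\<in>{J..<n}. mean (\<lambda>x. abs2 (dyad j ?h x))) \<le> 2 * ?m" by simp
  qed (use m0 in auto)
  also have "\<dots> = (4 + 240 * real M / 2 ^ J) * ?m" by (simp add: field_simps)
  finally show ?thesis .
qed

text \<open>Powers of the square function are not of the form \<open>abs2 (Q x)\<close>, but finite
  sums of such terms. This cone is closed under products, with additive degree bounds, and the
  weighted tail estimate extends to it by linearity.\<close>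

inductive sos :: "nat \<Rightarrow> (real \<Rightarrow> real) \<Rightarrow> bool" for M where
  zero: "sos M (\<lambda>x. 0)"
| square: "Q \<in> tp {- int M..int M} \<Longrightarrow> sos M (\<lambda>x. abs2 (Q x))"
| add: "sos M v \<Longrightarrow> sos M w \<Longrightarrow> sos M (\<lambda>x. v x + w x)"

lemma sos_cont: "sos M w \<Longrightarrow> continuous_on S w"
  by (induction rule: sos.induct) (auto intro!: continuous_intros tp_cont)

lemma sos_mono: "sos M w \<Longrightarrow> M \<le> N \<Longrightarrow> sos N w"
  by (induction rule: sos.induct) (auto intro!: sos.intros elim: tp_mono)

lemma sos_sum: "(\<And>i. i \<in> I \<Longrightarrow> sos M (w i)) \<Longrightarrow> sos M (\<lambda>x. \<Sum>i\<in>I. w i x)"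
  by (induction I rule: infinite_finite_induct) (auto intro: sos.intros)

lemma sos_mult:
  assumes "sos M v" "sos N w" shows "sos (M + N) (\<lambda>x. v x * w x)"
  using assms(1)
proof (induction rule: sos.induct)
  case (square Q)
  show ?case
    using assms(2)
  proof (induction rule: sos.induct)
    case (square R)
    have "(\<lambda>x. Q x * R x) \<in> tp {- int (M + N)..int (M + N)}"
      by (rule tp_mult [OF \<open>Q \<in> _\<close> square]) auto
    from sos.square [OF this] show ?case by (simp add: norm_mult power_mult_distrib)
  qed (auto intro: sos.intros simp: distrib_left)
qed (auto intro: sos.intros simp: distrib_right)

lemma sos_power: "sos M w \<Longrightarrow> sos (r * M) (\<lambda>x. w x ^ r)"
proof (induction r)
  case 0
  have "sos 0 (\<lambda>x. abs2 1)" by (rule sos.square [OF tp_const]) simp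
  then show ?case by simp
next
  case (Suc r)
  from sos_mult [OF Suc(2) Suc(1) [OF Suc(2)]] show ?case by simp
qed

lemma dyad_tail_sos:
  assumes g: "g \<in> tp UNIV" "\<And>t. cmod (g t) \<le> 1" and "sos M w"
  shows "(\<Sum>j\<in>{J..<n}. mean (\<lambda>x. abs2 (dyad j g x) * w x)) \<le> (4 + 240 * real M / 2 ^ J) * mean w"
  using assms(3)
proof (induction rule: sos.induct)
  case zero
  then show ?case by simp
next
  case (square Q)
  then show ?case by (rule dyad_tail_weighted [OF g])
next
  case (add v w)
  note [continuous_intros] = tp_cont [OF dyad_tp] sos_cont [OF add.hyps(1)] sos_cont [OF add.hyps(2)]
  have "(\<Sum>j\<in>{J..<n}. mean (\<lambda>x. abs2 (dyad j g x) * (v x + w x)))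
    = (\<Sum>j\<in>{J..<n}. mean (\<lambda>x. abs2 (dyad j g x) * v x)) + (\<Sum>j\<in>{J..<n}. mean (\<lambda>x. abs2 (dyad j g x) * w x))"
    unfolding distrib_left sum.distrib [symmetric] by (intro sum.cong refl mean_add continuous_intros)
  also have "\<dots> \<le> (4 + 240 * real M / 2 ^ J) * mean v + (4 + 240 * real M / 2 ^ J) * mean w"
    by (rule add_mono [OF add.IH])
  also have "\<dots> = (4 + 240 * real M / 2 ^ J) * mean (\<lambda>x. v x + w x)"
    by (subst mean_add) (auto simp: distrib_left intro!: continuous_intros)
  finally show ?case .
qed

text \<open>A discrete version of \<open>d (S ^ Suc r) = Suc r * S ^ r * dS\<close>, with
  \<open>S\<close> taken at the right endpoint of each step. It arranges a power of the sum
  according to its largest index.\<close>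

lemma power_Suc_telescope_le:
  fixes a :: "nat \<Rightarrow> real"
  assumes "\<And>i. 0 \<le> a i"
  shows "(\<Sum>i<n. a i) ^ Suc r \<le> Suc r * (\<Sum>j<n. a j * (\<Sum>i\<le>j. a i) ^ r)"
proof (induction n)
  case (Suc n)
  let ?x = "\<Sum>i\<le>n. a i" and ?y = "\<Sum>i<n. a i"
  have x: "?x = ?y + a n" by (metis add.commute lessThan_Suc_atMost sum.lessThan_Suc)
  have y0: "0 \<le> ?y" using assms by (simp add: sum_nonneg)
  have "?x ^ Suc r - ?y ^ Suc r = (?x - ?y) * (\<Sum>i<Suc r. ?y ^ (Suc r - Suc i) * ?x ^ i)"
    by (rule power_diff_sumr2)
  also have "\<dots> \<le> (?x - ?y) * (\<Sum>i<Suc r. ?x ^ r)"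
  proof (intro mult_left_mono sum_mono)
    fix i assume "i \<in> {..<Suc r}"
    then have "?x ^ r = ?x ^ (Suc r - Suc i) * ?x ^ i" by (simp flip: power_add)
    then show "?y ^ (Suc r - Suc i) * ?x ^ i \<le> ?x ^ r"
      using y0 assms [of n] x by (simp only:) (intro mult_right_mono power_mono; simp)
  qed (use x assms in simp)
  also have "\<dots> = Suc r * (a n * ?x ^ r)" using x by simp
  finally have "?x ^ Suc r \<le> ?y ^ Suc r + Suc r * (a n * ?x ^ r)" by simp
  with Suc show ?case
    by (simp only: lessThan_Suc_atMost) (simp add: distrib_left flip: lessThan_Suc_atMost)
qed simp

text \<open>The induction strips off the block of highest frequency. What remains,
  \<open>?a j x * ?A j x ^ r\<close>, is a sum of squares of degree at most
  \<open>Suc r * (4 * 2 ^ j)\<close>; this is a bounded multiple of \<open>2 ^ j\<close>, so summing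
  the blocks \<open>J \<ge> j\<close> against it costs only \<open>4 + 240 * 4 * Suc r\<close>. The
  final factor 4 is the case of the constant weight 1.\<close>

lemma smooth_square_function_step:
  assumes g: "g \<in> tp UNIV" "\<And>t. cmod (g t) \<le> 1"
  shows "(\<Sum>j<n. mean (\<lambda>x. abs2 (dyad j g x) * (\<Sum>i\<le>j. abs2 (dyad i g x)) ^ r))
    \<le> (\<Prod>i<r. (Suc i) * (4 + 960 * Suc i)) * 4"
proof (induction r)
  case 0
  have "sos 0 (\<lambda>x. abs2 1)" by (rule sos.square [OF tp_const]) simp
  from dyad_tail_sos [OF g this, of 0 n] show ?case by (simp add: atLeast0LessThan)
next
  case (Suc r)
  let ?a = "\<lambda>j x. abs2 (dyad j g x)"
  let ?A = "\<lambda>j x. \<Sum>i\<le>j. ?a i x"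
  note [continuous_intros] = tp_cont [OF dyad_tp]
  have sos_a: "sos (4 * 2 ^ j) (?a j)" for j
    by (rule sos.square) (rule tp_mono [OF dyad_tp], auto)
  have sos_A: "sos (4 * 2 ^ j) (?A j)" for j
    by (intro sos_sum sos_mono [OF sos_a]) auto
  have sos_w: "sos (Suc r * (4 * 2 ^ j)) (\<lambda>x. ?a j x * ?A j x ^ r)" for j
    using sos_mult [OF sos_a sos_power [OF sos_A, of r j], of j] by simp
  have "(\<Sum>J<n. mean (\<lambda>x. ?a J x * ?A J x ^ Suc r))
     \<le> (\<Sum>J<n. Suc r * (\<Sum>j<Suc J. mean (\<lambda>x. ?a J x * (?a j x * ?A j x ^ r))))"
  proof (rule sum_mono)
    fix J
    have "mean (\<lambda>x. ?a J x * ?A J x ^ Suc r)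
       \<le> mean (\<lambda>x. \<Sum>j<Suc J. Suc r * (?a J x * (?a j x * ?A j x ^ r)))"
    proof (intro mean_mono continuous_intros)
      fix x
      have "?A J x ^ Suc r \<le> Suc r * (\<Sum>j<Suc J. ?a j x * ?A j x ^ r)"
        unfolding lessThan_Suc_atMost [symmetric, of J]
        by (rule power_Suc_telescope_le) simp
      then have "?a J x * ?A J x ^ Suc r \<le> ?a J x * (Suc r * (\<Sum>j<Suc J. ?a j x * ?A j x ^ r))"
        by (intro mult_left_mono) auto
      also have "\<dots> = (\<Sum>j<Suc J. Suc r * (?a J x * (?a j x * ?A j x ^ r)))"
        by (simp only: sum_distrib_left mult.left_commute)
      finally show "?a J x * ?A J x ^ Suc r \<le> \<dots>" .
    qed
    also have "\<dots> = Suc r * (\<Sum>j<Suc J. mean (\<lambda>x. ?a J x * (?a j x * ?A j x ^ r)))"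
      by (subst mean_sum) (auto simp only: mean_rmult sum_distrib_left intro!: continuous_intros)
    finally show "mean (\<lambda>x. ?a J x * ?A J x ^ Suc r)
      \<le> Suc r * (\<Sum>j<Suc J. mean (\<lambda>x. ?a J x * (?a j x * ?A j x ^ r)))" .
  qed
  \<comment> \<open>The order of summation is reversed, so that for each fixed low-frequency weight
    the higher blocks \<open>J\<close> are summed first.\<close>
  also have "\<dots> = Suc r * (\<Sum>j<n. \<Sum>J\<in>{j..<n}. mean (\<lambda>x. ?a J x * (?a j x * ?A j x ^ r)))"
    unfolding sum_distrib_left [symmetric]
  proof (rule arg_cong [where f = "(*) (real (Suc r))"])
    have "(\<Sum>J<n. \<Sum>j<Suc J. F J j) = (\<Sum>j<n. \<Sum>J\<in>{j..<n}. F J j)" for F :: "nat \<Rightarrow> nat \<Rightarrow> real"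
      by (subst sum.Sigma, simp, simp, subst sum.Sigma, simp, simp,
          rule sum.reindex_bij_witness [of _ "\<lambda>(a, b). (b, a)" "\<lambda>(a, b). (b, a)"]) auto
    then show "(\<Sum>J<n. \<Sum>j<Suc J. mean (\<lambda>x. ?a J x * (?a j x * ?A j x ^ r)))
      = (\<Sum>j<n. \<Sum>J\<in>{j..<n}. mean (\<lambda>x. ?a J x * (?a j x * ?A j x ^ r)))" .
  qed
  also have "\<dots> \<le> Suc r * (\<Sum>j<n. (4 + 960 * Suc r) * mean (\<lambda>x. ?a j x * ?A j x ^ r))"
  proof (intro mult_left_mono sum_mono)
    fix j
    have "(\<Sum>J\<in>{j..<n}. mean (\<lambda>x. ?a J x * (?a j x * ?A j x ^ r)))
      \<le> (4 + 240 * real (Suc r * (4 * 2 ^ j)) / 2 ^ j) * mean (\<lambda>x. ?a j x * ?A j x ^ r)"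
      by (rule dyad_tail_sos [OF g sos_w])
    moreover have "4 + 240 * real (Suc r * (4 * 2 ^ j)) / 2 ^ j = real (4 + 960 * Suc r)"
      by (simp add: field_simps)
    ultimately show "(\<Sum>J\<in>{j..<n}. mean (\<lambda>x. ?a J x * (?a j x * ?A j x ^ r)))
      \<le> (4 + 960 * Suc r) * mean (\<lambda>x. ?a j x * ?A j x ^ r)" by (simp only:)
  qed simp
  also have "\<dots> = Suc r * (4 + 960 * Suc r) * (\<Sum>j<n. mean (\<lambda>x. ?a j x * ?A j x ^ r))"
    by (simp only: sum_distrib_left [symmetric] mult.assoc of_nat_mult)
  also have "\<dots> \<le> Suc r * (4 + 960 * Suc r) * ((\<Prod>i<r. (Suc i) * (4 + 960 * Suc i)) * 4)"
    by (simp only: of_nat_mult [of "Suc r * (4 + 960 * Suc r)"], intro mult_left_mono Suc of_nat_0_le_iff)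
  also have "\<dots> = (\<Prod>i<Suc r. (Suc i) * (4 + 960 * Suc i)) * 4"
    by (simp only: prod.lessThan_Suc of_nat_mult mult_ac)
  finally show ?case .
qed

lemma smooth_square_function:
  "\<exists>C\<ge>0. \<forall>g n. g \<in> tp UNIV \<and> (\<forall>t. cmod (g t) \<le> 1) \<longrightarrow>
      mean (\<lambda>x. (\<Sum>j<n. abs2 (dyad j g x)) ^ Suc r) \<le> C"
proof (intro exI conjI allI impI)
  let ?C = "Suc r * ((\<Prod>i<r. (Suc i) * (4 + 960 * Suc i)) * 4)"
  show "0 \<le> real ?C" by (rule of_nat_0_le_iff)
  fix g n assume "g \<in> tp UNIV \<and> (\<forall>t. cmod (g t) \<le> 1)"
  then have g: "g \<in> tp UNIV" "\<And>t. cmod (g t) \<le> 1" by auto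
  let ?a = "\<lambda>j x. abs2 (dyad j g x)"
  note [continuous_intros] = tp_cont [OF dyad_tp]
  have "mean (\<lambda>x. (\<Sum>j<n. ?a j x) ^ Suc r)
    \<le> mean (\<lambda>x. Suc r * (\<Sum>j<n. ?a j x * (\<Sum>i\<le>j. ?a i x) ^ r))"
    by (intro mean_mono continuous_intros power_Suc_telescope_le) auto
  also have "\<dots> = Suc r * (\<Sum>j<n. mean (\<lambda>x. ?a j x * (\<Sum>i\<le>j. ?a i x) ^ r))"
    unfolding mean_rmult by (subst mean_sum) (auto intro!: continuous_intros)
  also have "\<dots> \<le> Suc r * real ((\<Prod>i<r. (Suc i) * (4 + 960 * Suc i)) * 4)"
    by (intro mult_left_mono smooth_square_function_step g) auto
  finally show "mean (\<lambda>x. (\<Sum>j<n. ?a j x) ^ Suc r) \<le> real ?C" by (simp only: of_nat_mult)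
qed


subsection \<open>Marcinkiewicz multipliers on trigonometric polynomials\<close>

lemma abel_summation:
  fixes w :: "nat \<Rightarrow> complex" and \<mu> :: "nat \<Rightarrow> real"
  assumes "a \<le> b"
  shows "(\<Sum>k\<in>{a..<Suc b}. \<mu> k * w k)
    = (\<Sum>k\<in>{a..<b}. (\<mu> k - \<mu> (Suc k)) * (\<Sum>l\<in>{a..<Suc k}. w l)) + \<mu> b * (\<Sum>l\<in>{a..<Suc b}. w l)"
  using assms
proof (induction b rule: dec_induct)
  case (step b)
  have "a \<le> Suc b" using step by simp
  then have "(\<Sum>k\<in>{a..<Suc (Suc b)}. \<mu> k * w k) = (\<Sum>k\<in>{a..<Suc b}. \<mu> k * w k) + \<mu> (Suc b) * w (Suc b)"
    by simp
  also have "\<dots> = (\<Sum>k\<in>{a..<b}. (\<mu> k - \<mu> (Suc k)) * (\<Sum>l\<in>{a..<Suc k}. w l)) + \<mu> b * (\<Sum>l\<in>{a..<Suc b}. w l)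
      + \<mu> (Suc b) * w (Suc b)"
    by (simp only: step.IH)
  also have "\<dots> = (\<Sum>k\<in>{a..<Suc b}. (\<mu> k - \<mu> (Suc k)) * (\<Sum>l\<in>{a..<Suc k}. w l))
      + \<mu> (Suc b) * (\<Sum>l\<in>{a..<Suc (Suc b)}. w l)"
    using step \<open>a \<le> Suc b\<close> by (simp add: algebra_simps)
  finally show ?case .
qed simp

text \<open>Splitting the blocks by residues modulo \<open>L\<close> produces boundedly many
  families, each lacunary with ratio \<open>2 ^ L\<close>.\<close>

lemma sum_residues:
  fixes f :: "nat \<Rightarrow> 'a :: comm_monoid_add"
  shows "(\<Sum>j<n * L. f j) = (\<Sum>a<L. \<Sum>t<n. f (a + t * L))"
proof -
  have "(\<Sum>j<n * L. f j) = (\<Sum>t<n. sum f {t * L..<t * L + L})" by (rule sum.nat_group [symmetric])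
  also have "\<dots> = (\<Sum>t<n. \<Sum>a<L. f (a + t * L))"
    using sum.shift_bounds_nat_ivl [of f 0 "_ * L" L] by (simp add: atLeast0LessThan add.commute)
  also have "\<dots> = (\<Sum>a<L. \<Sum>t<n. f (a + t * L))" by (rule sum.swap)
  finally show ?thesis .
qed

text \<open>Replacing each term by the largest one is precise enough here. The last summand covers
  \<open>0 ^ 0\<close> for the empty sum.\<close>

lemma power_sum_le:
  fixes y :: "nat \<Rightarrow> real"
  assumes "\<And>a. 0 \<le> y a"
  shows "(\<Sum>a<L. y a) ^ m \<le> L ^ m * (\<Sum>a<L. y a ^ m) + (if L = 0 then 1 else 0)"
proof (cases "L = 0")
  case False
  define M where "M = Max (y ` {..<L})"
  have "M \<in> y ` {..<L}" unfolding M_def using False by (intro Max_in) auto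
  then obtain i where i: "i < L" "M = y i" by auto
  have "(\<Sum>a<L. y a) \<le> (\<Sum>a<L. M)" by (intro sum_mono) (auto simp: M_def)
  then have "(\<Sum>a<L. y a) ^ m \<le> (L * M) ^ m" using assms by (intro power_mono) (auto intro: sum_nonneg)
  also have "\<dots> = L ^ m * y i ^ m" by (simp add: power_mult_distrib i)
  also have "\<dots> \<le> L ^ m * (\<Sum>a<L. y a ^ m)"
    using assms i by (intro mult_left_mono member_le_sum) auto
  finally show ?thesis using False by simp
qed (cases m; simp)

lemma sum_dyadic_blocks:
  fixes f :: "nat \<Rightarrow> 'a :: comm_monoid_add"
  shows "(\<Sum>j<n. \<Sum>k\<in>{2 ^ j..<2 ^ Suc j}. f k) = (\<Sum>k\<in>{1..<2 ^ n}. f k)"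
proof (induction n)
  case (Suc n)
  have "(\<Sum>k\<in>{1..<2 ^ Suc n}. f k) = (\<Sum>k\<in>{1..<2 ^ n}. f k) + (\<Sum>k\<in>{2 ^ n..<2 ^ Suc n}. f k)"
    by (rule sum.atLeastLessThan_concat [symmetric]) auto
  with Suc show ?case by simp
qed simp

section \<open>Dyadic blocks of the multiplied series, their partial sums and Abel weights\<close>

definition harm :: "(real \<Rightarrow> complex) \<Rightarrow> nat \<Rightarrow> real \<Rightarrow> complex" where
  "harm g k x = fc g (int k) * ex (int k) x"

definition mblock :: "(real \<Rightarrow> complex) \<Rightarrow> (nat \<Rightarrow> real) \<Rightarrow> nat \<Rightarrow> real \<Rightarrow> complex" where
  "mblock g \<mu> j x = (\<Sum>k\<in>{2 ^ j..<2 ^ Suc j}. \<mu> k * harm g k x)"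

definition psum :: "(real \<Rightarrow> complex) \<Rightarrow> nat \<Rightarrow> nat \<Rightarrow> real \<Rightarrow> complex" where
  "psum g j k x = (\<Sum>l\<in>{2 ^ j..<Suc k}. harm g l x)"

text \<open>The weights that Abel summation gives to the partial sums of block \<open>j\<close>: the
  last frequency \<open>2 ^ Suc j - 1\<close> carries the boundary term, all others carry one
  increment of \<open>\<mu>\<close>.\<close>

definition wgt :: "(nat \<Rightarrow> real) \<Rightarrow> nat \<Rightarrow> nat \<Rightarrow> real" where
  "wgt \<mu> j k = (if Suc k = 2 ^ Suc j then \<bar>\<mu> k\<bar> else \<bar>\<mu> (Suc k) - \<mu> k\<bar>)"

lemma wgt_nonneg: "0 \<le> wgt \<mu> j k"
  by (simp add: wgt_def)

lemma block_split: "{2 ^ j..<2 ^ Suc j} = insert (2 ^ Suc j - 1) {2 ^ j..<2 ^ Suc j - 1 :: nat}"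
  by auto

lemma harm_tp: "harm g k \<in> tp {int k}"
  unfolding harm_def [abs_def] by (rule tp_ex) simp

lemma mblock_tp: "mblock g \<mu> j \<in> tp {2 ^ j..<2 * 2 ^ j}"
  unfolding mblock_def [abs_def]
proof (intro tp_sum tp_cmult tp_mono [OF harm_tp])
  fix k :: nat assume "k \<in> {2 ^ j..<2 ^ Suc j}"
  then have "int (2 ^ j) \<le> int k" "int k < int (2 ^ Suc j)" by (auto simp only: of_nat_le_iff of_nat_less_iff atLeastLessThan_iff)
  then show "{int k} \<subseteq> {2 ^ j..<2 * 2 ^ j}" by simp
qed

lemma psum_tp: "psum g j k \<in> tp {2 ^ j..<int (Suc k)}"
  unfolding psum_def [abs_def]
proof (intro tp_sum tp_mono [OF harm_tp])
  fix l :: nat assume "l \<in> {2 ^ j..<Suc k}"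
  then have "int (2 ^ j) \<le> int l" "int l < int (Suc k)" by (auto simp only: of_nat_le_iff of_nat_less_iff atLeastLessThan_iff)
  then show "{int l} \<subseteq> {2 ^ j..<int (Suc k)}" by simp
qed

lemma psum_eq:
  assumes "k < 2 ^ Suc j"
  shows "psum g j k x = (\<Sum>l\<in>{2 ^ j..<int (Suc k)}. fc (dyad j g) l * ex l x)"
proof -
  have "{2 ^ j..<int (Suc k)} = int ` {2 ^ j..<Suc k}"
    by (simp add: image_int_atLeastLessThan)
  then have "(\<Sum>l\<in>{2 ^ j..<int (Suc k)}. fc (dyad j g) l * ex l x)
    = (\<Sum>l\<in>{2 ^ j..<Suc k}. fc (dyad j g) (int l) * ex (int l) x)"
    by (simp add: sum.reindex del: image_int_atLeastLessThan)
  also have "\<dots> = psum g j k x"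
    unfolding psum_def harm_def
  proof (intro sum.cong refl arg_cong2 [where f = "(*)"] fc_dyad_block)
    fix l assume "l \<in> {2 ^ j..<Suc k}"
    then have "2 ^ j \<le> l" "l \<le> 2 * 2 ^ j" using assms by auto
    then have "int (2 ^ j) \<le> int l" "int l \<le> int (2 * 2 ^ j)" by (simp_all only: of_nat_le_iff)
    then show "2 ^ j \<le> int l" "int l \<le> 2 * 2 ^ j" by simp_all
  qed
  finally show ?thesis by simp
qed

text \<open>On the dyadic block the smooth multiplier equals 1, so a sharp partial sum of
  \<open>g\<close> is the part of \<open>dyad j g\<close> on an interval of frequencies. This is the
  shape to which \<open>vector_riesz_interval\<close> applies, with cuts at \<open>2 ^ j\<close> and
  \<open>Suc k\<close>.\<close>

lemma dyad_decomposition: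
  assumes "k \<in> {2 ^ j..<2 ^ Suc j}"
  shows "\<exists>D U. D \<in> tp {..<2 ^ j} \<and> U \<in> tp {int (Suc k)..} \<and> (\<forall>x. dyad j g x = D x + psum g j k x + U x)"
proof -
  let ?f = "\<lambda>x l. fc (dyad j g) l * ex l x"
  have "int k < int (2 ^ Suc j)" "int (2 ^ j) \<le> int k" using assms by (simp_all only: of_nat_less_iff of_nat_le_iff atLeastLessThan_iff)
  moreover have "(0::int) < 2 ^ j" by simp
  ultimately have k: "int (Suc k) \<le> 4 * 2 ^ j + 1" "2 ^ j \<le> int (Suc k)"
    by (simp_all only: of_nat_mult of_nat_power of_nat_numeral power_Suc of_nat_Suc)
  have "dyad j g x = (\<Sum>l\<in>{- (4 * 2 ^ j)..<2 ^ j}. ?f x l) + psum g j k x + (\<Sum>l\<in>{int (Suc k)..<4 * 2 ^ j + 1}. ?f x l)" for x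
  proof -
    have "dyad j g x = (\<Sum>l\<in>{- (4 * 2 ^ j)..4 * 2 ^ j}. ?f x l)"
      using tp_expansion [OF dyad_tp] by simp
    also have "{- (4 * 2 ^ j)..4 * 2 ^ j} =
        {- (4 * 2 ^ j)..<2 ^ j} \<union> ({2 ^ j..<int (Suc k)} \<union> {int (Suc k)..<4 * 2 ^ j + 1 :: int})"
    proof -
      have "- (4 * 2 ^ j) \<le> (2 ^ j :: int)" by (rule order_trans [of _ 0]) auto
      then show ?thesis using k by auto
    qed
    also have "(\<Sum>l\<in>\<dots>. ?f x l) = (\<Sum>l\<in>{- (4 * 2 ^ j)..<2 ^ j}. ?f x l)
       + ((\<Sum>l\<in>{2 ^ j..<int (Suc k)}. ?f x l) + (\<Sum>l\<in>{int (Suc k)..<4 * 2 ^ j + 1}. ?f x l))"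
    proof -
      have 1: "{- (4 * 2 ^ j)..<2 ^ j} \<inter> ({2 ^ j..<int (Suc k)} \<union> {int (Suc k)..<4 * 2 ^ j + 1}) = {}"
      proof (rule ccontr)
        assume "\<not> ?thesis"
        then obtain l where "l < 2 ^ j" "2 ^ j \<le> l \<or> int (Suc k) \<le> l" by auto
        with k show False by linarith
      qed
      have 2: "{2 ^ j..<int (Suc k)} \<inter> {int (Suc k)..<4 * 2 ^ j + 1} = {}"
        by (simp add: ivl_disj_int)
      show ?thesis
        by (simp only: sum.union_disjoint [OF _ _ 1] sum.union_disjoint [OF _ _ 2]
            finite_atLeastLessThan_int finite_UnI)
    qed
    finally show ?thesis
      using assms by (simp add: psum_eq)
  qed
  moreover have "(\<lambda>x. \<Sum>l\<in>{- (4 * 2 ^ j)..<2 ^ j}. ?f x l) \<in> tp {..<2 ^ j}"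
    "(\<lambda>x. \<Sum>l\<in>{int (Suc k)..<4 * 2 ^ j + 1}. ?f x l) \<in> tp {int (Suc k)..}"
    by (rule tp_sum_ex, force)+
  ultimately show ?thesis by blast
qed

context
  fixes g :: "real \<Rightarrow> complex" and \<mu> :: "nat \<Rightarrow> real" and \<Lambda> :: real
  assumes \<Lambda>: "0 \<le> \<Lambda>"
    and \<mu>: "\<And>k. 1 \<le> k \<Longrightarrow> \<bar>\<mu> k\<bar> \<le> \<Lambda>"
    and var: "\<And>j. (\<Sum>k\<in>{2 ^ j..<2 ^ Suc j - 1}. \<bar>\<mu> (Suc k) - \<mu> k\<bar>) \<le> \<Lambda>"
begin

lemma sum_wgt_le: "(\<Sum>k\<in>{2 ^ j..<2 ^ Suc j}. wgt \<mu> j k) \<le> 2 * \<Lambda>"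
proof -
  have "(\<Sum>k\<in>{2 ^ j..<2 ^ Suc j - 1}. wgt \<mu> j k) = (\<Sum>k\<in>{2 ^ j..<2 ^ Suc j - 1}. \<bar>\<mu> (Suc k) - \<mu> k\<bar>)"
    by (intro sum.cong refl) (auto simp: wgt_def)
  moreover have "wgt \<mu> j (2 ^ Suc j - 1) = \<bar>\<mu> (2 ^ Suc j - 1)\<bar>"
    by (simp add: wgt_def)
  moreover have "1 \<le> (2::nat) ^ Suc j - 1"
  proof -
    have "(1::nat) \<le> 2 ^ j" by simp
    then show ?thesis unfolding power_Suc by linarith
  qed
  ultimately show ?thesis
    using \<mu> [of "2 ^ Suc j - 1"] var [of j] unfolding block_split by (subst sum.insert) auto
qed

text \<open>Abel summation, then the Cauchy-Schwarz inequality with each weight split as a product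
  of two square roots. One half sums to at most \<open>2 * \<Lambda>\<close>, the other stays with
  the squared partial sums.\<close>

lemma mblock_bound:
  "abs2 (mblock g \<mu> j x) \<le> 2 * \<Lambda> * (\<Sum>k\<in>{2 ^ j..<2 ^ Suc j}. wgt \<mu> j k * abs2 (psum g j k x))"
proof -
  let ?B = "{2 ^ j..<2 ^ Suc j} :: nat set"
  define b :: nat where "b = 2 ^ Suc j - 1"
  have b: "2 ^ Suc j = Suc b" "2 ^ j \<le> b" using one_le_power [of "2::nat" j] by (auto simp: b_def)
  have "mblock g \<mu> j x = (\<Sum>k\<in>{2 ^ j..<b}. (\<mu> k - \<mu> (Suc k)) * psum g j k x) + \<mu> b * psum g j b x"
    unfolding mblock_def b psum_def by (rule abel_summation [OF b(2)])
  then have "cmod (mblock g \<mu> j x) \<le> (\<Sum>k\<in>{2 ^ j..<b}. cmod ((\<mu> k - \<mu> (Suc k)) * psum g j k x)) + cmod (\<mu> b * psum g j b x)"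
    by (simp only:) (intro norm_triangle_le add_right_mono norm_sum)
  also have "\<dots> = (\<Sum>k\<in>{2 ^ j..<b}. wgt \<mu> j k * cmod (psum g j k x)) + wgt \<mu> j b * cmod (psum g j b x)"
    using b by (intro arg_cong2 [where f = "(+)"] sum.cong)
      (auto simp: wgt_def norm_mult abs_minus_commute simp flip: of_real_diff)
  also have "\<dots> = (\<Sum>k\<in>?B. wgt \<mu> j k * cmod (psum g j k x))"
    using b by (simp only: sum.atLeastLessThan_Suc)
  finally have "abs2 (mblock g \<mu> j x) \<le> (\<Sum>k\<in>?B. wgt \<mu> j k * cmod (psum g j k x))\<^sup>2"
    by (intro power_mono) auto
  also have "\<dots> = (\<Sum>k\<in>?B. sqrt (wgt \<mu> j k) * (sqrt (wgt \<mu> j k) * cmod (psum g j k x)))\<^sup>2"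
    using wgt_nonneg by (simp flip: mult.assoc)
  also have "\<dots> \<le> (\<Sum>k\<in>?B. (sqrt (wgt \<mu> j k))\<^sup>2) * (\<Sum>k\<in>?B. (sqrt (wgt \<mu> j k) * cmod (psum g j k x))\<^sup>2)"
    by (rule Cauchy_Schwarz_ineq_sum)
  also have "\<dots> = (\<Sum>k\<in>?B. wgt \<mu> j k) * (\<Sum>k\<in>?B. wgt \<mu> j k * abs2 (psum g j k x))"
    using wgt_nonneg by (simp add: power_mult_distrib)
  also have "\<dots> \<le> 2 * \<Lambda> * (\<Sum>k\<in>?B. wgt \<mu> j k * abs2 (psum g j k x))"
    using wgt_nonneg by (intro mult_right_mono sum_wgt_le sum_nonneg) auto
  finally show ?thesis .
qed

text \<open>Vectors are indexed by pairs of a block and a cut-off, with the square root of the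
  weight put into each component, so one application of the Riesz estimate handles all partial sums
  of all blocks. On its right-hand side the cut-off no longer occurs, and summing the weights of a
  block gives a second factor \<open>2 * \<Lambda>\<close> beside the one from
  \<open>mblock_bound\<close>.\<close>

lemma square_function_multiplier:
  assumes riesz: "\<And>(I :: (nat \<times> nat) set) a b D T U. finite I \<Longrightarrow>
      (\<forall>i\<in>I. a i \<le> b i \<and> D i \<in> tp {..<a i} \<and> T i \<in> tp {a i..<b i} \<and> U i \<in> tp {b i..}) \<Longrightarrow>
      mean (\<lambda>x. (\<Sum>i\<in>I. abs2 (T i x)) ^ Suc r)
      \<le> C * mean (\<lambda>x. (\<Sum>i\<in>I. abs2 (D i x + T i x + U i x)) ^ Suc r)" and C: "0 \<le> C"
  shows "mean (\<lambda>x. (\<Sum>j<n. abs2 (mblock g \<mu> j x)) ^ Suc r)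
    \<le> C * (4 * \<Lambda>\<^sup>2) ^ Suc r * mean (\<lambda>x. (\<Sum>j<n. abs2 (dyad j g x)) ^ Suc r)"
proof -
  note [continuous_intros] = tp_cont [OF mblock_tp] tp_cont [OF psum_tp] tp_cont [OF dyad_tp]
  define B where "B j = {2 ^ j..<2 ^ Suc j :: nat}" for j :: nat
  define I where "I = Sigma {..<n} B"
  have I: "finite I" by (auto simp: I_def B_def)
  have I_sum: "(\<Sum>i\<in>I. F (fst i) (snd i)) = (\<Sum>j<n. \<Sum>k\<in>B j. F j k)" for F :: "nat \<Rightarrow> nat \<Rightarrow> real"
    unfolding I_def by (subst sum.Sigma) (auto simp: B_def case_prod_beta)
  have "\<forall>i. \<exists>D U. i \<in> I \<longrightarrow> D \<in> tp {..<2 ^ fst i} \<and> U \<in> tp {int (Suc (snd i))..}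
      \<and> (\<forall>x. dyad (fst i) g x = D x + psum g (fst i) (snd i) x + U x)"
    using dyad_decomposition by (auto simp: I_def B_def)
  then obtain D U where DU: "\<And>i. i \<in> I \<Longrightarrow> D i \<in> tp {..<2 ^ fst i} \<and> U i \<in> tp {int (Suc (snd i))..}
      \<and> (\<forall>x. dyad (fst i) g x = D i x + psum g (fst i) (snd i) x + U i x)"
    by metis
  define s where "s i = complex_of_real (sqrt (wgt \<mu> (fst i) (snd i)))" for i
  have s: "abs2 (s i * z) = wgt \<mu> (fst i) (snd i) * abs2 z" for i z
    using wgt_nonneg by (simp add: s_def norm_mult power_mult_distrib)
  have "mean (\<lambda>x. (\<Sum>j<n. abs2 (mblock g \<mu> j x)) ^ Suc r)
    \<le> mean (\<lambda>x. (2 * \<Lambda>) ^ Suc r * (\<Sum>i\<in>I. abs2 (s i * psum g (fst i) (snd i) x)) ^ Suc r)"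
  proof (intro mean_mono continuous_intros)
    fix x
    have "(\<Sum>j<n. abs2 (mblock g \<mu> j x)) \<le> (\<Sum>j<n. 2 * \<Lambda> * (\<Sum>k\<in>B j. wgt \<mu> j k * abs2 (psum g j k x)))"
      unfolding B_def by (intro sum_mono mblock_bound)
    also have "\<dots> = 2 * \<Lambda> * (\<Sum>i\<in>I. abs2 (s i * psum g (fst i) (snd i) x))"
      unfolding s I_sum [of "\<lambda>j k. wgt \<mu> j k * abs2 (psum g j k x)"] by (simp add: sum_distrib_left)
    finally have "(\<Sum>j<n. abs2 (mblock g \<mu> j x)) ^ Suc r \<le> (2 * \<Lambda> * (\<Sum>i\<in>I. abs2 (s i * psum g (fst i) (snd i) x))) ^ Suc r"
      by (intro power_mono) (auto intro: sum_nonneg)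
    then show "(\<Sum>j<n. abs2 (mblock g \<mu> j x)) ^ Suc r
      \<le> (2 * \<Lambda>) ^ Suc r * (\<Sum>i\<in>I. abs2 (s i * psum g (fst i) (snd i) x)) ^ Suc r"
      by (simp only: power_mult_distrib)
  qed
  also have "\<dots> = (2 * \<Lambda>) ^ Suc r * mean (\<lambda>x. (\<Sum>i\<in>I. abs2 (s i * psum g (fst i) (snd i) x)) ^ Suc r)"
    by (rule mean_rmult)
  also have "\<dots> \<le> (2 * \<Lambda>) ^ Suc r * (C * mean (\<lambda>x. (\<Sum>i\<in>I. abs2 (s i * D i x + s i * psum g (fst i) (snd i) x + s i * U i x)) ^ Suc r))"
  proof (intro mult_left_mono riesz [OF I, of "\<lambda>i. 2 ^ fst i" "\<lambda>i. int (Suc (snd i))"] ballI conjI tp_cmult psum_tp)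
    fix i assume i: "i \<in> I"
    then have "2 ^ fst i \<le> snd i" by (auto simp: I_def B_def)
    then have "int (2 ^ fst i) \<le> int (snd i)" by (simp only: of_nat_le_iff)
    then show "2 ^ fst i \<le> int (Suc (snd i))"
      unfolding of_nat_power of_nat_numeral of_nat_Suc by linarith
    show "D i \<in> tp {..<2 ^ fst i}" "U i \<in> tp {int (Suc (snd i))..}" using DU [OF i] by auto
  qed (use \<Lambda> in auto)
  also have "(\<lambda>x. (\<Sum>i\<in>I. abs2 (s i * D i x + s i * psum g (fst i) (snd i) x + s i * U i x)) ^ Suc r)
    = (\<lambda>x. (\<Sum>j<n. (\<Sum>k\<in>B j. wgt \<mu> j k) * abs2 (dyad j g x)) ^ Suc r)"
  proof (rule ext, rule arg_cong [where f = "\<lambda>y. y ^ Suc r"])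
    fix x
    have "(\<Sum>i\<in>I. abs2 (s i * D i x + s i * psum g (fst i) (snd i) x + s i * U i x))
        = (\<Sum>i\<in>I. wgt \<mu> (fst i) (snd i) * abs2 (dyad (fst i) g x))"
      by (intro sum.cong refl) (simp add: DU s flip: distrib_left)
    then show "(\<Sum>i\<in>I. abs2 (s i * D i x + s i * psum g (fst i) (snd i) x + s i * U i x))
        = (\<Sum>j<n. (\<Sum>k\<in>B j. wgt \<mu> j k) * abs2 (dyad j g x))"
      by (simp add: I_sum [of "\<lambda>j k. wgt \<mu> j k * abs2 (dyad j g x)"] sum_distrib_right)
  qed
  also have "mean \<dots> \<le> mean (\<lambda>x. (2 * \<Lambda>) ^ Suc r * (\<Sum>j<n. abs2 (dyad j g x)) ^ Suc r)"
  proof (intro mean_mono continuous_intros)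
    fix x
    have "(\<Sum>j<n. (\<Sum>k\<in>B j. wgt \<mu> j k) * abs2 (dyad j g x)) \<le> (\<Sum>j<n. 2 * \<Lambda> * abs2 (dyad j g x))"
      unfolding B_def by (intro sum_mono mult_right_mono sum_wgt_le) auto
    also have "\<dots> = 2 * \<Lambda> * (\<Sum>j<n. abs2 (dyad j g x))" by (simp add: sum_distrib_left)
    finally have "(\<Sum>j<n. (\<Sum>k\<in>B j. wgt \<mu> j k) * abs2 (dyad j g x)) ^ Suc r \<le> (2 * \<Lambda> * (\<Sum>j<n. abs2 (dyad j g x))) ^ Suc r"
      using wgt_nonneg by (intro power_mono) (auto intro!: sum_nonneg mult_nonneg_nonneg)
    then show "(\<Sum>j<n. (\<Sum>k\<in>B j. wgt \<mu> j k) * abs2 (dyad j g x)) ^ Suc r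
      \<le> (2 * \<Lambda>) ^ Suc r * (\<Sum>j<n. abs2 (dyad j g x)) ^ Suc r"
      by (simp only: power_mult_distrib)
  qed
  also have "mean (\<lambda>x. (2 * \<Lambda>) ^ Suc r * (\<Sum>j<n. abs2 (dyad j g x)) ^ Suc r)
     = (2 * \<Lambda>) ^ Suc r * mean (\<lambda>x. (\<Sum>j<n. abs2 (dyad j g x)) ^ Suc r)"
    by (rule mean_rmult)
  finally have "mean (\<lambda>x. (\<Sum>j<n. abs2 (mblock g \<mu> j x)) ^ Suc r)
    \<le> (2 * \<Lambda>) ^ Suc r * (C * ((2 * \<Lambda>) ^ Suc r * mean (\<lambda>x. (\<Sum>j<n. abs2 (dyad j g x)) ^ Suc r)))"
    using C \<Lambda> by (simp add: mult_left_mono)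
  moreover have "(4 * \<Lambda>\<^sup>2) ^ Suc r = (2 * \<Lambda>) ^ Suc r * (2 * \<Lambda>) ^ Suc r"
    by (simp only: power_mult_distrib [symmetric]) (simp add: power2_eq_square)
  ultimately show ?thesis by (simp only: mult_ac)
qed

text \<open>Adjacent blocks violate the gap condition of \<open>lac\<close>, which asks that
  \<open>Suc r\<close> times each frequency stay below the start of the next block. Blocks at
  distance \<open>L\<close> satisfy it: frequencies of block \<open>j\<close> are below
  \<open>2 * 2 ^ j\<close>, whence the requirement on \<open>2 * Suc r\<close>. The \<open>L\<close>
  residue classes are recombined at the cost of a constant.\<close>

lemma mblock_lacunary_sum:
  assumes lac: "\<And>n b v. mono b \<and> (1::int) \<le> b 0 \<and>
      (\<forall>t<n. v t \<in> tp {k. b t \<le> k \<and> int (Suc r) * k < b (Suc t)}) \<Longrightarrow>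
      mean (\<lambda>x. abs2 (\<Sum>t<n. v t x) ^ Suc r)
      \<le> C * mean (\<lambda>x. (\<Sum>t<n. abs2 (v t x)) ^ Suc r)" and C: "0 \<le> C"
    and L: "2 * Suc r \<le> 2 ^ L"
  shows "mean (\<lambda>x. abs2 (\<Sum>j<n * L. mblock g \<mu> j x) ^ Suc r)
    \<le> L * real L ^ (2 * Suc r) * C * mean (\<lambda>x. (\<Sum>j<n * L. abs2 (mblock g \<mu> j x)) ^ Suc r)"
proof -
  note [continuous_intros] = tp_cont [OF mblock_tp]
  have L0: "L \<noteq> 0" using L by (cases L) auto
  let ?F = "\<lambda>a x. \<Sum>t<n. mblock g \<mu> (a + t * L) x"
  let ?M = "mean (\<lambda>x. (\<Sum>j<n * L. abs2 (mblock g \<mu> j x)) ^ Suc r)"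
  have pow: "(y\<^sup>2) ^ Suc r = y ^ (2 * Suc r)" for y :: real by (rule power_mult [symmetric])
  have "mean (\<lambda>x. abs2 (\<Sum>j<n * L. mblock g \<mu> j x) ^ Suc r)
    \<le> mean (\<lambda>x. real L ^ (2 * Suc r) * (\<Sum>a<L. abs2 (?F a x) ^ Suc r))"
  proof (intro mean_mono continuous_intros)
    fix x
    have "cmod (\<Sum>j<n * L. mblock g \<mu> j x) \<le> (\<Sum>a<L. cmod (?F a x))"
      unfolding sum_residues by (rule norm_sum)
    then have "abs2 (\<Sum>j<n * L. mblock g \<mu> j x) ^ Suc r \<le> (\<Sum>a<L. cmod (?F a x)) ^ (2 * Suc r)"
      unfolding pow by (rule power_mono) simp
    also have "\<dots> \<le> real L ^ (2 * Suc r) * (\<Sum>a<L. cmod (?F a x) ^ (2 * Suc r))"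
      using power_sum_le [of "\<lambda>a. cmod (?F a x)" L "2 * Suc r"] L0 by simp
    finally show "abs2 (\<Sum>j<n * L. mblock g \<mu> j x) ^ Suc r
      \<le> real L ^ (2 * Suc r) * (\<Sum>a<L. abs2 (?F a x) ^ Suc r)" by (simp only: pow)
  qed
  also have "\<dots> = real L ^ (2 * Suc r) * (\<Sum>a<L. mean (\<lambda>x. abs2 (?F a x) ^ Suc r))"
    unfolding mean_rmult by (subst mean_sum) (auto intro!: continuous_intros)
  also have "\<dots> \<le> real L ^ (2 * Suc r) * (\<Sum>a<L. C * ?M)"
  proof (intro mult_left_mono sum_mono)
    fix a assume a: "a \<in> {..<L}"
    have "mean (\<lambda>x. abs2 (?F a x) ^ Suc r) \<le> C * mean (\<lambda>x. (\<Sum>t<n. abs2 (mblock g \<mu> (a + t * L) x)) ^ Suc r)"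
    proof (rule lac [of "\<lambda>t. 2 ^ (a + t * L)"], intro conjI allI impI)
      show "mono (\<lambda>t. 2 ^ (a + t * L) :: int)"
        by (intro monoI power_increasing) auto
      show "1 \<le> (2 ^ (a + 0 * L) :: int)" by simp
      fix t
      show "mblock g \<mu> (a + t * L) \<in> tp {k. 2 ^ (a + t * L) \<le> k \<and> int (Suc r) * k < 2 ^ (a + Suc t * L)}"
      proof (rule tp_mono [OF mblock_tp], safe)
        fix k :: int assume k: "k \<in> {2 ^ (a + t * L)..<2 * 2 ^ (a + t * L)}"
        then show "2 ^ (a + t * L) \<le> k" by simp
        have "int (Suc r) * k < int (Suc r) * (2 * 2 ^ (a + t * L))"
          using k by (intro mult_strict_left_mono) auto
        also have "\<dots> = int (2 * Suc r) * 2 ^ (a + t * L)" by simp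
        also have "\<dots> \<le> int (2 ^ L) * 2 ^ (a + t * L)"
          using L by (intro mult_right_mono) (simp_all only: of_nat_le_iff zero_le_power zero_le_numeral)
        also have "\<dots> = 2 ^ (a + Suc t * L)" by (simp add: power_add mult_ac)
        finally show "int (Suc r) * k < 2 ^ (a + Suc t * L)" .
      qed
    qed
    also have "\<dots> \<le> C * ?M"
    proof (intro mult_left_mono C mean_mono continuous_intros power_mono sum_nonneg)
      fix x
      show "(\<Sum>t<n. abs2 (mblock g \<mu> (a + t * L) x)) \<le> (\<Sum>j<n * L. abs2 (mblock g \<mu> j x))"
        unfolding sum_residues using a
        by (intro member_le_sum [of a "{..<L}" "\<lambda>a. \<Sum>t<n. abs2 (mblock g \<mu> (a + t * L) x)"] sum_nonneg) auto
    qed auto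
    finally show "mean (\<lambda>x. abs2 (?F a x) ^ Suc r) \<le> C * ?M" .
  qed simp
  finally show ?thesis by (simp add: mult_ac)
qed

end

text \<open>The jump from the last frequency of a block to the first of the next is not counted,
  because Abel summation never crosses a block boundary.\<close>

definition marcinkiewicz :: "(nat \<Rightarrow> real) \<Rightarrow> real \<Rightarrow> bool" where
  "marcinkiewicz \<mu> \<Lambda> \<longleftrightarrow> 0 \<le> \<Lambda> \<and> (\<forall>k\<ge>1. \<bar>\<mu> k\<bar> \<le> \<Lambda>) \<and>
     (\<forall>j. (\<Sum>k\<in>{2 ^ j..<2 ^ Suc j - 1}. \<bar>\<mu> (Suc k) - \<mu> k\<bar>) \<le> \<Lambda>)"

lemma marcinkiewicz_mono: "marcinkiewicz \<mu> \<Lambda> \<Longrightarrow> \<Lambda> \<le> \<Lambda>' \<Longrightarrow> marcinkiewicz \<mu> \<Lambda>'"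
  unfolding marcinkiewicz_def by (meson order_trans)

lemma marcinkiewicz_polynomial:
  "\<exists>C\<ge>0. \<forall>g (\<mu> :: nat \<Rightarrow> real) (\<Lambda> :: real) d. g \<in> tp {- int d<..<int d} \<and> (\<forall>t. cmod (g t) \<le> 1) \<and> marcinkiewicz \<mu> \<Lambda> \<longrightarrow>
      mean (\<lambda>x. (abs2 (\<Sum>k\<in>{1..<d}. \<mu> k * (fc g (int k) * ex (int k) x))) ^ Suc r)
      \<le> C * (\<Lambda>\<^sup>2) ^ Suc r"
proof -
  obtain C1 where C1: "0 \<le> C1" "\<And>(I :: (nat \<times> nat) set) a b D T U. finite I \<Longrightarrow>
      (\<forall>i\<in>I. a i \<le> b i \<and> D i \<in> tp {..<a i} \<and> T i \<in> tp {a i..<b i} \<and> U i \<in> tp {b i..}) \<Longrightarrow>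
      mean (\<lambda>x. (\<Sum>i\<in>I. abs2 (T i x)) ^ Suc r)
      \<le> C1 * mean (\<lambda>x. (\<Sum>i\<in>I. abs2 (D i x + T i x + U i x)) ^ Suc r)"
    using vector_riesz_interval [where 'i = "nat \<times> nat", of r] by blast
  obtain C2 where C2: "0 \<le> C2" "\<And>n b v. mono b \<and> (1::int) \<le> b 0 \<and>
      (\<forall>t<n. v t \<in> tp {k. b t \<le> k \<and> int (Suc r) * k < b (Suc t)}) \<Longrightarrow>
      mean (\<lambda>x. abs2 (\<Sum>t<n. v t x) ^ Suc r)
      \<le> C2 * mean (\<lambda>x. (\<Sum>t<n. abs2 (v t x)) ^ Suc r)"
    using lacunary_square_function [of r] by blast
  obtain C3 where C3: "0 \<le> C3" "\<And>g n. g \<in> tp UNIV \<and> (\<forall>t. cmod (g t) \<le> 1) \<Longrightarrow>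
      mean (\<lambda>x. (\<Sum>j<n. abs2 (dyad j g x)) ^ Suc r) \<le> C3"
    using smooth_square_function [of r] by blast
  define L where "L = Suc (Suc r)"
  have L: "2 * Suc r \<le> 2 ^ L"
    using less_exp [of "Suc r"] by (simp add: L_def)
  define K where "K = L * real L ^ (2 * Suc r) * C2"
  have K: "0 \<le> K" using C2 by (simp add: K_def)
  show ?thesis
  proof (intro exI [of _ "K * (C1 * 4 ^ Suc r * C3)"] conjI allI impI)
    show "0 \<le> K * (C1 * 4 ^ Suc r * C3)" using K C1 C3 by simp
    fix g and \<mu> :: "nat \<Rightarrow> real" and \<Lambda> :: real and d
    assume "g \<in> tp {- int d<..<int d} \<and> (\<forall>t. cmod (g t) \<le> 1) \<and> marcinkiewicz \<mu> \<Lambda>"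
    then have g: "g \<in> tp {- int d<..<int d}" "\<forall>t. cmod (g t) \<le> 1" and \<Lambda>: "0 \<le> \<Lambda>"
      and \<mu>: "\<And>k. 1 \<le> k \<Longrightarrow> \<bar>\<mu> k\<bar> \<le> \<Lambda>"
      and var: "\<And>j. (\<Sum>k\<in>{2 ^ j..<2 ^ Suc j - 1}. \<bar>\<mu> (Suc k) - \<mu> k\<bar>) \<le> \<Lambda>"
      by (auto simp: marcinkiewicz_def)
    have g': "g \<in> tp UNIV" by (rule tp_mono [OF g(1)]) simp
    \<comment> \<open>The number of blocks is taken to be \<open>d * L\<close>: a multiple of
      \<open>L\<close>, as the splitting into residue classes demands, and large enough to reach the
      degree of \<open>g\<close>.\<close>
    have d: "d \<le> 2 ^ (d * L)"
    proof -
      have "d \<le> 2 ^ d" by (rule less_imp_le [OF less_exp])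
      also have "\<dots> \<le> 2 ^ (d * L)" by (intro power_increasing) (simp_all add: L_def)
      finally show ?thesis .
    qed
    have eq: "(\<Sum>k\<in>{1..<d}. \<mu> k * (fc g (int k) * ex (int k) x)) = (\<Sum>j<d * L. mblock g \<mu> j x)" for x
    proof -
      have "(\<Sum>j<d * L. mblock g \<mu> j x) = (\<Sum>k\<in>{1..<2 ^ (d * L)}. \<mu> k * harm g k x)"
        unfolding mblock_def by (rule sum_dyadic_blocks)
      also have "\<dots> = (\<Sum>k\<in>{1..<d}. \<mu> k * harm g k x)"
        using d by (intro sum.mono_neutral_right)
          (auto simp: harm_def fc_outside [OF g(1)])
      finally show ?thesis by (simp add: harm_def)
    qed
    have "mean (\<lambda>x. (abs2 (\<Sum>k\<in>{1..<d}. \<mu> k * (fc g (int k) * ex (int k) x))) ^ Suc r)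
       \<le> K * mean (\<lambda>x. (\<Sum>j<d * L. abs2 (mblock g \<mu> j x)) ^ Suc r)"
      unfolding eq K_def by (rule mblock_lacunary_sum [OF \<Lambda> \<mu> var C2(2) C2(1) L])
    also have "\<dots> \<le> K * (C1 * (4 * \<Lambda>\<^sup>2) ^ Suc r * mean (\<lambda>x. (\<Sum>j<d * L. abs2 (dyad j g x)) ^ Suc r))"
      by (intro mult_left_mono K square_function_multiplier [OF \<Lambda> \<mu> var C1(2) C1(1)])
    also have "\<dots> \<le> K * (C1 * (4 * \<Lambda>\<^sup>2) ^ Suc r * C3)"
      using C1 K \<Lambda> C3(2) [of g "d * L"] g g' by (intro mult_left_mono) auto
    also have "\<dots> = K * (C1 * 4 ^ Suc r * C3) * (\<Lambda>\<^sup>2) ^ Suc r"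
      by (simp only: power_mult_distrib mult_ac)
    finally show "mean (\<lambda>x. (abs2 (\<Sum>k\<in>{1..<d}. \<mu> k * (fc g (int k) * ex (int k) x))) ^ Suc r)
      \<le> K * (C1 * 4 ^ Suc r * C3) * (\<Lambda>\<^sup>2) ^ Suc r" .
  qed
qed


subsection \<open>Fejer means of summable functions\<close>

text \<open>Measurability supplies continuous functions that converge off a negligible set, but
  without a common bound. Truncating values and cutting off near the endpoints restores domination:
  first the truncation level \<open>m\<close> tends to infinity under the majorant
  \<open>2 * cmod (f x)\<close>, then for fixed \<open>m\<close> the continuous approximations
  converge under the constant majorant \<open>2 * m\<close>. Vanishing near both endpoints makes
  \<open>\<phi>\<close> compatible with periodicity.\<close>

lemma approx_by_continuous:
  fixes f :: "real \<Rightarrow> complex"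
  assumes f: "integrable circle f" and \<epsilon>: "0 < \<epsilon>"
  shows "\<exists>\<phi> \<delta>. continuous_on UNIV \<phi> \<and> 0 < \<delta> \<and> (\<forall>x. pi - \<delta> \<le> \<bar>x\<bar> \<longrightarrow> \<phi> x = 0) \<and>
      (\<integral>x. cmod (f x - \<phi> x) \<partial>circle) < \<epsilon>"
proof -
  let ?M = "circle"
  interpret finite_measure ?M by (rule finite_measure_lebesgue_on) simp
  have "f measurable_on {-pi..pi}"
    using f by (subst measurable_on_iff_borel_measurable) auto
  then obtain N g where N: "negligible N" and g: "\<And>n. continuous_on UNIV (g n)"
    and lim: "\<And>x. x \<notin> N \<Longrightarrow> (\<lambda>n. g n x) \<longlonglongrightarrow> (if x \<in> {-pi..pi} then f x else 0)"
    unfolding measurable_on_def by blast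
  have "N \<union> {-pi, pi} \<in> null_sets lebesgue"
    using N by (simp add: negligible_Un flip: negligible_iff_null_sets)
  then have "AE x in lebesgue. x \<notin> N \<union> {-pi, pi}" by (rule AE_not_in)
  then have AE_N: "AE x in ?M. x \<notin> N \<and> \<bar>x\<bar> < pi \<and> -pi \<le> x \<and> x \<le> pi"
  proof (subst AE_restrict_space_iff)
    assume "AE x in lebesgue. x \<notin> N \<union> {-pi, pi}"
    then show "AE x in lebesgue. x \<in> {-pi..pi} \<longrightarrow> x \<notin> N \<and> \<bar>x\<bar> < pi \<and> -pi \<le> x \<and> x \<le> pi"
      by eventually_elim auto
  qed simp
  \<comment> \<open>\<open>cl m\<close> is the radial truncation at modulus \<open>m\<close>; the
    cut-off \<open>\<kappa> m\<close> below vanishes within distance \<open>1 / m\<close> of the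
    endpoints and equals 1 from distance \<open>2 / m\<close> on.\<close>
  define cl where "cl m z = (m / max m (cmod z)) *\<^sub>R z" for m :: real and z :: complex
  define \<kappa> where "\<kappa> m x = max 0 (min 1 (m * (pi - \<bar>x\<bar>) - 1))" for m x :: real
  have \<kappa>: "0 \<le> \<kappa> m x" "\<kappa> m x \<le> 1" for m x by (auto simp: \<kappa>_def)
  have cl_norm: "cmod (cl m z) \<le> m" "cmod (cl m z) \<le> cmod z" if "0 < m" for m z
    using that by (auto simp: cl_def max_def field_simps mult_left_le_one_le)
  have cl_cont: "continuous_on UNIV (cl m)" if "0 < m" for m
    unfolding cl_def using that by (intro continuous_intros) (auto simp: max_def)
  have \<kappa>_cont: "continuous_on UNIV (\<kappa> m)" for m unfolding \<kappa>_def by (intro continuous_intros)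
  define h where "h m n x = \<kappa> m x *\<^sub>R cl m (g n x)" for m n x
  define k where "k m x = \<kappa> m x *\<^sub>R cl m (f x)" for m x
  have h_cont: "continuous_on UNIV (h m n)" if "0 < m" for m n
    unfolding h_def
    by (intro continuous_intros \<kappa>_cont continuous_on_compose2 [OF cl_cont [OF that] g]) auto
  have h_meas: "h m n \<in> borel_measurable ?M" if "0 < m" for m n
    by (rule borel_measurable_integrable [OF cont_integrable [OF h_cont [OF that]]])
  have f_meas [measurable]: "f \<in> borel_measurable ?M" by (rule borel_measurable_integrable [OF f])
  have k_meas: "k m \<in> borel_measurable ?M" if "0 < m" for m
  proof -
    have "\<kappa> m \<in> borel_measurable ?M"
      by (rule borel_measurable_integrable [OF cont_integrable [OF \<kappa>_cont]])
    moreover have "(\<lambda>x. cl m (f x)) \<in> borel_measurable ?M"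
      by (rule measurable_compose [OF f_meas borel_measurable_continuous_onI [OF cl_cont [OF that]]])
    ultimately show ?thesis unfolding k_def by (rule borel_measurable_scaleR)
  qed
  have norm_h: "cmod (h m n x) \<le> m" if "0 < m" for m n x
    unfolding h_def using \<kappa> [of m x] cl_norm(1) [OF that, of "g n x"] that
    by (simp add: mult_le_one) (meson mult_left_le_one_le norm_ge_zero order_trans)
  have norm_k: "cmod (k m x) \<le> cmod (f x)" "cmod (k m x) \<le> m" if "0 < m" for m x
    unfolding k_def using \<kappa> [of m x] cl_norm [OF that, of "f x"] that
    by (simp_all) (meson mult_left_le_one_le norm_ge_zero order_trans)+
  have 1: "(\<lambda>m. \<integral>x. cmod (f x - k (real (Suc m)) x) \<partial>?M) \<longlonglongrightarrow> (\<integral>x. 0 \<partial>?M)"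
  proof (rule integral_dominated_convergence [where w = "\<lambda>x. 2 * cmod (f x)"])
    show "AE x in ?M. (\<lambda>m. cmod (f x - k (real (Suc m)) x)) \<longlonglongrightarrow> 0"
      using AE_N
    proof eventually_elim
      case (elim x)
      obtain m1 where m1: "cmod (f x) \<le> real m1" using real_arch_simple by blast
      obtain m2 where m2: "2 / (pi - \<bar>x\<bar>) \<le> real m2" using real_arch_simple by blast
      have "k (real (Suc m)) x = f x" if m: "m \<ge> max m1 m2" for m
      proof -
        have a: "cmod (f x) \<le> real (Suc m)" using m m1 by simp
        have "2 / (pi - \<bar>x\<bar>) \<le> real (Suc m)" using m m2 by simp
        then have "2 \<le> real (Suc m) * (pi - \<bar>x\<bar>)" using elim by (simp add: divide_le_eq)
        then show ?thesis using a by (simp add: k_def \<kappa>_def cl_def max_def)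
      qed
      then have "\<forall>\<^sub>F m in sequentially. cmod (f x - k (real (Suc m)) x) = 0"
        unfolding eventually_sequentially by (intro exI [of _ "max m1 m2"]) simp
      then show ?case by (rule tendsto_eventually)
    qed
    show "AE x in ?M. norm (cmod (f x - k (real (Suc m)) x)) \<le> 2 * cmod (f x)" for m
      using norm_k(1) [of "real (Suc m)"] norm_triangle_ineq4 [of "f _" "k (real (Suc m)) _"]
      by (intro AE_I2) (simp, smt (verit))
    show "(\<lambda>x. cmod (f x - k (real (Suc m)) x)) \<in> borel_measurable ?M" for m
      by (intro measurable_compose [OF _ borel_measurable_norm] borel_measurable_diff f_meas k_meas) simp
  qed (use f in auto)
  then have "\<forall>\<^sub>F m in sequentially. (\<integral>x. cmod (f x - k (real (Suc m)) x) \<partial>?M) < \<epsilon> / 2"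
    using \<epsilon> by (intro order_tendstoD(2) [OF 1]) auto
  then obtain m0 where m0: "(\<integral>x. cmod (f x - k (real (Suc m0)) x) \<partial>?M) < \<epsilon> / 2"
    unfolding eventually_sequentially by blast
  define m where "m = real (Suc m0)"
  have m: "0 < m" by (simp add: m_def)
  have m': "(\<integral>x. cmod (f x - k m x) \<partial>?M) < \<epsilon> / 2" using m0 by (simp add: m_def)
  have 2: "(\<lambda>n. \<integral>x. cmod (k m x - h m n x) \<partial>?M) \<longlonglongrightarrow> (\<integral>x. 0 \<partial>?M)"
  proof (rule integral_dominated_convergence [where w = "\<lambda>x. 2 * m"])
    show "AE x in ?M. (\<lambda>n. cmod (k m x - h m n x)) \<longlonglongrightarrow> 0"
      using AE_N
    proof eventually_elim
      case (elim x)
      then have "(\<lambda>n. g n x) \<longlonglongrightarrow> f x" using lim [of x] by simp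
      moreover have "isCont (cl m) (f x)"
        using cl_cont [OF m] by (simp add: continuous_on_eq_continuous_at)
      ultimately have "(\<lambda>n. cl m (g n x)) \<longlonglongrightarrow> cl m (f x)" by (rule isCont_tendsto_compose [rotated])
      then have "(\<lambda>n. cmod (k m x - h m n x)) \<longlonglongrightarrow> cmod (k m x - \<kappa> m x *\<^sub>R cl m (f x))"
        unfolding h_def by (intro tendsto_intros)
      then show ?case by (simp add: k_def)
    qed
    show "AE x in ?M. norm (cmod (k m x - h m n x)) \<le> 2 * m" for n
      using norm_k(2) [OF m] norm_h [OF m, of n] norm_triangle_ineq4 [of "k m _" "h m n _"]
      by (intro AE_I2) (simp, smt (verit))
    show "(\<lambda>x. cmod (k m x - h m n x)) \<in> borel_measurable ?M" for n
      by (intro measurable_compose [OF _ borel_measurable_norm] borel_measurable_diff h_meas k_meas m)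
  qed auto
  then have "\<forall>\<^sub>F n in sequentially. (\<integral>x. cmod (k m x - h m n x) \<partial>?M) < \<epsilon> / 2"
    using \<epsilon> by (intro order_tendstoD(2) [OF 2]) auto
  then obtain n where n: "(\<integral>x. cmod (k m x - h m n x) \<partial>?M) < \<epsilon> / 2"
    unfolding eventually_sequentially by blast
  have k_int: "integrable ?M (k m)"
    by (rule Bochner_Integration.integrable_bound [OF f k_meas [OF m]]) (use norm_k(1) [OF m] in auto)
  have h_int: "integrable ?M (h m n)" by (rule cont_integrable [OF h_cont [OF m]])
  have "(\<integral>x. cmod (f x - h m n x) \<partial>?M) \<le> (\<integral>x. cmod (f x - k m x) + cmod (k m x - h m n x) \<partial>?M)"
    using f k_int h_int
    by (intro integral_mono) (auto intro!: norm_diff_triangle_le)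
  also have "\<dots> = (\<integral>x. cmod (f x - k m x) \<partial>?M) + (\<integral>x. cmod (k m x - h m n x) \<partial>?M)"
    using f k_int h_int by (intro Bochner_Integration.integral_add) auto
  also have "\<dots> < \<epsilon>" using n m' by linarith
  finally have "(\<integral>x. cmod (f x - h m n x) \<partial>?M) < \<epsilon>" .
  moreover have "h m n x = 0" if "pi - 1 / m \<le> \<bar>x\<bar>" for x
  proof -
    have "m * (pi - \<bar>x\<bar>) \<le> m * (1 / m)" using that m by (intro mult_left_mono) auto
    then have "\<kappa> m x = 0" using m by (simp add: \<kappa>_def)
    then show ?thesis by (simp add: h_def)
  qed
  ultimately show ?thesis
    using h_cont [OF m] m by (intro exI [of _ "h m n"] exI [of _ "1 / m"]) auto
qed

lemma mean_mono_on:
  fixes f g :: "real \<Rightarrow> real"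
  assumes "integrable circle f" "integrable circle g"
    "\<And>x. -pi \<le> x \<Longrightarrow> x \<le> pi \<Longrightarrow> f x \<le> g x"
  shows "mean f \<le> mean g"
  unfolding mean_def using assms by (auto intro!: divide_right_mono integral_mono)

text \<open>The test function of Korovkin's method: the cosine is reproduced up to the factor
  \<open>fej N 1 = 1 - 1 / N\<close>. Together with total mass 1 this measures how far the kernel is
  concentrated at 0.\<close>

lemma mean_fejer_kernel_cos:
  assumes "N \<ge> 1"
  shows "mean (\<lambda>t. (1 - cos (x - t)) * fejer_kernel N (x - t)) = 1 / N"
proof -
  note [continuous_intros] = cont_fejer_kernel
  have 0: "cos (x - t) * fejer_kernel N (x - t) = Re (ex 1 x * (ex (- 1) t * of_real (fejer_kernel N (x - t))))" for t
  proof -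
    have "ex 1 x * ex (- 1) t = ex 1 (x - t)" by (simp add: ex_diff_arg)
    moreover have "Re (ex 1 (x - t)) = cos (x - t)" by (simp add: ex_def Re_exp)
    moreover have "ex 1 x * (ex (- 1) t * of_real (fejer_kernel N (x - t)))
      = (ex 1 x * ex (- 1) t) * of_real (fejer_kernel N (x - t))" by simp
    ultimately show ?thesis by (metis Re_complex_of_real times_complex.sel(1) Im_complex_of_real mult_zero_right diff_zero)
  qed
  have "sigma N (ex (- 1)) x = of_real (fej N 1) * ex (- 1) x"
  proof -
    have "sigma N (ex (- 1)) x = (\<Sum>k\<in>{- int N<..<int N}. if k = - 1 then of_real (fej N 1) * ex (- 1) x else 0)"
      unfolding sigma_def using fc_ex [of 1 "- 1"] by (intro sum.cong refl) (auto simp: fej_def)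
    then show ?thesis using assms by (auto simp: fej_def)
  qed
  then have 1: "mean (\<lambda>t. ex (- 1) t * of_real (fejer_kernel N (x - t))) = of_real (fej N 1) * ex (- 1) x"
    by (simp only: sigma_kernel [OF cont_integrable [OF cont_ex] assms])
  have "mean (\<lambda>t. cos (x - t) * fejer_kernel N (x - t)) = Re (ex 1 x * (of_real (fej N 1) * ex (- 1) x))"
    unfolding 0 by (subst mean_Re) (auto simp only: mean_cmult 1 intro!: continuous_intros)
  also have "ex 1 x * (of_real (fej N 1) * ex (- 1) x) = of_real (fej N 1)"
    using ex_mult_cnj [of 1 x] by (simp add: ex_minus mult_ac)
  finally have "mean (\<lambda>t. cos (x - t) * fejer_kernel N (x - t)) = fej N 1" by simp
  then have "mean (\<lambda>t. (1 - cos (x - t)) * fejer_kernel N (x - t)) = 1 - fej N 1"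
    unfolding left_diff_distrib mult_1_left
    by (subst mean_diff) (auto simp: mean_fejer_kernel [OF assms] intro!: continuous_intros)
  also have "\<dots> = 1 / N" using assms by (auto simp: fej_def)
  finally show ?thesis .
qed

text \<open>Korovkin's argument: the oscillation of \<open>\<phi>\<close> between two points is at
  most \<open>\<epsilon> / 2 + K * (1 - cos (x - t))\<close>, and averaging over the kernel leaves
  \<open>\<epsilon> / 2 + K / N\<close>.\<close>

lemma fejer_uniform:
  assumes \<phi>: "continuous_on UNIV \<phi>" and \<delta>: "0 < \<delta>" "\<And>x. pi - \<delta> \<le> \<bar>x\<bar> \<Longrightarrow> \<phi> x = 0" and \<epsilon>: "0 < \<epsilon>"
  shows "\<exists>N0. \<forall>N\<ge>N0. \<forall>x. -pi \<le> x \<longrightarrow> x \<le> pi \<longrightarrow> cmod (sigma N \<phi> x - \<phi> x) \<le> \<epsilon>"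
proof -
  have "bounded (\<phi> ` {-pi..pi})"
    by (intro compact_imp_bounded compact_continuous_image continuous_on_subset [OF \<phi>]) auto
  then obtain B where B: "0 < B" "\<And>x. -pi \<le> x \<Longrightarrow> x \<le> pi \<Longrightarrow> cmod (\<phi> x) \<le> B"
    unfolding bounded_pos by auto
  have "uniformly_continuous_on {-pi..pi} \<phi>"
    by (intro compact_uniformly_continuous continuous_on_subset [OF \<phi>]) auto
  then obtain d where d: "0 < d" "\<And>x t. x \<in> {-pi..pi} \<Longrightarrow> t \<in> {-pi..pi} \<Longrightarrow> dist t x < d \<Longrightarrow> dist (\<phi> t) (\<phi> x) < \<epsilon> / 2"
    unfolding uniformly_continuous_on_def using \<epsilon> half_gt_zero by metis
  define \<eta> where "\<eta> = min (min d \<delta>) 1"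
  have \<eta>: "0 < \<eta>" "\<eta> \<le> d" "\<eta> \<le> \<delta>" "\<eta> < pi"
    using d(1) \<delta>(1) pi_gt3 by (auto simp: \<eta>_def)
  have cos\<eta>: "0 < 1 - cos \<eta>" using cos_monotone_0_pi [of 0 \<eta>] \<eta> by simp
  define K where "K = 2 * B / (1 - cos \<eta>)"
  have K: "0 < K" using B cos\<eta> by (simp add: K_def)
  have key: "cmod (\<phi> t - \<phi> x) \<le> \<epsilon> / 2 + K * (1 - cos (x - t))"
    if x: "-pi \<le> x" "x \<le> pi" and t: "-pi \<le> t" "t \<le> pi" for x t
  proof -
    have nn: "0 \<le> K * (1 - cos (x - t))" using K by simp
    \<comment> \<open>Points close to each other, points apart on the circle, and points near
      opposite endpoints. In the last case \<open>1 - cos (x - t)\<close> is small although the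
      points are far apart on the line, and the vanishing of \<open>\<phi>\<close> near the
      endpoints is what helps.\<close>
    consider "\<bar>x - t\<bar> < \<eta>" | "\<eta> \<le> \<bar>x - t\<bar>" "\<bar>x - t\<bar> \<le> 2 * pi - \<eta>" | "2 * pi - \<eta> < \<bar>x - t\<bar>" by linarith
    then show ?thesis
    proof cases
      case 1
      then have "dist (\<phi> t) (\<phi> x) < \<epsilon> / 2"
        using \<eta> x t by (intro d(2)) (auto simp: dist_real_def)
      then show ?thesis using nn by (simp add: dist_norm)
    next
      case 2
      have "cos \<bar>x - t\<bar> \<le> cos \<eta>"
      proof (cases "\<bar>x - t\<bar> \<le> pi")
        case True
        then show ?thesis using 2 \<eta> by (intro cos_monotone_0_pi_le) auto
      next
        case False
        have "cos (2 * pi - \<bar>x - t\<bar>) \<le> cos \<eta>"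
          using 2 \<eta> False by (intro cos_monotone_0_pi_le) auto
        then show ?thesis by (simp add: cos_diff)
      qed
      then have "K * (1 - cos \<eta>) \<le> K * (1 - cos (x - t))"
        using K by (intro mult_left_mono) auto
      moreover have "K * (1 - cos \<eta>) = 2 * B" using cos\<eta> by (simp add: K_def)
      moreover have "cmod (\<phi> t - \<phi> x) \<le> 2 * B"
        using B(2) [OF x] B(2) [OF t] norm_triangle_ineq4 [of "\<phi> t" "\<phi> x"] by linarith
      ultimately show ?thesis using \<epsilon> by linarith
    next
      case 3
      then have "pi - \<delta> \<le> \<bar>x\<bar>" "pi - \<delta> \<le> \<bar>t\<bar>" using x t \<eta> by linarith+
      then show ?thesis using \<delta>(2) nn \<epsilon> by simp
    qed
  qed
  obtain N1 where N1: "2 * K / \<epsilon> \<le> real N1" using real_arch_simple by blast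
  show ?thesis
  proof (intro exI [of _ "max N1 1"] allI impI)
    fix N x assume N: "max N1 1 \<le> N" and x: "-pi \<le> x" "x \<le> pi"
    define F where "F t = fejer_kernel N (x - t)" for t
    have F0: "0 \<le> F t" for t by (simp add: F_def fejer_kernel_nonneg)
    have contF: "continuous_on UNIV F"
      unfolding F_def by (intro cont_fejer_kernel continuous_intros)
    have mF: "mean F = 1" unfolding F_def by (rule mean_fejer_kernel) (use N in simp)
    note [continuous_intros] = \<phi> contF
    have "sigma N \<phi> x - \<phi> x = mean (\<lambda>t. \<phi> t * of_real (F t)) - \<phi> x * mean (\<lambda>t. of_real (F t))"
      using N by (simp add: sigma_kernel [OF cont_integrable [OF \<phi>]] mean_of_real contF mF flip: F_def)
    also have "\<dots> = mean (\<lambda>t. (\<phi> t - \<phi> x) * of_real (F t))"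
      unfolding left_diff_distrib mean_cmult [symmetric]
      by (rule mean_diff [symmetric]) (intro continuous_intros)+
    finally have "cmod (sigma N \<phi> x - \<phi> x) \<le> mean (\<lambda>t. cmod ((\<phi> t - \<phi> x) * of_real (F t)))"
      by (metis norm_mean_le)
    also have "\<dots> \<le> mean (\<lambda>t. \<epsilon> / 2 * F t + K * ((1 - cos (x - t)) * F t))"
    proof (rule mean_mono_on)
      fix t assume t: "-pi \<le> t" "t \<le> pi"
      have "cmod (\<phi> t - \<phi> x) * F t \<le> (\<epsilon> / 2 + K * (1 - cos (x - t))) * F t"
        using key [OF x t] F0 by (rule mult_right_mono)
      then show "cmod ((\<phi> t - \<phi> x) * of_real (F t)) \<le> \<epsilon> / 2 * F t + K * ((1 - cos (x - t)) * F t)"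
        unfolding norm_mult using F0 [of t] by (simp add: algebra_simps)
    qed (intro cont_integrable continuous_intros)+
    also have "\<dots> = \<epsilon> / 2 + K * (1 / N)"
    proof (subst mean_add)
      have "mean (\<lambda>t. \<epsilon> / 2 * F t) = \<epsilon> / 2" by (simp only: mean_rmult mF mult_1_right)
      moreover have "mean (\<lambda>t. K * ((1 - cos (x - t)) * F t)) = K * (1 / N)"
        unfolding F_def mean_rmult using mean_fejer_kernel_cos [of N x] N by simp
      ultimately show "mean (\<lambda>t. \<epsilon> / 2 * F t) + mean (\<lambda>t. K * ((1 - cos (x - t)) * F t))
        = \<epsilon> / 2 + K * (1 / N)" by simp
    qed (intro continuous_intros)+
    also have "\<dots> \<le> \<epsilon>"
    proof -
      have "2 * K / \<epsilon> \<le> real N" using N N1 by simp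
      then have "K * (1 / N) \<le> \<epsilon> / 2" using N \<epsilon> by (simp add: field_simps)
      from add_left_mono [OF this, of "\<epsilon> / 2"] show ?thesis by (simp only: field_sum_of_halves)
    qed
    finally show "cmod (sigma N \<phi> x - \<phi> x) \<le> \<epsilon>" .
  qed
qed

lemma fc_diff_integrable:
  assumes "integrable circle f" "integrable circle g"
  shows "fc (\<lambda>x. f x - g x) k = fc f k - fc g k"
  using integrable_ex_mult [OF assms(1), of "-k"] integrable_ex_mult [OF assms(2), of "-k"]
  by (simp add: fourier_coeff_eq_mean left_diff_distrib mean_def scaleR_diff_right)

lemma sigma_diff:
  assumes "integrable circle f" "integrable circle g"
  shows "sigma N (\<lambda>x. f x - g x) x = sigma N f x - sigma N g x"
  by (simp add: sigma_def fc_diff_integrable [OF assms] algebra_simps sum_subtractf)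

lemma sigma_bounded:
  assumes "g \<in> borel_measurable circle" "AE t in circle. cmod (g t) \<le> 1" "N \<ge> 1"
  shows "cmod (sigma N g x) \<le> 1"
proof -
  interpret finite_measure "circle" by (rule finite_measure_lebesgue_on) simp
  have g: "integrable circle g"
    by (rule integrable_const_bound [OF assms(2,1)])
  define F where "F t = fejer_kernel N (x - t)" for t
  have contF: "continuous_on UNIV F" unfolding F_def by (intro cont_fejer_kernel continuous_intros)
  have F: "integrable circle F" by (rule cont_integrable [OF contF])
  have "cmod (sigma N g x) \<le> mean (\<lambda>t. cmod (g t * of_real (F t)))"
    unfolding sigma_kernel [OF g assms(3)] F_def by (rule norm_mean_le)
  also have "\<dots> \<le> mean F"
  proof -
    have "(\<integral>t. cmod (g t * of_real (F t)) \<partial>circle) \<le> (\<integral>t. F t \<partial>circle)"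
    proof (rule integral_mono_AE' [OF F])
      show "AE t in circle. cmod (g t * of_real (F t)) \<le> F t"
        using assms(2) by eventually_elim
          (use fejer_kernel_nonneg in \<open>auto simp: norm_mult F_def mult_left_le_one_le\<close>)
    qed (simp add: F_def fejer_kernel_nonneg)
    then show ?thesis by (simp add: mean_def divide_right_mono)
  qed
  also have "\<dots> = 1" unfolding F_def by (rule mean_fejer_kernel [OF assms(3)])
  finally show ?thesis .
qed

text \<open>Duality: \<open>sigma N\<close> is symmetric, and it is tested against the sign of \<open>sigma N h\<close>.\<close>

lemma sigma_contraction:
  assumes h: "integrable circle h" and N: "N \<ge> 1"
  shows "(\<integral>x. cmod (sigma N h x) \<partial>circle) \<le> (\<integral>x. cmod (h x) \<partial>circle)"
proof -
  let ?M = "circle"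
  interpret finite_measure ?M by (rule finite_measure_lebesgue_on) simp
  define s where "s x = sgn (sigma N h x)" for x
  have sigma_meas: "sigma N h \<in> borel_measurable ?M"
    by (rule borel_measurable_integrable [OF cont_integrable [OF tp_cont [OF sigma_tp]]])
  have s_meas: "s \<in> borel_measurable ?M"
  proof -
    have "(\<lambda>x. cmod (sigma N h x)) \<in> borel_measurable ?M"
      by (rule measurable_compose [OF sigma_meas borel_measurable_norm])
    with sigma_meas show ?thesis
      unfolding s_def sgn_div_norm by (intro borel_measurable_scaleR borel_measurable_inverse)
  qed
  have s1: "cmod (s x) \<le> 1" for x by (simp add: s_def norm_sgn)
  have s: "integrable ?M s" by (rule integrable_const_bound [OF AE_I2 s_meas]) (rule s1)
  have s_cnj: "integrable ?M (\<lambda>x. cnj (s x))" using s by simp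
  have "complex_of_real (mean (\<lambda>x. cmod (sigma N h x))) = mean (\<lambda>x. sigma N h x * cnj (s x))"
  proof -
    have "sigma N h x * cnj (s x) = of_real (cmod (sigma N h x))" for x
      by (cases "sigma N h x = 0")
         (simp_all add: s_def sgn_div_norm scaleR_conv_of_real complex_norm_square [symmetric] power2_eq_square field_simps)
    then show ?thesis by (simp add: mean_of_real tp_cont [OF sigma_tp] continuous_intros)
  qed
  also have "\<dots> = (\<Sum>k\<in>{- int N<..<int N}. (of_real (fej N k) * fc h k) * mean (\<lambda>x. cnj (s x) * ex k x))"
    unfolding sigma_def sum_distrib_right
    by (subst mean_lincomb [OF integrable_ex_mult [OF s_cnj], symmetric]) (simp add: mult_ac)
  also have "\<dots> = (\<Sum>k\<in>{- int N<..<int N}. (of_real (fej N k) * cnj (fc s k)) * mean (\<lambda>x. h x * ex (- k) x))"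
    by (intro sum.cong refl) (simp add: fourier_coeff_eq_mean ex_minus flip: mean_cnj)
  also have "\<dots> = mean (\<lambda>x. h x * cnj (sigma N s x))"
    unfolding sigma_def cnj_sum sum_distrib_left
    by (subst mean_lincomb [OF integrable_ex_mult [OF h], symmetric]) (simp add: mult_ac ex_minus)
  finally have "mean (\<lambda>x. cmod (sigma N h x)) = cmod (mean (\<lambda>x. h x * cnj (sigma N s x)))"
    by (metis abs_of_nonneg mean_nonneg norm_ge_zero norm_of_real)
  also have "\<dots> \<le> mean (\<lambda>x. cmod (h x * cnj (sigma N s x)))" by (rule norm_mean_le)
  also have "\<dots> \<le> mean (\<lambda>x. cmod (h x))"
  proof -
    have "cmod (h x * cnj (sigma N s x)) \<le> cmod (h x)" for x
      using sigma_bounded [OF s_meas AE_I2 N, of x] s1 by (simp add: norm_mult mult_left_le)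
    then have "(\<integral>x. cmod (h x * cnj (sigma N s x)) \<partial>?M) \<le> (\<integral>x. cmod (h x) \<partial>?M)"
      by (intro integral_mono_AE') (auto intro: h integrable_norm)
    then show ?thesis by (simp add: mean_def divide_right_mono)
  qed
  finally show ?thesis by (simp add: mean_def divide_le_cancel)
qed

text \<open>A density argument: by the contraction property the error of \<open>f - \<phi>\<close>
  enters twice with weight \<open>\<epsilon> / 4\<close>, and the uniform error
  \<open>\<epsilon>'\<close> integrates to another \<open>\<epsilon> / 4\<close> over a period of
  length \<open>2 * pi\<close>.\<close>

lemma fejer_L1:
  assumes f: "integrable circle f"
  shows "(\<lambda>N. \<integral>x. cmod (sigma N f x - f x) \<partial>circle) \<longlonglongrightarrow> 0"
proof (rule LIMSEQ_I)
  let ?M = "circle"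
  interpret finite_measure ?M by (rule finite_measure_lebesgue_on) simp
  fix \<epsilon> :: real assume \<epsilon>: "0 < \<epsilon>"
  obtain \<phi> \<delta> where \<phi>: "continuous_on UNIV \<phi>" and \<delta>: "0 < \<delta>" "\<And>x. pi - \<delta> \<le> \<bar>x\<bar> \<Longrightarrow> \<phi> x = 0"
    and close: "(\<integral>x. cmod (f x - \<phi> x) \<partial>?M) < \<epsilon> / 4"
    using approx_by_continuous [OF f, of "\<epsilon> / 4"] \<epsilon> by auto
  define \<epsilon>' where "\<epsilon>' = \<epsilon> / 4 / (2 * pi)"
  obtain N0 where N0: "\<And>N x. N \<ge> N0 \<Longrightarrow> -pi \<le> x \<Longrightarrow> x \<le> pi \<Longrightarrow> cmod (sigma N \<phi> x - \<phi> x) \<le> \<epsilon>'"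
    using fejer_uniform [OF \<phi> \<delta>, of \<epsilon>'] \<epsilon> by (auto simp: \<epsilon>'_def)
  have \<phi>i: "integrable ?M \<phi>" by (rule cont_integrable [OF \<phi>])
  have si: "integrable ?M (sigma N u)" for N u by (rule cont_integrable [OF tp_cont [OF sigma_tp]])
  show "\<exists>N0. \<forall>N\<ge>N0. norm ((\<integral>x. cmod (sigma N f x - f x) \<partial>?M) - 0) < \<epsilon>"
  proof (intro exI [of _ "max N0 1"] allI impI)
    fix N assume N: "max N0 1 \<le> N"
    define u where "u x = f x - \<phi> x" for x
    have u: "integrable ?M u" unfolding u_def using f \<phi>i by simp
    have "(\<integral>x. cmod (sigma N f x - f x) \<partial>?M)
      \<le> (\<integral>x. cmod (sigma N u x) + cmod (sigma N \<phi> x - \<phi> x) + cmod (u x) \<partial>?M)"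
    proof (rule integral_mono)
      fix x
      have "sigma N f x - f x = (sigma N u x + (sigma N \<phi> x - \<phi> x)) - u x"
        unfolding u_def [abs_def] by (simp add: sigma_diff [OF f \<phi>i])
      then show "cmod (sigma N f x - f x) \<le> cmod (sigma N u x) + cmod (sigma N \<phi> x - \<phi> x) + cmod (u x)"
        by (metis add_right_mono norm_triangle_ineq norm_triangle_ineq4 order_trans)
    qed (use f u si \<phi>i in auto)
    also have "\<dots> = (\<integral>x. cmod (sigma N u x) \<partial>?M) + (\<integral>x. cmod (sigma N \<phi> x - \<phi> x) \<partial>?M) + (\<integral>x. cmod (u x) \<partial>?M)"
      using u si \<phi>i by simp
    also have "(\<integral>x. cmod (sigma N u x) \<partial>?M) \<le> (\<integral>x. cmod (u x) \<partial>?M)"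
      by (rule sigma_contraction [OF u]) (use N in simp)
    also have "(\<integral>x. cmod (sigma N \<phi> x - \<phi> x) \<partial>?M) \<le> (\<integral>x. \<epsilon>' \<partial>?M)"
      by (rule integral_mono) (use N N0 si \<phi>i in auto)
    also have "(\<integral>x. \<epsilon>' \<partial>?M) = \<epsilon> / 4" by (simp add: measure_restrict_space \<epsilon>'_def)
    finally have "(\<integral>x. cmod (sigma N f x - f x) \<partial>?M) < \<epsilon>"
      using close \<epsilon> by (simp add: u_def)
    then show "norm ((\<integral>x. cmod (sigma N f x - f x) \<partial>?M) - 0) < \<epsilon>"
      by (simp add: abs_of_nonneg)
  qed
qed

text \<open>Almost everywhere convergence along a subsequence follows from \<open>L\<^sub>1\<close>
  convergence and is enough for Fatou's lemma, so no pointwise summability theorem enters.\<close>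

lemma fejer_AE_subseq:
  assumes f: "integrable circle f"
  shows "\<exists>\<rho> :: nat \<Rightarrow> nat. strict_mono \<rho> \<and> (AE x in circle. (\<lambda>i. sigma (\<rho> i) f x) \<longlonglongrightarrow> f x)"
proof -
  have "integrable circle (\<lambda>x. sigma N f x - f x)" for N
    using f cont_integrable [OF tp_cont [OF sigma_tp]] by (rule Bochner_Integration.integrable_diff [rotated])
  from tendsto_L1_AE_subseq [OF this fejer_L1 [OF f]]
  obtain \<rho> where "strict_mono \<rho>" "AE x in circle. (\<lambda>i. sigma (\<rho> i) f x - f x) \<longlonglongrightarrow> 0"
    by blast
  then show ?thesis by (auto simp: LIM_zero_iff)
qed

section \<open>Passage between the periods [-pi, pi] and [0, 2 * pi), and integrability of members
  of \<open>Lp\<close>\<close>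

lemma nn_integral_period:
  fixes \<phi> :: "real \<Rightarrow> ennreal"
  assumes [measurable]: "\<phi> \<in> borel_measurable lebesgue" and per: "\<And>t. \<phi> (t + 2 * pi) = \<phi> t"
  shows "(\<integral>\<^sup>+x. \<phi> x * indicator {0..<2 * pi} x \<partial>lebesgue) = (\<integral>\<^sup>+x. \<phi> x \<partial>circle)"
proof -
  have [measurable]: "(\<lambda>x::real. x) \<in> borel_measurable lebesgue"
    using id_borel_measurable_lebesgue by (simp add: id_def)
  have "(\<integral>\<^sup>+x. \<phi> x \<partial>circle) = (\<integral>\<^sup>+x. \<phi> x * indicator {-pi..pi} x \<partial>lebesgue)"
    by (simp add: nn_integral_restrict_space)
  also have "\<dots> = (\<integral>\<^sup>+x. \<phi> x * indicator {-pi..<0} x + \<phi> x * indicator {0..<pi} x \<partial>lebesgue)"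
  proof (rule nn_integral_cong_AE)
    have "{pi} \<in> null_sets lebesgue" by (simp flip: negligible_iff_null_sets)
    then have "AE x in lebesgue. x \<notin> {pi}" by (rule AE_not_in)
    then show "AE x in lebesgue. \<phi> x * indicator {-pi..pi} x = \<phi> x * indicator {-pi..<0} x + \<phi> x * indicator {0..<pi} x"
      by eventually_elim (auto simp: indicator_def)
  qed
  also have "\<dots> = (\<integral>\<^sup>+x. \<phi> x * indicator {-pi..<0} x \<partial>lebesgue) + (\<integral>\<^sup>+x. \<phi> x * indicator {0..<pi} x \<partial>lebesgue)"
    by (rule nn_integral_add) measurable
  also have "(\<integral>\<^sup>+x. \<phi> x * indicator {-pi..<0} x \<partial>lebesgue)
      = (\<integral>\<^sup>+x. \<phi> (- (2 * pi) + 1 * x) * indicator {-pi..<0} (- (2 * pi) + 1 * x) \<partial>lebesgue)"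
    by (subst nn_integral_real_affine_lebesgue [where c = 1 and t = "- (2 * pi)"]) auto
  also have "\<dots> = (\<integral>\<^sup>+x. \<phi> x * indicator {pi..<2 * pi} x \<partial>lebesgue)"
    using per [of "_ - 2 * pi"] by (intro nn_integral_cong) (auto simp: indicator_def)
  also have "\<dots> + (\<integral>\<^sup>+x. \<phi> x * indicator {0..<pi} x \<partial>lebesgue)
     = (\<integral>\<^sup>+x. \<phi> x * indicator {pi..<2 * pi} x + \<phi> x * indicator {0..<pi} x \<partial>lebesgue)"
    by (rule nn_integral_add [symmetric]) measurable
  also have "\<dots> = (\<integral>\<^sup>+x. \<phi> x * indicator {0..<2 * pi} x \<partial>lebesgue)"
    by (intro nn_integral_cong) (auto simp: indicator_def)
  finally show ?thesis by simp
qed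

lemma Lp_measurable:
  assumes "f \<in> Lp p"
  shows "f \<in> borel_measurable lebesgue" "f \<in> borel_measurable circle"
  using assms by (auto simp: Lp_def intro: measurable_restrict_space1)

lemma set_integrable_powr_iff:
  assumes "u \<in> borel_measurable lebesgue"
  shows "set_integrable lebesgue {0..<2 * pi} (\<lambda>t. cmod (u t) powr p) \<longleftrightarrow>
    (\<integral>\<^sup>+x. ennreal (cmod (u x) powr p) * indicator {0..<2 * pi} x \<partial>lebesgue) < \<infinity>"
proof -
  have [measurable]: "(\<lambda>x::real. x) \<in> borel_measurable lebesgue"
    using id_borel_measurable_lebesgue by (simp add: id_def)
  have [measurable]: "u \<in> borel_measurable lebesgue" by fact
  have "(\<integral>\<^sup>+x. ennreal (norm (indicat_real {0..<2 * pi} x *\<^sub>R cmod (u x) powr p)) \<partial>lebesgue)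
    = (\<integral>\<^sup>+x. ennreal (cmod (u x) powr p) * indicator {0..<2 * pi} x \<partial>lebesgue)"
    by (intro nn_integral_cong) (auto simp: indicator_def)
  moreover have "(\<lambda>x. indicat_real {0..<2 * pi} x *\<^sub>R cmod (u x) powr p) \<in> borel_measurable lebesgue"
    by measurable
  ultimately show ?thesis
    unfolding set_integrable_def integrable_iff_bounded by simp
qed

lemma Lp_1_integrable:
  assumes "f \<in> Lp 1"
  shows "integrable circle f"
proof -
  have [measurable]: "f \<in> borel_measurable lebesgue" and per: "\<And>t. f (t + 2 * pi) = f t"
    and "set_integrable lebesgue {0..<2 * pi} (\<lambda>t. cmod (f t) powr 1)"
    using assms by (auto simp: Lp_def)
  then have "(\<integral>\<^sup>+x. ennreal (cmod (f x) powr 1) * indicator {0..<2 * pi} x \<partial>lebesgue) < \<infinity>"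
    by (simp only: set_integrable_powr_iff)
  also have "(\<integral>\<^sup>+x. ennreal (cmod (f x) powr 1) * indicator {0..<2 * pi} x \<partial>lebesgue)
    = (\<integral>\<^sup>+x. ennreal (cmod (f x)) \<partial>circle)"
    by (subst nn_integral_period) (auto simp: per)
  finally show ?thesis
    unfolding integrable_iff_bounded using Lp_measurable(2) [OF assms] by simp
qed


subsection \<open>The upper bound\<close>

lemma fc_cnj: "fc (\<lambda>x. cnj (g x)) k = cnj (fc g (- k))"
  by (simp add: fourier_coeff_eq_mean ex_minus flip: mean_cnj)

text \<open>Negative frequencies are reduced to positive ones by conjugating \<open>g\<close>; since
  \<open>\<nu>\<close> is real, conjugation does not change it. The two multipliers are kept apart
  because the cut-offs on the two sides may differ, and \<open>c1\<close>, \<open>c2\<close> are to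
  carry the phases coming from \<open>\<beta>\<close>.\<close>

lemma two_sided_multiplier:
  "\<exists>C\<ge>0. \<forall>g (\<mu> :: nat \<Rightarrow> real) (\<nu> :: nat \<Rightarrow> real) (\<Lambda> :: real) d c1 c2.
      g \<in> tp {- int d<..<int d} \<and> (\<forall>t. cmod (g t) \<le> 1) \<and> cmod c1 \<le> 1 \<and> cmod c2 \<le> 1 \<and>
      marcinkiewicz \<mu> \<Lambda> \<and> marcinkiewicz \<nu> \<Lambda> \<longrightarrow>
      mean (\<lambda>x. (abs2 (c1 * (\<Sum>k\<in>{1..<d}. \<mu> k * (fc g (int k) * ex (int k) x))
        + c2 * (\<Sum>k\<in>{1..<d}. \<nu> k * (fc g (- int k) * ex (- int k) x)))) ^ Suc r)
      \<le> C * (\<Lambda>\<^sup>2) ^ Suc r"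
proof -
  obtain C where C0: "0 \<le> C" and C: "\<And>g (\<mu> :: nat \<Rightarrow> real) (\<Lambda> :: real) d.
      g \<in> tp {- int d<..<int d} \<and> (\<forall>t. cmod (g t) \<le> 1) \<and> marcinkiewicz \<mu> \<Lambda> \<Longrightarrow>
      mean (\<lambda>x. (abs2 (\<Sum>k\<in>{1..<d}. \<mu> k * (fc g (int k) * ex (int k) x))) ^ Suc r)
      \<le> C * (\<Lambda>\<^sup>2) ^ Suc r"
    using marcinkiewicz_polynomial [of r] by blast
  show ?thesis
  proof (intro exI [of _ "4 ^ Suc r * (C + C)"] conjI allI impI)
    show "0 \<le> 4 ^ Suc r * (C + C)" using C0 by simp
    fix g and \<mu> \<nu> :: "nat \<Rightarrow> real" and \<Lambda> :: real and d and c1 c2 :: complex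
    assume asm: "g \<in> tp {- int d<..<int d} \<and> (\<forall>t. cmod (g t) \<le> 1) \<and> cmod c1 \<le> 1 \<and> cmod c2 \<le> 1 \<and>
      marcinkiewicz \<mu> \<Lambda> \<and> marcinkiewicz \<nu> \<Lambda>"
    define g' where "g' x = cnj (g x)" for x
    have g': "g' \<in> tp {- int d<..<int d}"
      unfolding g'_def by (rule tp_cnj [of g "{- int d<..<int d}"]) (use asm in auto)
    define P where "P x = (\<Sum>k\<in>{1..<d}. \<mu> k * (fc g (int k) * ex (int k) x))" for x
    define P' where "P' x = (\<Sum>k\<in>{1..<d}. \<nu> k * (fc g' (int k) * ex (int k) x))" for x
    have cont [continuous_intros]: "continuous_on UNIV P" "continuous_on UNIV P'"
      unfolding P_def P'_def by (intro continuous_intros)+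
    have eq: "(\<Sum>k\<in>{1..<d}. \<nu> k * (fc g (- int k) * ex (- int k) x)) = cnj (P' x)" for x
      unfolding P'_def g'_def by (simp add: fc_cnj ex_minus)
    have "mean (\<lambda>x. abs2 (c1 * P x + c2 * cnj (P' x)) ^ Suc r)
      \<le> mean (\<lambda>x. 4 ^ Suc r * (abs2 (P x) ^ Suc r + abs2 (P' x) ^ Suc r))"
    proof (intro mean_mono continuous_intros)
      fix x
      have "abs2 (c1 * P x + c2 * cnj (P' x)) \<le> 2 * abs2 (c1 * P x) + 2 * abs2 (- (c2 * cnj (P' x)))"
        using norm_diff_squared_le [of "c1 * P x" "- (c2 * cnj (P' x))"] by simp
      also have "\<dots> \<le> 2 * abs2 (P x) + 2 * abs2 (P' x)"
        using asm by (intro add_mono mult_left_mono power_mono) (auto simp: norm_mult mult_left_le_one_le)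
      finally have "abs2 (c1 * P x + c2 * cnj (P' x)) ^ Suc r \<le> (2 * abs2 (P x) + 2 * abs2 (P' x)) ^ Suc r"
        by (intro power_mono) auto
      also have "\<dots> \<le> 2 ^ Suc r * ((2 * abs2 (P x)) ^ Suc r + (2 * abs2 (P' x)) ^ Suc r)"
        by (rule power_add_le) auto
      also have "\<dots> = 4 ^ Suc r * (abs2 (P x) ^ Suc r + abs2 (P' x) ^ Suc r)"
      proof -
        have "(4::real) ^ Suc r = 2 ^ Suc r * 2 ^ Suc r" by (simp flip: power_mult_distrib)
        then show ?thesis by (simp only: power_mult_distrib distrib_left mult.assoc)
      qed
      finally show "abs2 (c1 * P x + c2 * cnj (P' x)) ^ Suc r
        \<le> 4 ^ Suc r * (abs2 (P x) ^ Suc r + abs2 (P' x) ^ Suc r)" .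
    qed
    also have "\<dots> = 4 ^ Suc r * (mean (\<lambda>x. abs2 (P x) ^ Suc r) + mean (\<lambda>x. abs2 (P' x) ^ Suc r))"
      unfolding mean_rmult by (subst mean_add) (auto intro!: continuous_intros)
    also have "\<dots> \<le> 4 ^ Suc r * (C * (\<Lambda>\<^sup>2) ^ Suc r + C * (\<Lambda>\<^sup>2) ^ Suc r)"
    proof (intro mult_left_mono add_mono)
      show "mean (\<lambda>x. abs2 (P x) ^ Suc r) \<le> C * (\<Lambda>\<^sup>2) ^ Suc r"
        unfolding P_def by (rule C) (use asm in blast)
      show "mean (\<lambda>x. abs2 (P' x) ^ Suc r) \<le> C * (\<Lambda>\<^sup>2) ^ Suc r"
        unfolding P'_def by (rule C) (use asm g' in \<open>auto simp: g'_def\<close>)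
    qed simp
    finally show "mean (\<lambda>x. (abs2 (c1 * (\<Sum>k\<in>{1..<d}. \<mu> k * (fc g (int k) * ex (int k) x))
        + c2 * (\<Sum>k\<in>{1..<d}. \<nu> k * (fc g (- int k) * ex (- int k) x)))) ^ Suc r)
      \<le> 4 ^ Suc r * (C + C) * (\<Lambda>\<^sup>2) ^ Suc r"
      unfolding eq by (simp add: P_def algebra_simps)
  qed
qed

section \<open>From the conditions on \<open>\<psi>\<close> to the remainder of a class
  member\<close>

lemma class_P_bounds:
  assumes "\<psi> \<in> class_P"
  shows "\<exists>K>0. (\<forall>k1 k2. 1 \<le> k1 \<longrightarrow> k1 \<le> k2 \<longrightarrow> \<psi> k2 \<le> K * \<psi> k1) \<and>
     (\<forall>p\<ge>1. marcinkiewicz (cut_below \<psi> p) (K * \<psi> p))"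
proof -
  have pos: "\<And>k. 1 \<le> k \<Longrightarrow> 0 < \<psi> k" using assms by (auto simp: class_P_def)
  obtain M where M: "0 < M" "\<And>k1 k2. 1 \<le> k1 \<Longrightarrow> k1 \<le> k2 \<Longrightarrow> \<psi> k2 \<le> M * \<psi> k1"
    using assms by (auto simp: class_P_def almost_decreasing_def)
  obtain K where K: "\<And>n. n \<ge> 1 \<Longrightarrow> (SUP m \<in> {1..}. ereal (\<Sum>k = 2 ^ m..2 ^ (m + 1).
           \<bar>cut_below \<psi> n (k + 1) - cut_below \<psi> n k\<bar>)) \<le> ereal (K * \<psi> n)"
    using assms by (auto simp: class_P_def)
  define L where "L = max K M"
  have L: "0 < L" "K \<le> L" "M \<le> L" using M by (auto simp: L_def)
  have le: "c * \<psi> p \<le> L * \<psi> p" if "c \<le> L" "1 \<le> p" for c p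
    using that pos [of p] by (intro mult_right_mono) auto
  show ?thesis
  proof (intro exI [of _ L] conjI allI impI L)
    show "\<psi> k2 \<le> L * \<psi> k1" if "1 \<le> k1" "k1 \<le> k2" for k1 k2
      using M(2) [OF that] le [OF L(3) that(1)] by linarith
    fix p :: nat assume p: "1 \<le> p"
    have bound: "\<bar>cut_below \<psi> p k\<bar> \<le> L * \<psi> p" if "1 \<le> k" for k
    proof (cases "k < p")
      case True
      then show ?thesis using L pos [OF p] by (simp add: cut_below_def)
    next
      case False
      then have "\<psi> k \<le> L * \<psi> p"
        by (intro order_trans [OF M(2) [OF p] le [OF L(3) p]]) simp
      then show ?thesis using False pos [OF that] by (simp add: cut_below_def)
    qed
    have "(\<Sum>k\<in>{2 ^ j..<2 ^ Suc j - 1}. \<bar>cut_below \<psi> p (Suc k) - cut_below \<psi> p k\<bar>) \<le> L * \<psi> p" for j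
    proof (cases "j = 0")
      case True
      \<comment> \<open>The supremum in \<open>class_P\<close> starts at \<open>m = 1\<close>; for
        \<open>j = 0\<close> the range of summation \<open>{1..<1}\<close> is empty.\<close>
      then show ?thesis using L pos [OF p] by simp
    next
      case False
      have "(\<Sum>k\<in>{2 ^ j..<2 ^ Suc j - 1}. \<bar>cut_below \<psi> p (Suc k) - cut_below \<psi> p k\<bar>)
        \<le> (\<Sum>k = 2 ^ j..2 ^ (j + 1). \<bar>cut_below \<psi> p (k + 1) - cut_below \<psi> p k\<bar>)"
        unfolding Suc_eq_plus1 by (intro sum_mono2) auto
      also have "\<dots> \<le> K * \<psi> p"
      proof -
        have "ereal (\<Sum>k = 2 ^ j..2 ^ (j + 1). \<bar>cut_below \<psi> p (k + 1) - cut_below \<psi> p k\<bar>) \<le> ereal (K * \<psi> p)"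
          using False by (intro order_trans [OF _ K [OF p]] SUP_upper) auto
        then show ?thesis by simp
      qed
      also have "\<dots> \<le> L * \<psi> p" by (rule le [OF L(2) p])
      finally show ?thesis .
    qed
    with bound show "marcinkiewicz (cut_below \<psi> p) (L * \<psi> p)"
      unfolding marcinkiewicz_def using L pos [OF p] by simp
  qed
qed

lemma psi_derivative_coeff:
  assumes "is_psi_derivative \<psi> \<beta> f g" "\<And>k. 1 \<le> k \<Longrightarrow> 0 < \<psi> k" "k \<noteq> 0"
  shows "fc f k = \<psi> (nat \<bar>k\<bar>) * exp (- \<i> * of_real (\<beta> * pi / 2 * of_int (sgn k))) * fc g k"
proof -
  have "1 \<le> nat \<bar>k\<bar>" using assms(3) by linarith
  then have "\<psi> (nat \<bar>k\<bar>) \<noteq> 0" using assms(2) less_irrefl by metis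
  moreover have "fc g k = fc f k / of_real (\<psi> (nat \<bar>k\<bar>)) *
      exp (\<i> * of_real (\<beta> * pi / 2 * of_int (sgn k)))"
    using assms(1,3) by (simp add: is_psi_derivative_def)
  ultimately show ?thesis
    by (simp add: exp_minus mult.assoc)
qed

lemma sum_ivl_minus_ivl:
  fixes F :: "int \<Rightarrow> complex"
  assumes "1 \<le> n" "1 \<le> p" "n \<le> N" "p \<le> N"
  shows "(\<Sum>k\<in>{- int N<..<int N} - {- int n<..<int p}. F k)
    = (\<Sum>k\<in>{p..<N}. F (int k)) + (\<Sum>k\<in>{n..<N}. F (- int k))"
proof -
  have "{- int N<..<int N} - {- int n<..<int p} = int ` {p..<N} \<union> (\<lambda>k. - int k) ` {n..<N}"
  proof (intro set_eqI iffI)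
    fix k assume k: "k \<in> {- int N<..<int N} - {- int n<..<int p}"
    show "k \<in> int ` {p..<N} \<union> (\<lambda>k. - int k) ` {n..<N}"
    proof (cases "0 \<le> k")
      case True
      then have "k = int (nat k)" "nat k \<in> {p..<N}" using k assms by auto
      then show ?thesis by blast
    next
      case False
      then have "k = - int (nat (- k))" "nat (- k) \<in> {n..<N}" using k assms by auto
      then show ?thesis by blast
    qed
  qed (use assms in auto)
  moreover have "int ` {p..<N} \<inter> (\<lambda>k. - int k) ` {n..<N} = {}" using assms by auto
  ultimately show ?thesis
    by (simp add: sum.union_disjoint sum.reindex inj_on_def)
qed

lemma sum_cut_below:
  fixes F :: "nat \<Rightarrow> complex"
  assumes "1 \<le> p"
  shows "(\<Sum>k\<in>{1..<N}. cut_below \<psi> p k * F k) = (\<Sum>k\<in>{p..<N}. \<psi> k * F k)"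
proof -
  have "(\<Sum>k\<in>{1..<N}. cut_below \<psi> p k * F k) = (\<Sum>k\<in>{p..<N}. cut_below \<psi> p k * F k)"
    using assms by (intro sum.mono_neutral_right) (auto simp: cut_below_def)
  also have "\<dots> = (\<Sum>k\<in>{p..<N}. \<psi> k * F k)" by (intro sum.cong) (auto simp: cut_below_def)
  finally show ?thesis .
qed

text \<open>\<open>f\<close> is only known to be summable, so the estimate is made for polynomials
  and transferred by Fatou's lemma, which yields finiteness at the same time. The Fejer factor is
  attached to \<open>g\<close> and not to the multiplier: \<open>sigma N g\<close> is still bounded
  by 1, and the multiplier stays the cut sequence, with constants independent of
  \<open>N\<close>.\<close>

lemma class_L_remainder:
  assumes \<psi>: "\<psi> \<in> class_P"
  shows "\<exists>B\<ge>0. \<forall>f\<in>class_L \<psi> \<beta>. \<forall>n\<ge>1. \<forall>p\<ge>1.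
    (\<integral>\<^sup>+x. ennreal (abs2 (f x - (\<Sum>k\<in>{- int n<..<int p}. fc f k * ex k x)) ^ Suc r) \<partial>circle)
    \<le> ennreal (B * ((\<psi> n + \<psi> p)\<^sup>2) ^ Suc r)"
proof -
  let ?M = "circle"
  have pos: "\<And>k. 1 \<le> k \<Longrightarrow> 0 < \<psi> k" using \<psi> by (auto simp: class_P_def)
  obtain K where K: "0 < K" and Km: "\<And>p. 1 \<le> p \<Longrightarrow> marcinkiewicz (cut_below \<psi> p) (K * \<psi> p)"
    using class_P_bounds [OF \<psi>] by blast
  obtain C where C0: "0 \<le> C" and C: "\<And>g (\<mu> :: nat \<Rightarrow> real) (\<nu> :: nat \<Rightarrow> real) (\<Lambda> :: real) d c1 c2.
      g \<in> tp {- int d<..<int d} \<and> (\<forall>t. cmod (g t) \<le> 1) \<and> cmod c1 \<le> 1 \<and> cmod c2 \<le> 1 \<and>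
      marcinkiewicz \<mu> \<Lambda> \<and> marcinkiewicz \<nu> \<Lambda> \<Longrightarrow>
      mean (\<lambda>x. (abs2 (c1 * (\<Sum>k\<in>{1..<d}. \<mu> k * (fc g (int k) * ex (int k) x))
        + c2 * (\<Sum>k\<in>{1..<d}. \<nu> k * (fc g (- int k) * ex (- int k) x)))) ^ Suc r)
      \<le> C * (\<Lambda>\<^sup>2) ^ Suc r"
    using two_sided_multiplier [of r] by blast
  show ?thesis
  proof (intro exI [of _ "2 * pi * C * (K\<^sup>2) ^ Suc r"] conjI ballI allI impI)
    show "0 \<le> 2 * pi * C * (K\<^sup>2) ^ Suc r" using C0 by simp
    fix f and n p :: nat assume f: "f \<in> class_L \<psi> \<beta>" and n: "1 \<le> n" and p: "1 \<le> p"
    obtain g where g: "is_psi_derivative \<psi> \<beta> f g" "Linf_norm g \<le> 1"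
      using f by (auto simp: class_L_def)
    have f1: "integrable ?M f" using f by (intro Lp_1_integrable) (auto simp: class_L_def)
    have gLp: "g \<in> Lp 1" using g by (auto simp: is_psi_derivative_def)
    have g1: "integrable ?M g" by (rule Lp_1_integrable [OF gLp])
    have "AE t in lebesgue. ennreal (cmod (g t)) \<le> 1"
      using esssup_AE [of "\<lambda>t. ennreal (cmod (g t))" lebesgue]
    proof eventually_elim
      case (elim t)
      then show ?case using g(2) unfolding Linf_norm_def by (rule order_trans)
    qed
    then have "AE t in lebesgue. t \<in> {-pi..pi} \<longrightarrow> cmod (g t) \<le> 1"
      by eventually_elim (simp add: ennreal_le_1)
    then have g_AE: "AE t in ?M. cmod (g t) \<le> 1"
      by (subst AE_restrict_space_iff) auto
    define \<gamma> where "\<gamma> = {- int n<..<int p}"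
    define \<Lambda> where "\<Lambda> = K * (\<psi> n + \<psi> p)"
    have \<Lambda>: "K * \<psi> n \<le> \<Lambda>" "K * \<psi> p \<le> \<Lambda>"
      using K pos [OF n] pos [OF p] by (auto simp: \<Lambda>_def)
    \<comment> \<open>The subtracted terms carry the Fejer factors too, so that \<open>h N\<close>
      is exactly the part of \<open>sigma N f\<close> outside \<open>\<gamma>\<close>; for fixed
      \<open>k\<close> these factors tend to 1.\<close>
    define h where "h N x = sigma N f x - (\<Sum>k\<in>\<gamma>. of_real (fej N k) * fc f k * ex k x)" for N x
    define w where "w x = f x - (\<Sum>k\<in>\<gamma>. fc f k * ex k x)" for x
    have h_cont: "continuous_on UNIV (h N)" for N
      unfolding h_def by (intro continuous_intros tp_cont [OF sigma_tp])
    have h_mean: "mean (\<lambda>x. abs2 (h N x) ^ Suc r) \<le> C * (\<Lambda>\<^sup>2) ^ Suc r" if N: "n \<le> N" "p \<le> N" for N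
    proof -
      define gN where "gN = sigma N g"
      let ?c1 = "exp (- \<i> * of_real (\<beta> * pi / 2))" and ?c2 = "exp (\<i> * of_real (\<beta> * pi / 2))"
      let ?F = "\<lambda>x k. of_real (fej N k) * fc f k * ex k x"
      have eq: "h N x = ?c1 * (\<Sum>k\<in>{1..<N}. cut_below \<psi> p k * (fc gN (int k) * ex (int k) x))
        + ?c2 * (\<Sum>k\<in>{1..<N}. cut_below \<psi> n k * (fc gN (- int k) * ex (- int k) x))" for x
      proof -
        have "\<gamma> \<subseteq> {- int N<..<int N}" using N by (auto simp: \<gamma>_def)
        then have "h N x = (\<Sum>k\<in>{- int N<..<int N} - \<gamma>. ?F x k)"
          unfolding h_def sigma_def by (simp add: sum_diff)
        also have "\<dots> = (\<Sum>k\<in>{p..<N}. ?F x (int k)) + (\<Sum>k\<in>{n..<N}. ?F x (- int k))"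
          unfolding \<gamma>_def by (rule sum_ivl_minus_ivl [OF n p N])
        also have "(\<Sum>k\<in>{p..<N}. ?F x (int k)) = ?c1 * (\<Sum>k\<in>{p..<N}. \<psi> k * (fc gN (int k) * ex (int k) x))"
          unfolding sum_distrib_left using p
          by (intro sum.cong refl)
             (simp add: gN_def fc_sigma psi_derivative_coeff [OF g(1) pos])
        also have "(\<Sum>k\<in>{n..<N}. ?F x (- int k)) = ?c2 * (\<Sum>k\<in>{n..<N}. \<psi> k * (fc gN (- int k) * ex (- int k) x))"
          unfolding sum_distrib_left using n
          by (intro sum.cong refl)
             (simp add: gN_def fc_sigma psi_derivative_coeff [OF g(1) pos])
        finally show ?thesis by (simp only: sum_cut_below [OF n] sum_cut_below [OF p])
      qed
      show ?thesis
        unfolding eq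
      proof (rule C, intro conjI allI)
        show "gN \<in> tp {- int N<..<int N}" unfolding gN_def by (rule sigma_tp)
        show "cmod (gN t) \<le> 1" for t
          unfolding gN_def using n N by (intro sigma_bounded g_AE Lp_measurable(2) [OF gLp]) auto
        show "marcinkiewicz (cut_below \<psi> p) \<Lambda>" "marcinkiewicz (cut_below \<psi> n) \<Lambda>"
          by (rule marcinkiewicz_mono [OF Km [OF p] \<Lambda>(2)], rule marcinkiewicz_mono [OF Km [OF n] \<Lambda>(1)])
      qed simp_all
    qed
    obtain \<rho> :: "nat \<Rightarrow> nat" where \<rho>: "strict_mono \<rho>"
      and lim: "AE x in ?M. (\<lambda>i. sigma (\<rho> i) f x) \<longlonglongrightarrow> f x"
      using fejer_AE_subseq [OF f1] by blast
    \<comment> \<open>The shift guarantees that \<open>{- int n<..<int p}\<close> is contained in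
      the spectrum range of every mean used.\<close>
    define N where "N i = \<rho> (i + (n + p))" for i
    have N: "n \<le> N i" "p \<le> N i" "i \<le> N i" for i
      using seq_suble [OF \<rho>, of "i + (n + p)"] by (auto simp: N_def)
    have fej_lim: "(\<lambda>i. fej (N i) k) \<longlonglongrightarrow> 1" for k
    proof (rule tendsto_sandwich)
      show "\<forall>\<^sub>F i in sequentially. 1 - \<bar>of_int k\<bar> / real (N i) \<le> fej (N i) k"
        using fej_defect [OF order_trans [OF n N(1)], of _ k] by (intro always_eventually allI) (simp add: algebra_simps)
      show "\<forall>\<^sub>F i in sequentially. fej (N i) k \<le> 1" by (simp add: fej_le_1)
      have "filterlim (\<lambda>i. N i) at_top sequentially"
        by (rule filterlim_at_top_mono [OF filterlim_ident]) (simp add: N)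
      then have "filterlim (\<lambda>i. real (N i)) at_top sequentially"
        by (rule filterlim_compose [OF filterlim_real_sequentially])
      then have "(\<lambda>i. 1 - \<bar>real_of_int k\<bar> / real (N i)) \<longlonglongrightarrow> 1 - 0"
        by (intro tendsto_intros tendsto_divide_0 [OF tendsto_const] filterlim_at_top_imp_at_infinity)
      then show "(\<lambda>i. 1 - \<bar>real_of_int k\<bar> / real (N i)) \<longlonglongrightarrow> 1" by simp
    qed auto
    have "AE x in ?M. (\<lambda>i. ennreal (abs2 (h (N i) x) ^ Suc r)) \<longlonglongrightarrow> ennreal (abs2 (w x) ^ Suc r)"
      using lim
    proof eventually_elim
      case (elim x)
      then have "(\<lambda>i. sigma (N i) f x) \<longlonglongrightarrow> f x"
        unfolding N_def by (rule LIMSEQ_ignore_initial_segment)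
      then have "(\<lambda>i. h (N i) x) \<longlonglongrightarrow> f x - (\<Sum>k\<in>\<gamma>. of_real 1 * fc f k * ex k x)"
        unfolding h_def by (intro tendsto_intros fej_lim)
      then have "(\<lambda>i. h (N i) x) \<longlonglongrightarrow> w x" by (simp add: w_def)
      then show ?case by (intro tendsto_intros)
    qed
    then have "AE x in ?M. ennreal (abs2 (w x) ^ Suc r) = liminf (\<lambda>i. ennreal (abs2 (h (N i) x) ^ Suc r))"
      by eventually_elim (simp only: lim_imp_Liminf [OF sequentially_bot])
    then have "(\<integral>\<^sup>+x. ennreal (abs2 (w x) ^ Suc r) \<partial>?M)
       = (\<integral>\<^sup>+x. liminf (\<lambda>i. ennreal (abs2 (h (N i) x) ^ Suc r)) \<partial>?M)"
      by (rule nn_integral_cong_AE)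
    also have "\<dots> \<le> liminf (\<lambda>i. \<integral>\<^sup>+x. ennreal (abs2 (h (N i) x) ^ Suc r) \<partial>?M)"
    proof (rule nn_integral_liminf)
      fix i
      have "continuous_on UNIV (\<lambda>x. abs2 (h (N i) x) ^ Suc r)"
        by (intro continuous_intros h_cont)
      then have "(\<lambda>x. abs2 (h (N i) x) ^ Suc r) \<in> borel_measurable ?M"
        by (intro borel_measurable_integrable cont_integrable)
      then show "(\<lambda>x. ennreal (abs2 (h (N i) x) ^ Suc r)) \<in> borel_measurable ?M"
        by (rule measurable_compose [OF _ measurable_ennreal])
    qed
    also have "\<dots> \<le> limsup (\<lambda>i. \<integral>\<^sup>+x. ennreal (abs2 (h (N i) x) ^ Suc r) \<partial>?M)"
      by (rule Liminf_le_Limsup) simp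
    also have "\<dots> \<le> ennreal (2 * pi * (C * (\<Lambda>\<^sup>2) ^ Suc r))"
    proof (rule Limsup_bounded, intro always_eventually allI)
      fix i
      have cont: "continuous_on UNIV (\<lambda>x. abs2 (h (N i) x) ^ Suc r)"
        by (intro continuous_intros h_cont)
      have "(\<integral>\<^sup>+x. ennreal (abs2 (h (N i) x) ^ Suc r) \<partial>?M) = ennreal (\<integral>x. abs2 (h (N i) x) ^ Suc r \<partial>?M)"
        by (rule nn_integral_eq_integral [OF cont_integrable [OF cont]]) simp
      also have "(\<integral>x. abs2 (h (N i) x) ^ Suc r \<partial>?M) = 2 * pi * mean (\<lambda>x. abs2 (h (N i) x) ^ Suc r)"
        by (simp add: mean_def)
      also have "ennreal \<dots> \<le> ennreal (2 * pi * (C * (\<Lambda>\<^sup>2) ^ Suc r))"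
        using h_mean [OF N(1) [of i] N(2) [of i]] by (intro ennreal_leI mult_left_mono) auto
      finally show "(\<integral>\<^sup>+x. ennreal (abs2 (h (N i) x) ^ Suc r) \<partial>?M) \<le> ennreal (2 * pi * (C * (\<Lambda>\<^sup>2) ^ Suc r))" .
    qed
    also have "2 * pi * (C * (\<Lambda>\<^sup>2) ^ Suc r) = 2 * pi * C * (K\<^sup>2) ^ Suc r * ((\<psi> n + \<psi> p)\<^sup>2) ^ Suc r"
      unfolding \<Lambda>_def by (simp only: power_mult_distrib mult.assoc)
    finally show "(\<integral>\<^sup>+x. ennreal (abs2 (f x - (\<Sum>k\<in>{- int n<..<int p}. fc f k * ex k x)) ^ Suc r) \<partial>?M)
      \<le> ennreal (2 * pi * C * (K\<^sup>2) ^ Suc r * ((\<psi> n + \<psi> p)\<^sup>2) ^ Suc r)"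
      by (simp only: w_def \<gamma>_def)
  qed
qed

section \<open>From means of even powers to norms with a real exponent\<close>

lemma powr_le_1_plus_power:
  fixes y :: real
  assumes "0 \<le> y" "0 \<le> s" "s \<le> real m"
  shows "y powr s \<le> 1 + y ^ m"
proof (cases "y \<le> 1")
  case True
  then show ?thesis using assms powr_le1 [of s y] by (simp add: add_increasing2)
next
  case False
  then have "y powr s \<le> y powr real m" using assms by (intro powr_mono) auto
  also have "\<dots> = y ^ m" using False by (intro powr_realpow) auto
  finally show ?thesis by simp
qed

lemma set_integral_powr_period:
  assumes [measurable]: "u \<in> borel_measurable lebesgue" and per: "\<And>t. u (t + 2 * pi) = u t"
    and int: "set_integrable lebesgue {0..<2 * pi} (\<lambda>t. cmod (u t) powr s)"
  shows "ennreal (LINT t:{0..<2 * pi}|lebesgue. cmod (u t) powr s)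
    = (\<integral>\<^sup>+x. ennreal (cmod (u x) powr s) \<partial>circle)"
proof -
  have "ennreal (LINT t:{0..<2 * pi}|lebesgue. cmod (u t) powr s)
    = (\<integral>\<^sup>+x. ennreal (indicat_real {0..<2 * pi} x *\<^sub>R cmod (u x) powr s) \<partial>lebesgue)"
    unfolding set_lebesgue_integral_def using int
    by (intro nn_integral_eq_integral [symmetric]) (auto simp: set_integrable_def)
  also have "\<dots> = (\<integral>\<^sup>+x. ennreal (cmod (u x) powr s) * indicator {0..<2 * pi} x \<partial>lebesgue)"
    by (intro nn_integral_cong) (auto simp: indicator_def)
  also have "\<dots> = (\<integral>\<^sup>+x. ennreal (cmod (u x) powr s) \<partial>circle)"
    by (rule nn_integral_period) (auto simp: per)
  finally show ?thesis .
qed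

text \<open>In place of Hoelder's inequality, \<open>y powr s \<le> 1 + y ^ (2 * R)\<close> is
  applied to \<open>y = cmod (u x) / A\<close>. Scaling by \<open>A\<close> first makes both
  resulting terms proportional to \<open>A powr s\<close>; the factor \<open>c\<close> is what turns
  \<open>abs2 (u x) ^ R\<close> into the scaled power. The same estimate provides the integrability
  on which \<open>Lp_norm\<close> branches.\<close>

lemma Lp_norm_le:
  assumes [measurable]: "u \<in> borel_measurable lebesgue" and per: "\<And>t. u (t + 2 * pi) = u t"
    and s: "1 \<le> s" "s \<le> real (2 * R)" and A: "0 < A" and B: "0 \<le> B"
    and le: "(\<integral>\<^sup>+x. ennreal (abs2 (u x) ^ R) \<partial>circle) \<le> ennreal (B * (A\<^sup>2) ^ R)"
  shows "Lp_norm s u \<le> ennreal ((2 * pi + B) powr (1 / s) * A)"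
proof -
  let ?M = "circle"
  have meas: "u \<in> borel_measurable ?M" by (rule measurable_restrict_space1) fact
  define c where "c = A powr s / (A\<^sup>2) ^ R"
  have c: "0 \<le> c" using A by (simp add: c_def)
  have eq: "(\<integral>\<^sup>+x. ennreal (cmod (u x) powr s) * indicator {0..<2 * pi} x \<partial>lebesgue)
    = (\<integral>\<^sup>+x. ennreal (cmod (u x) powr s) \<partial>?M)"
    by (rule nn_integral_period) (auto simp: per)
  have "(\<integral>\<^sup>+x. ennreal (cmod (u x) powr s) \<partial>?M)
    \<le> (\<integral>\<^sup>+x. ennreal (A powr s) + ennreal c * ennreal (abs2 (u x) ^ R) \<partial>?M)"
  proof (rule nn_integral_mono)
    fix x
    have "cmod (u x) powr s = A powr s * (cmod (u x) / A) powr s"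
      using A by (simp add: powr_divide)
    also have "\<dots> \<le> A powr s * (1 + (cmod (u x) / A) ^ (2 * R))"
      using s A by (intro mult_left_mono powr_le_1_plus_power) auto
    also have "\<dots> = A powr s + c * abs2 (u x) ^ R"
      by (simp add: c_def distrib_left power_divide flip: power_mult)
    finally show "ennreal (cmod (u x) powr s) \<le> ennreal (A powr s) + ennreal c * ennreal (abs2 (u x) ^ R)"
      using c by (simp add: ennreal_leI flip: ennreal_mult ennreal_plus)
  qed
  also have "\<dots> = (\<integral>\<^sup>+x. ennreal (A powr s) \<partial>?M) + ennreal c * (\<integral>\<^sup>+x. ennreal (abs2 (u x) ^ R) \<partial>?M)"
    using meas by (subst nn_integral_add) (auto simp: nn_integral_cmult)
  also have "\<dots> \<le> ennreal (A powr s * (2 * pi)) + ennreal c * ennreal (B * (A\<^sup>2) ^ R)"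
  proof (intro add_mono mult_left_mono le)
    have "emeasure ?M {-pi..pi} = ennreal (2 * pi)" by (simp add: emeasure_restrict_space)
    then show "(\<integral>\<^sup>+x. ennreal (A powr s) \<partial>?M) \<le> ennreal (A powr s * (2 * pi))"
      by (simp add: ennreal_mult)
  qed simp
  also have "\<dots> = ennreal (A powr s * (2 * pi + B))"
    using A B c by (simp add: c_def distrib_left flip: ennreal_mult ennreal_plus)
  finally have *: "(\<integral>\<^sup>+x. ennreal (cmod (u x) powr s) \<partial>?M) \<le> ennreal (A powr s * (2 * pi + B))" .
  have int: "set_integrable lebesgue {0..<2 * pi} (\<lambda>t. cmod (u t) powr s)"
    unfolding set_integrable_powr_iff [OF assms(1)] eq
    using * by (rule order_le_less_trans) simp
  have "ennreal (LINT t:{0..<2 * pi}|lebesgue. cmod (u t) powr s) = (\<integral>\<^sup>+x. ennreal (cmod (u x) powr s) \<partial>?M)"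
    by (rule set_integral_powr_period [OF assms(1) per int])
  also note *
  finally have "(LINT t:{0..<2 * pi}|lebesgue. cmod (u t) powr s) \<le> A powr s * (2 * pi + B)"
    by (subst (asm) ennreal_le_iff) (use A B in auto)
  then have "(LINT t:{0..<2 * pi}|lebesgue. cmod (u t) powr s) powr (1 / s) \<le> (A powr s * (2 * pi + B)) powr (1 / s)"
    using s by (intro powr_mono2) (auto simp: set_lebesgue_integral_def intro!: integral_nonneg_AE)
  also have "\<dots> = (2 * pi + B) powr (1 / s) * A"
    using A B s by (simp add: powr_mult powr_powr)
  finally show ?thesis using int by (simp add: Lp_norm_def ennreal_leI)
qed

text \<open>The interval \<open>{- int n<..<int p}\<close> has \<open>n + p - 1\<close> elements:
  \<open>p = n\<close> gives \<open>2 * n - 1\<close>, and the even number \<open>2 * n\<close>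
  needs the asymmetric choice \<open>p = Suc n\<close>. Almost monotonicity then bounds
  \<open>\<psi> (Suc n)\<close> by a multiple of \<open>\<psi> n\<close>.\<close>

lemma upper_bound:
  assumes \<psi>: "\<psi> \<in> class_P" and s: "1 \<le> s"
  shows "\<exists>K2>0. \<forall>n\<ge>1. best_orth_approx_class (2 * n) (class_L \<psi> \<beta>) s \<le> ennreal (K2 * \<psi> n) \<and>
      best_orth_approx_class (2 * n - 1) (class_L \<psi> \<beta>) s \<le> ennreal (K2 * \<psi> n)"
proof -
  have pos: "\<And>k. 1 \<le> k \<Longrightarrow> 0 < \<psi> k" using \<psi> by (auto simp: class_P_def)
  obtain K where K: "0 < K" "\<And>k1 k2. 1 \<le> k1 \<Longrightarrow> k1 \<le> k2 \<Longrightarrow> \<psi> k2 \<le> K * \<psi> k1"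
    using class_P_bounds [OF \<psi>] by blast
  obtain r where r: "s \<le> real r" using real_arch_simple by blast
  then have r': "s \<le> real (2 * Suc r)" by simp
  obtain B where B: "0 \<le> B" "\<And>f n p. f \<in> class_L \<psi> \<beta> \<Longrightarrow> 1 \<le> n \<Longrightarrow> 1 \<le> p \<Longrightarrow>
    (\<integral>\<^sup>+x. ennreal (abs2 (f x - (\<Sum>k\<in>{- int n<..<int p}. fc f k * ex k x)) ^ Suc r) \<partial>circle)
    \<le> ennreal (B * ((\<psi> n + \<psi> p)\<^sup>2) ^ Suc r)"
    using class_L_remainder [OF \<psi>, of \<beta> r] by blast
  define c where "c = (2 * pi + B) powr (1 / s)"
  have "0 < 2 * pi + B" using B(1) by (intro add_pos_nonneg) auto
  then have c: "0 < c" by (simp add: c_def)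
  have key: "best_orth_approx_class (n + p - 1) (class_L \<psi> \<beta>) s \<le> ennreal (c * (\<psi> n + \<psi> p))"
    if n: "1 \<le> n" and p: "1 \<le> p" for n p
    unfolding best_orth_approx_class_def
  proof (rule SUP_least)
    fix f assume f: "f \<in> class_L \<psi> \<beta>"
    then have "f \<in> Lp 1" by (auto simp: class_L_def)
    then have fm: "f \<in> borel_measurable lebesgue" and per: "\<And>t. f (t + 2 * pi) = f t"
      by (auto simp: Lp_def)
    define \<gamma> where "\<gamma> = {- int n<..<int p}"
    have "card \<gamma> = nat (int p + int n - 1)" by (simp add: \<gamma>_def)
    then have card: "card \<gamma> = n + p - 1" using n p by linarith
    define u where "u t = f t - (\<Sum>k\<in>\<gamma>. fc f k * ex k t)" for t
    have "Lp_norm s u \<le> ennreal (c * (\<psi> n + \<psi> p))"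
      unfolding c_def
    proof (rule Lp_norm_le [OF _ _ s r'])
      have "continuous_on UNIV (\<lambda>t. \<Sum>k\<in>\<gamma>. fc f k * ex k t)" by (intro continuous_intros)
      then have "(\<lambda>t. \<Sum>k\<in>\<gamma>. fc f k * ex k t) \<in> borel_measurable lebesgue"
        by (intro measurable_completion) (simp add: borel_measurable_continuous_onI)
      then show "u \<in> borel_measurable lebesgue" unfolding u_def by (intro borel_measurable_diff fm)
      show "u (t + 2 * pi) = u t" for t by (simp add: u_def per ex_periodic)
      show "(\<integral>\<^sup>+x. ennreal (abs2 (u x) ^ Suc r) \<partial>circle) \<le> ennreal (B * ((\<psi> n + \<psi> p)\<^sup>2) ^ Suc r)"
        unfolding u_def \<gamma>_def by (rule B(2) [OF f n p])
    qed (use pos [OF n] pos [OF p] B in auto)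
    then show "best_orth_approx (n + p - 1) f s \<le> ennreal (c * (\<psi> n + \<psi> p))"
      unfolding best_orth_approx_def u_def ex_def using card
      by (intro INF_lower2 [of \<gamma>]) (auto simp: \<gamma>_def)
  qed
  show ?thesis
  proof (intro exI [of _ "c * (2 + K)"] conjI allI impI)
    show "0 < c * (2 + K)" using c K by simp
    fix n :: nat assume n: "1 \<le> n"
    have "\<psi> n + \<psi> (Suc n) \<le> (2 + K) * \<psi> n" "\<psi> n + \<psi> n \<le> (2 + K) * \<psi> n"
      using K(1) K(2) [OF n, of "Suc n"] pos [OF n] by (simp_all add: distrib_right)
    then have le: "c * (\<psi> n + \<psi> (Suc n)) \<le> c * (2 + K) * \<psi> n" "c * (\<psi> n + \<psi> n) \<le> c * (2 + K) * \<psi> n"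
      unfolding mult.assoc [of c] using c by (intro mult_left_mono; simp)+
    have eq: "2 * n = n + Suc n - 1" "2 * n - 1 = n + n - 1" by simp_all
    show "best_orth_approx_class (2 * n) (class_L \<psi> \<beta>) s \<le> ennreal (c * (2 + K) * \<psi> n)"
      unfolding eq(1) using n by (intro order_trans [OF key ennreal_leI [OF le(1)]]) simp_all
    show "best_orth_approx_class (2 * n - 1) (class_L \<psi> \<beta>) s \<le> ennreal (c * (2 + K) * \<psi> n)"
      unfolding eq(2) using n by (intro order_trans [OF key ennreal_leI [OF le(2)]]) simp_all
  qed
qed


subsection \<open>The lower bound\<close>

text \<open>The Rudin-Shapiro recursion sends a pair \<open>(P, Q)\<close> of length
  \<open>N\<close> to \<open>P + ex N * Q\<close> and \<open>P - ex N * Q\<close>. The two halves do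
  not overlap, so the coefficients remain signs, and the parallelogram law doubles the sum of
  squares.\<close>

lemma rudin_shapiro_pair:
  "\<exists>(a :: nat \<Rightarrow> real) (b :: nat \<Rightarrow> real). (\<forall>k. \<bar>a k\<bar> = (1 :: real) \<and> \<bar>b k\<bar> = (1 :: real)) \<and>
     (\<forall>x. abs2 (\<Sum>k<2 ^ m. a k * ex (int k) x) + abs2 (\<Sum>k<2 ^ m. b k * ex (int k) x) = 2 * 2 ^ m)"
proof (induction m)
  case 0
  show ?case by (intro exI [of _ "\<lambda>_. 1"]) simp
next
  case (Suc m)
  then obtain a :: "nat \<Rightarrow> real" and b :: "nat \<Rightarrow> real" where ab: "\<And>k. \<bar>a k\<bar> = (1 :: real)" "\<And>k. \<bar>b k\<bar> = (1 :: real)"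
    and sq: "\<And>x. abs2 (\<Sum>k<2 ^ m. a k * ex (int k) x) + abs2 (\<Sum>k<2 ^ m. b k * ex (int k) x) = 2 * 2 ^ m"
    by blast
  define N :: nat where "N = 2 ^ m"
  define c where "c \<epsilon> k = (if k < N then a k else \<epsilon> * b (k - N))" for \<epsilon> k
  have split: "(\<Sum>k<2 ^ Suc m. c \<epsilon> k * ex (int k) x)
      = (\<Sum>k<N. a k * ex (int k) x) + of_real \<epsilon> * (ex (int N) x * (\<Sum>k<N. b k * ex (int k) x))" for \<epsilon> x
  proof -
    have "{..<2 ^ Suc m} = {0..<N + N}" by (auto simp: N_def)
    then have "(\<Sum>k<2 ^ Suc m. c \<epsilon> k * ex (int k) x)
       = (\<Sum>k\<in>{0..<N}. c \<epsilon> k * ex (int k) x) + (\<Sum>k\<in>{0+N..<N + N}. c \<epsilon> k * ex (int k) x)"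
      by (simp add: sum.atLeastLessThan_concat)
    also have "(\<Sum>k\<in>{0+N..<N + N}. c \<epsilon> k * ex (int k) x) = (\<Sum>k\<in>{0..<N}. c \<epsilon> (k + N) * ex (int (k + N)) x)"
      by (rule sum.shift_bounds_nat_ivl)
    also have "\<dots> = of_real \<epsilon> * (ex (int N) x * (\<Sum>k<N. b k * ex (int k) x))"
      by (simp add: c_def ex_add sum_distrib_left atLeast0LessThan mult_ac)
    also have "(\<Sum>k\<in>{0..<N}. c \<epsilon> k * ex (int k) x) = (\<Sum>k<N. a k * ex (int k) x)"
      by (simp add: c_def atLeast0LessThan)
    finally show ?thesis .
  qed
  have parallelogram: "abs2 (z + w) + abs2 (z - w) = 2 * (abs2 z + abs2 w)" for z w
    using norm_add_squared [of z w] norm_add_squared [of z "- w"] by simp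
  show ?case
  proof (intro exI conjI allI)
    show "\<bar>c 1 k\<bar> = (1 :: real)" "\<bar>c (- 1) k\<bar> = (1 :: real)" for k using ab by (simp_all add: c_def)
    show "abs2 (\<Sum>k<2 ^ Suc m. c 1 k * ex (int k) x) + abs2 (\<Sum>k<2 ^ Suc m. c (- 1) k * ex (int k) x)
      = 2 * 2 ^ Suc m" for x
    proof -
      have "abs2 (\<Sum>k<2 ^ Suc m. c 1 k * ex (int k) x) + abs2 (\<Sum>k<2 ^ Suc m. c (- 1) k * ex (int k) x)
        = 2 * (abs2 (\<Sum>k<N. a k * ex (int k) x) + abs2 (ex (int N) x * (\<Sum>k<N. b k * ex (int k) x)))"
        unfolding split using parallelogram by simp
      also have "\<dots> = 2 * (2 * 2 ^ m)"
        using sq [of x] by (simp add: norm_mult N_def)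
      finally show ?thesis by simp
    qed
  qed
qed

text \<open>Multiplication by \<open>ex N\<close> does not change the modulus. It moves the spectrum
  to a set disjoint from its negative, so that the coefficients survive when the conjugate is
  added.\<close>

lemma rudin_shapiro_shifted:
  assumes N: "N = 2 ^ m"
  shows "\<exists>a :: int \<Rightarrow> real. (\<forall>k. \<bar>a k\<bar> = (1 :: real)) \<and>
     (\<forall>x. cmod (\<Sum>j\<in>{int N..<2 * int N}. a j * ex j x) \<le> sqrt (2 * real N))"
proof -
  obtain a :: "nat \<Rightarrow> real" and b :: "nat \<Rightarrow> real" where ab: "\<And>k. \<bar>a k\<bar> = (1 :: real)"
    and sq: "\<And>x. abs2 (\<Sum>k<2 ^ m. a k * ex (int k) x) + abs2 (\<Sum>k<2 ^ m. b k * ex (int k) x) = 2 * 2 ^ m"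
    using rudin_shapiro_pair [of m] by blast
  have "cmod (\<Sum>j\<in>{int N..<2 * int N}. a (nat (j - int N)) * ex j x) \<le> sqrt (2 * real N)" for x
  proof -
    have "{int N..<2 * int N} = (\<lambda>k. int N + int k) ` {..<N}"
    proof (intro set_eqI iffI)
      fix j assume "j \<in> {int N..<2 * int N}"
      then have "j = int N + int (nat (j - int N))" "nat (j - int N) < N" by auto
      then show "j \<in> (\<lambda>k. int N + int k) ` {..<N}" by blast
    qed auto
    then have "(\<Sum>j\<in>{int N..<2 * int N}. a (nat (j - int N)) * ex j x)
       = ex (int N) x * (\<Sum>k<N. a k * ex (int k) x)"
      by (simp add: sum.reindex inj_on_def ex_add sum_distrib_left mult_ac)
    moreover have "abs2 (\<Sum>k<N. a k * ex (int k) x) \<le> 2 * N"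
    proof -
      have "real (2 * N) = 2 * 2 ^ m" by (simp add: N)
      then show ?thesis unfolding N by (simp only: sq [of x, symmetric]) simp
    qed
    ultimately show ?thesis by (simp add: norm_mult real_le_rsqrt)
  qed
  with ab show ?thesis by (intro exI [of _ "\<lambda>j. a (nat (j - int N))"]) auto
qed

section \<open>Real trigonometric polynomials as members of the class\<close>

definition real_poly :: "int set \<Rightarrow> (int \<Rightarrow> complex) \<Rightarrow> real \<Rightarrow> complex" where
  "real_poly J c x = (\<Sum>j\<in>J. c j * ex j x) + cnj (\<Sum>j\<in>J. c j * ex j x)"

lemma real_poly_tp: "real_poly J c \<in> tp UNIV"
  unfolding real_poly_def [abs_def] by (rule tp_add [OF tp_sum_ex tp_cnj [OF tp_sum_ex]]) auto

lemma real_poly_real: "real_poly J c x = of_real (2 * Re (\<Sum>j\<in>J. c j * ex j x))"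
  unfolding real_poly_def by (rule complex_add_cnj)

lemma fc_real_poly:
  assumes "finite J"
  shows "fc (real_poly J c) k = (if k \<in> J then c k else 0) + (if - k \<in> J then cnj (c (- k)) else 0)"
proof -
  have "fc (real_poly J c) k = fc (\<lambda>x. \<Sum>j\<in>J. c j * ex j x) k
    + fc (\<lambda>x. cnj (\<Sum>j\<in>J. c j * ex j x)) k"
    unfolding real_poly_def [abs_def]
    by (intro fc_add [of _ UNIV _ UNIV] tp_cnj [of _ UNIV UNIV] tp_sum_ex) auto
  then show ?thesis unfolding fc_cnj fc_sum_ex [OF assms] by simp
qed

lemma tp_periodic: "f \<in> tp A \<Longrightarrow> f (t + 2 * pi) = f t"
  by (induction rule: tp.induct) (auto simp: ex_periodic)

lemma continuous_lebesgue_measurable: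
  fixes f :: "real \<Rightarrow> complex"
  assumes "continuous_on UNIV f" shows "f \<in> borel_measurable lebesgue"
  using borel_measurable_continuous_onI [OF assms] by (intro measurable_completion) simp

lemma tp_Lp:
  assumes "f \<in> tp A" shows "f \<in> Lp 1"
proof -
  have cont: "continuous_on UNIV f" by (rule tp_cont [OF assms])
  have meas: "f \<in> borel_measurable lebesgue" by (rule continuous_lebesgue_measurable [OF cont])
  have "(\<integral>\<^sup>+x. ennreal (cmod (f x) powr 1) * indicator {0..<2 * pi} x \<partial>lebesgue)
    = (\<integral>\<^sup>+x. ennreal (cmod (f x)) \<partial>circle)"
    using meas by (subst nn_integral_period) (auto simp: tp_periodic [OF assms])
  also have "\<dots> < \<infinity>"
    using cont_integrable [OF cont] by (simp add: integrable_iff_bounded)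
  finally have "set_integrable lebesgue {0..<2 * pi} (\<lambda>t. cmod (f t) powr 1)"
    by (simp only: set_integrable_powr_iff [OF meas])
  then show ?thesis
    unfolding Lp_def using meas tp_periodic [OF assms] by blast
qed

text \<open>With \<open>a\<close> half the mean,
  \<open>y \<le> a + a powr (1 - s) * y powr s\<close> holds for every \<open>y \<ge> 0\<close>;
  averaging it gives \<open>a powr s \<le> mean (\<lambda>x. cmod (u x) powr s)\<close>, without
  Hoelder's inequality. The loss of a factor 2 is immaterial. Passing to the unnormalised integral
  only helps, as the period exceeds 1.\<close>

lemma Lp_norm_ge_mean:
  assumes u: "u \<in> tp A" and s: "1 \<le> s"
  shows "ennreal (mean (\<lambda>x. cmod (u x)) / 2) \<le> Lp_norm s u"
proof (cases "set_integrable lebesgue {0..<2 * pi} (\<lambda>t. cmod (u t) powr s)")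
  case True
  define a where "a = mean (\<lambda>x. cmod (u x)) / 2"
  have a0: "0 \<le> a" by (simp add: a_def mean_nonneg)
  note [continuous_intros] = tp_cont [OF u]
  have cont: "continuous_on UNIV (\<lambda>x. cmod (u x) powr s)"
    by (rule continuous_on_powr') (use s in \<open>auto intro!: continuous_intros\<close>)
  define I where "I = (LINT t:{0..<2 * pi}|lebesgue. cmod (u t) powr s)"
  have I0: "0 \<le> I" unfolding I_def set_lebesgue_integral_def by (intro integral_nonneg_AE) auto
  have "ennreal I = (\<integral>\<^sup>+x. ennreal (cmod (u x) powr s) \<partial>circle)"
    unfolding I_def
    by (rule set_integral_powr_period [OF continuous_lebesgue_measurable [OF tp_cont [OF u]] tp_periodic [OF u] True])
  also have "\<dots> = ennreal (\<integral>x. cmod (u x) powr s \<partial>circle)"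
    by (rule nn_integral_eq_integral [OF cont_integrable [OF cont]]) simp
  also have "(\<integral>x. cmod (u x) powr s \<partial>circle) = 2 * pi * mean (\<lambda>x. cmod (u x) powr s)"
    by (simp add: mean_def)
  finally have I: "I = 2 * pi * mean (\<lambda>x. cmod (u x) powr s)"
    using I0 by (subst (asm) ennreal_inj) (auto simp: mean_nonneg)
  have "a \<le> I powr (1 / s)"
  proof (cases "a = 0")
    case False
    then have a: "0 < a" using a0 by simp
    have "2 * a = mean (\<lambda>x. cmod (u x))" by (simp add: a_def)
    also have "\<dots> \<le> mean (\<lambda>x. a + a powr (1 - s) * cmod (u x) powr s)"
    proof (intro mean_mono continuous_on_add continuous_on_mult continuous_on_const continuous_on_norm cont tp_cont [OF u])
      fix x
      show "cmod (u x) \<le> a + a powr (1 - s) * cmod (u x) powr s"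
      proof (cases "cmod (u x) \<le> a")
        case False
        then have "cmod (u x) powr (1 - s) \<le> a powr (1 - s)" using a s by (intro powr_mono2') auto
        then have "cmod (u x) powr (1 - s) * cmod (u x) powr s \<le> a powr (1 - s) * cmod (u x) powr s"
          by (intro mult_right_mono) auto
        moreover have "cmod (u x) powr (1 - s) * cmod (u x) powr s = cmod (u x)"
          using False a by (simp flip: powr_add)
        ultimately show ?thesis using a by simp
      qed (simp add: add_increasing2)
    qed
    also have "\<dots> = a + a powr (1 - s) * mean (\<lambda>x. cmod (u x) powr s)"
      by (subst mean_add) (auto simp: mean_rmult intro!: continuous_on_mult cont)
    finally have "a powr s * a \<le> a powr s * (a powr (1 - s) * mean (\<lambda>x. cmod (u x) powr s))"
      by (intro mult_left_mono) auto
    also have "\<dots> = a * mean (\<lambda>x. cmod (u x) powr s)"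
      using a by (simp flip: powr_add mult.assoc)
    finally have "a powr s \<le> mean (\<lambda>x. cmod (u x) powr s)" using a by simp
    also have "\<dots> \<le> I"
      unfolding I using mean_nonneg [of "\<lambda>x. cmod (u x) powr s"] pi_gt3
      by (simp add: mult_ge1_I mult_le_cancel_right1)
    finally have "(a powr s) powr (1 / s) \<le> I powr (1 / s)" using s by (intro powr_mono2) auto
    then show ?thesis using a s by (simp add: powr_powr)
  qed simp
  then show ?thesis using True by (simp add: Lp_norm_def a_def I_def ennreal_leI)
qed (simp add: Lp_norm_def)

lemma exists_power_2_between:
  assumes "1 \<le> n" shows "\<exists>m. 4 * n \<le> 2 ^ m \<and> (2::nat) ^ m \<le> 8 * n"
proof -
  obtain m where "2 ^ m \<le> 4 * n" "4 * n < 2 ^ (m + 1)"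
    using ex_power_ivl1 [of 2 "4 * n"] assms by auto
  then show ?thesis by (intro exI [of _ "Suc m"]) auto
qed

text \<open>Four doublings through \<open>class_B\<close> compare \<open>n\<close> with
  \<open>16 * n\<close>, and almost monotonicity compares \<open>16 * n\<close> with every
  \<open>j\<close> below it. The number 16 comes from a spectrum in \<open>[N, 2 * N)\<close> with
  \<open>N \<le> 8 * n\<close>.\<close>

lemma psi_doubling:
  assumes "\<psi> \<in> class_P \<inter> class_B"
  shows "\<exists>c>0. \<forall>n\<ge>1. \<forall>j\<ge>1. j \<le> 16 * n \<longrightarrow> c * \<psi> n \<le> \<psi> j"
proof -
  obtain K where K: "0 < K" "\<And>k1 k2. 1 \<le> k1 \<Longrightarrow> k1 \<le> k2 \<Longrightarrow> \<psi> k2 \<le> K * \<psi> k1"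
    using class_P_bounds [of \<psi>] assms by blast
  obtain L where L: "0 < L" "\<And>k. 1 \<le> k \<Longrightarrow> \<psi> k / \<psi> (2 * k) \<le> L"
    and pos: "\<And>k. 1 \<le> k \<Longrightarrow> 0 < \<psi> k"
    using assms by (auto simp: class_B_def)
  have L': "\<psi> k \<le> L * \<psi> (2 * k)" if "1 \<le> k" for k
    using L(2) [OF that] pos [of "2 * k"] that by (simp add: divide_le_eq)
  show ?thesis
  proof (intro exI [of _ "1 / (L * L * L * L * K)"] conjI allI impI)
    show "0 < 1 / (L * L * L * L * K)" using L K by simp
    fix n j :: nat assume n: "1 \<le> n" and j: "1 \<le> j" "j \<le> 16 * n"
    have "\<psi> n \<le> L * \<psi> (2 * n)" using L' n by simp
    also have "\<dots> \<le> L * (L * \<psi> (4 * n))" using L' [of "2 * n"] n L by (intro mult_left_mono) auto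
    also have "\<dots> \<le> L * (L * (L * \<psi> (8 * n)))" using L' [of "4 * n"] n L by (intro mult_left_mono) auto
    also have "\<dots> \<le> L * (L * (L * (L * \<psi> (16 * n))))" using L' [of "8 * n"] n L by (intro mult_left_mono) auto
    also have "\<dots> \<le> L * (L * (L * (L * (K * \<psi> j))))" using K(2) [OF j] L by (intro mult_left_mono) auto
    finally show "1 / (L * L * L * L * K) * \<psi> n \<le> \<psi> j"
      using L K by (simp add: divide_le_eq mult_ac)
  qed
qed

text \<open>The extremal function has the spectrum of a Rudin-Shapiro polynomial of length \<open>N \<ge> 4 n\<close>, with all
  coefficients of comparable size; its remainder is tested against the analytic half of that polynomial, so
  that every surviving coefficient contributes a positive term.\<close>

lemma lower_bound:
  assumes \<psi>: "\<psi> \<in> class_P \<inter> class_B" and s: "1 \<le> s"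
  shows "\<exists>K1>0. \<forall>n\<ge>1. \<forall>m\<le>2 * n. ennreal (K1 * \<psi> n) \<le> best_orth_approx_class m (class_L \<psi> \<beta>) s"
proof -
  obtain c where c: "0 < c" "\<And>n j. 1 \<le> n \<Longrightarrow> 1 \<le> j \<Longrightarrow> j \<le> 16 * n \<Longrightarrow> c * \<psi> n \<le> \<psi> j"
    using psi_doubling [OF \<psi>] by blast
  have pos: "\<And>k. 1 \<le> k \<Longrightarrow> 0 < \<psi> k" using \<psi> by (auto simp: class_B_def)
  show ?thesis
  \<comment> \<open>The constant collects 1/2 from the share of surviving frequencies, 1/4 from
    \<open>2 * q * q = 4 * N\<close> against \<open>N\<close>, and 1/2 from
    \<open>Lp_norm_ge_mean\<close>.\<close>
  proof (intro exI [of _ "c / 16"] conjI allI impI)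
    show "0 < c / 16" using c by simp
    fix n m :: nat assume n: "1 \<le> n" and m: "m \<le> 2 * n"
    obtain l where l: "4 * n \<le> 2 ^ l" "2 ^ l \<le> 8 * n" using exists_power_2_between [OF n] by blast
    define N :: nat where "N = 2 ^ l"
    have N: "4 * n \<le> N" "N \<le> 8 * n" "1 \<le> N" using l n by (auto simp: N_def)
    define J where "J = {int N..<2 * int N}"
    have J: "finite J" "card J = N" by (auto simp: J_def)
    have J1: "1 \<le> j" if "j \<in> J" for j using that N by (auto simp: J_def)
    have \<psi>J: "\<psi> (nat j) \<noteq> 0" if "j \<in> J" for j
    proof -
      have "1 \<le> nat j" using J1 [OF that] by linarith
      from pos [OF this] show ?thesis by simp
    qed
    have Jneg: "- j \<notin> J" if "j \<in> J" for j using that N by (auto simp: J_def)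
    obtain a :: "int \<Rightarrow> real" where "(\<forall>k. \<bar>a k\<bar> = (1 :: real)) \<and>
        (\<forall>x. cmod (\<Sum>j\<in>{int N..<2 * int N}. a j * ex j x) \<le> sqrt (2 * real N))"
      using rudin_shapiro_shifted [OF N_def] by (elim exE)
    then have a: "\<And>k. \<bar>a k\<bar> = (1 :: real)"
      and a_le: "\<And>x. cmod (\<Sum>j\<in>J. a j * ex j x) \<le> sqrt (2 * real N)"
      by (simp_all only: J_def)
    define q where "q = sqrt (2 * real N)"
    have q: "0 < q" "q * q = 2 * real N" using N by (auto simp: q_def)
    \<comment> \<open>At positive frequencies the derivative multiplies by
      \<open>cnj \<omega>\<close>, so the coefficients of \<open>f\<close> are given the factor
      \<open>\<omega>\<close> there; at negative frequencies conjugation supplies the matching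
      phase.\<close>
    define \<omega> where "\<omega> = exp (- \<i> * of_real (\<beta> * pi / 2))"
    have \<omega>: "cmod \<omega> = 1" by (simp add: \<omega>_def)
    have cnj\<omega>: "cnj \<omega> = exp (\<i> * of_real (\<beta> * pi / 2))" by (simp add: \<omega>_def exp_cnj)
    have \<omega>\<omega>: "\<omega> * cnj \<omega> = 1" using complex_norm_square [of \<omega>] \<omega> by simp
    \<comment> \<open>\<open>g\<close> is the sum of a polynomial and its conjugate; dividing by
      twice the sup bound \<open>q\<close> makes \<open>cmod (g x) \<le> 1\<close>.\<close>
    define cg where "cg j = complex_of_real (a j / (2 * q))" for j
    define cf where "cf j = of_real (\<psi> (nat j)) * \<omega> * cg j" for j
    define g where "g = real_poly J cg"
    define f where "f = real_poly J cf"
    have fc_f: "fc f k = (if k \<in> J then cf k else 0) + (if - k \<in> J then cnj (cf (- k)) else 0)"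
      and fc_g: "fc g k = (if k \<in> J then cg k else 0) + (if - k \<in> J then cnj (cg (- k)) else 0)" for k
      unfolding f_def g_def by (rule fc_real_poly [OF J(1)])+
    have f_tp: "f \<in> tp UNIV" and g_tp: "g \<in> tp UNIV" unfolding f_def g_def by (rule real_poly_tp)+
    have g1: "cmod (g x) \<le> 1" for x
    proof -
      have eq: "(\<Sum>j\<in>J. cg j * ex j x) = (\<Sum>j\<in>J. a j * ex j x) / of_real (2 * q)"
        by (simp add: cg_def sum_divide_distrib)
      have "cmod (g x) \<le> cmod (\<Sum>j\<in>J. cg j * ex j x) + cmod (cnj (\<Sum>j\<in>J. cg j * ex j x))"
        unfolding g_def real_poly_def by (rule norm_triangle_ineq)
      also have "\<dots> = 2 * cmod (\<Sum>j\<in>J. cg j * ex j x)" by (simp only: complex_mod_cnj mult_2)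
      also have "\<dots> = cmod (\<Sum>j\<in>J. a j * ex j x) / q"
        unfolding eq norm_divide using q by simp
      also have "\<dots> \<le> 1" using a_le [of x] q by (simp add: q_def divide_le_eq)
      finally show ?thesis .
    qed
    have deriv: "is_psi_derivative \<psi> \<beta> f g"
      unfolding is_psi_derivative_def
    proof (intro conjI allI)
      show "g \<in> Lp 1" by (rule tp_Lp [OF g_tp])
      fix k
      consider "k = 0" | "k \<in> J" | "- k \<in> J" | "k \<noteq> 0" "k \<notin> J" "- k \<notin> J" by blast
      then show "fc g k = (if k = 0 then 0 else fc f k / of_real (\<psi> (nat \<bar>k\<bar>)) *
              exp (\<i> * of_real (\<beta> * pi / 2 * of_int (sgn k))))"
      proof cases
        case 1
        then show ?thesis using J1 [of 0] by (auto simp: fc_g)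
      next
        case 2
        then have k: "k \<ge> 1" "\<psi> (nat k) \<noteq> 0" using J1 \<psi>J by auto
        then have "sgn k = 1" "\<bar>k\<bar> = k" "k \<noteq> 0" by auto
        moreover have "exp (\<i> * of_real (\<beta> * pi / 2 * of_int 1)) = cnj \<omega>" by (simp add: cnj\<omega>)
        ultimately show ?thesis
          using 2 Jneg [OF 2] k \<omega>\<omega> by (simp only: fc_f fc_g cf_def) (simp add: mult_ac)
      next
        case 3
        then have k: "- k \<ge> 1" "\<psi> (nat (- k)) \<noteq> 0" using J1 [of "- k"] \<psi>J [of "- k"] by auto
        then have "sgn k = - 1" "\<bar>k\<bar> = - k" "k \<noteq> 0" by auto
        moreover have "k \<notin> J" using Jneg [OF 3] by simp
        moreover have "exp (\<i> * of_real (\<beta> * pi / 2 * of_int (- 1))) = \<omega>" by (simp add: \<omega>_def)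
        ultimately show ?thesis
          using 3 k \<omega>\<omega> by (simp only: fc_f fc_g cf_def) (simp add: mult_ac)
      next
        case 4
        then show ?thesis by (simp add: fc_f fc_g)
      qed
    qed
    have "Linf_norm g \<le> 1"
      unfolding Linf_norm_def
    proof (rule esssup_I)
      show "(\<lambda>t. ennreal (cmod (g t))) \<in> borel_measurable lebesgue"
        by (intro measurable_compose [OF _ measurable_ennreal] measurable_compose [OF _ borel_measurable_norm]
            continuous_lebesgue_measurable tp_cont [OF g_tp])
      show "AE t in lebesgue. ennreal (cmod (g t)) \<le> 1" by (simp add: g1)
    qed
    then have f_class: "f \<in> class_L \<psi> \<beta>"
      unfolding class_L_def using tp_Lp [OF f_tp] deriv by (auto simp: f_def real_poly_real)
    have "ennreal (c / 16 * \<psi> n) \<le> best_orth_approx m f s"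
      unfolding best_orth_approx_def
    proof (rule INF_greatest)
      fix \<gamma> :: "int set" assume "\<gamma> \<in> {\<gamma>. finite \<gamma> \<and> card \<gamma> = m}"
      then have \<gamma>: "finite \<gamma>" "card \<gamma> \<le> 2 * n" using m by auto
      define u where "u t = f t - (\<Sum>k\<in>\<gamma>. fc f k * ex k t)" for t
      have sum_tp: "(\<lambda>t. \<Sum>k\<in>\<gamma>. fc f k * ex k t) \<in> tp UNIV" by (rule tp_sum_ex) simp
      have u_tp: "u \<in> tp UNIV" unfolding u_def by (rule tp_diff [OF f_tp sum_tp])
      have fc_u: "fc u k = (if k \<in> \<gamma> then 0 else fc f k)" for k
        unfolding u_def fc_diff [OF f_tp sum_tp] fc_sum_ex [OF \<gamma>(1)] by simp
      define h where "h x = (\<Sum>j\<in>J. \<omega> * a j * ex j x)" for x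
      have h_le: "cmod (h x) \<le> q" for x
      proof -
        have "h x = \<omega> * (\<Sum>j\<in>J. a j * ex j x)" by (simp add: h_def sum_distrib_left mult.assoc)
        then show ?thesis using a_le [of x] \<omega> by (simp add: norm_mult q_def)
      qed
      have h_cont: "continuous_on UNIV h" unfolding h_def by (intro continuous_intros)
      note [continuous_intros] = tp_cont [OF u_tp] h_cont
      \<comment> \<open>At most \<open>2 * n\<close> frequencies are removed, which is at most half
        of the \<open>N \<ge> 4 * n\<close> elements of \<open>J\<close>.\<close>
      have card: "N \<le> 2 * card (J - \<gamma>)"
        using diff_card_le_card_Diff [OF \<gamma>(1), of J] J \<gamma>(2) N by linarith
      have "mean (\<lambda>x. u x * cnj (h x)) = (\<Sum>j\<in>J. cnj (\<omega> * a j) * fc u j)"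
      proof -
        have eq: "u x * cnj (h x) = (\<Sum>j\<in>J. cnj (\<omega> * a j) * (u x * ex (- j) x))" for x
          by (simp add: h_def sum_distrib_left ex_minus mult_ac)
        show ?thesis
          unfolding eq fourier_coeff_eq_mean
          by (rule mean_lincomb) (intro cont_integrable continuous_intros)
      qed
      also have "\<dots> = (\<Sum>j\<in>J - \<gamma>. cnj (\<omega> * a j) * fc u j)"
        by (rule sum.mono_neutral_right) (auto simp: J fc_u)
      also have "\<dots> = (\<Sum>j\<in>J - \<gamma>. of_real (\<psi> (nat j) / (2 * q)))"
      proof (rule sum.cong)
        fix j assume j: "j \<in> J - \<gamma>"
        have "a j * a j = \<bar>a j\<bar> * \<bar>a j\<bar>" by simp
        then have aa: "a j * a j = 1" by (simp only: a mult_1)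
        have "cnj (\<omega> * a j) * fc u j = (\<omega> * cnj \<omega>) * of_real (a j * a j) * of_real (\<psi> (nat j) / (2 * q))"
          using j Jneg [of j] by (simp add: fc_u fc_f cf_def cg_def)
        then show "cnj (\<omega> * a j) * fc u j = of_real (\<psi> (nat j) / (2 * q))"
          by (simp only: \<omega>\<omega> aa of_real_1 mult_1)
      qed simp
      finally have mean_uh: "mean (\<lambda>x. u x * cnj (h x)) = of_real (\<Sum>j\<in>J - \<gamma>. \<psi> (nat j) / (2 * q))" by simp
      have "N / 2 * (c * \<psi> n) \<le> card (J - \<gamma>) * (c * \<psi> n)"
        using card c pos [OF n] by (intro mult_right_mono) auto
      also have "\<dots> = (\<Sum>j\<in>J - \<gamma>. c * \<psi> n)" by simp
      also have "\<dots> \<le> (\<Sum>j\<in>J - \<gamma>. \<psi> (nat j))"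
      proof (intro sum_mono c(2) n)
        fix j assume "j \<in> J - \<gamma>"
        then show "1 \<le> nat j" "nat j \<le> 16 * n" using N by (auto simp: J_def)
      qed
      also have "\<dots> = 2 * q * (\<Sum>j\<in>J - \<gamma>. \<psi> (nat j) / (2 * q))"
        using q by (simp add: sum_distrib_left)
      also have "(\<Sum>j\<in>J - \<gamma>. \<psi> (nat j) / (2 * q)) \<le> cmod (mean (\<lambda>x. u x * cnj (h x)))"
        unfolding mean_uh norm_of_real by (rule abs_ge_self)
      also have "\<dots> \<le> mean (\<lambda>x. cmod (u x * cnj (h x)))" by (rule norm_mean_le)
      also have "\<dots> \<le> mean (\<lambda>x. q * cmod (u x))"
        by (intro mean_mono continuous_intros) (use h_le in \<open>simp add: norm_mult mult.commute mult_right_mono\<close>)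
      also have "\<dots> = q * mean (\<lambda>x. cmod (u x))" by (rule mean_rmult)
      finally have "N / 2 * (c * \<psi> n) \<le> 2 * q * (q * mean (\<lambda>x. cmod (u x)))"
        using q by (simp add: mult_left_mono)
      also have "\<dots> = 4 * N * mean (\<lambda>x. cmod (u x))" using q(2) by (simp add: mult.assoc [symmetric])
      finally have "c / 16 * \<psi> n \<le> mean (\<lambda>x. cmod (u x)) / 2" using N(3) by simp
      then have "ennreal (c / 16 * \<psi> n) \<le> ennreal (mean (\<lambda>x. cmod (u x)) / 2)" by (rule ennreal_leI)
      also have "\<dots> \<le> Lp_norm s u" by (rule Lp_norm_ge_mean [OF u_tp s])
      finally show "ennreal (c / 16 * \<psi> n) \<le> Lp_norm s (\<lambda>t. f t - (\<Sum>k\<in>\<gamma>. fc f k * exp (\<i> * of_int k * of_real t)))"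
        by (simp add: u_def [abs_def] ex_def)
    qed
    also have "\<dots> \<le> best_orth_approx_class m (class_L \<psi> \<beta>) s"
      unfolding best_orth_approx_class_def by (rule SUP_upper [OF f_class])
    finally show "ennreal (c / 16 * \<psi> n) \<le> best_orth_approx_class m (class_L \<psi> \<beta>) s" .
  qed
qed

theorem theorem2:
  fixes \<psi> :: "nat \<Rightarrow> real" and s \<beta> :: real
  assumes "\<psi> \<in> class_P \<inter> class_B" and "1 \<le> s"
  shows "\<exists>K1>0. \<exists>K2>0. \<forall>n\<ge>1.
      ennreal (K1 * \<psi> n) \<le> best_orth_approx_class (2 * n) (class_L \<psi> \<beta>) s \<and>
      best_orth_approx_class (2 * n) (class_L \<psi> \<beta>) s \<le> ennreal (K2 * \<psi> n) \<and>
      ennreal (K1 * \<psi> n) \<le> best_orth_approx_class (2 * n - 1) (class_L \<psi> \<beta>) s \<and>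
      best_orth_approx_class (2 * n - 1) (class_L \<psi> \<beta>) s \<le> ennreal (K2 * \<psi> n)"
proof -
  obtain K1 where K1: "0 < K1" "\<And>n m. 1 \<le> n \<Longrightarrow> m \<le> 2 * n \<Longrightarrow>
      ennreal (K1 * \<psi> n) \<le> best_orth_approx_class m (class_L \<psi> \<beta>) s"
    using lower_bound [OF assms] by blast
  obtain K2 where K2: "0 < K2" "\<And>n. 1 \<le> n \<Longrightarrow>
      best_orth_approx_class (2 * n) (class_L \<psi> \<beta>) s \<le> ennreal (K2 * \<psi> n) \<and>
      best_orth_approx_class (2 * n - 1) (class_L \<psi> \<beta>) s \<le> ennreal (K2 * \<psi> n)"
    using upper_bound [of \<psi> s \<beta>] assms by blast
  show ?thesis
    by (rule exI [of _ K1], rule conjI [OF K1(1)], rule exI [of _ K2], rule conjI [OF K2(1)])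
       (use K1(2) K2(2) in simp)
qed

end
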